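(* Given a directed series-parallel graph $G=(V,E)$ and a retention ratio $\alpha\in(0,1)$, Algorithm 1 (described in the context) returns an optimal solution of the MCPS instance $(G,\alpha)$ and runs in $O(|V|)$ time.
   Context: All graphs are simple and all edge capacities are $1$; $\lambda_H(s,t)$ denotes the maximum number of edge-disjoint directed $s$-$t$-paths in $H$. MCPS: given a directed graph $G=(V,E)$ and $\alpha\in(0,1)$, find a minimum-cardinality $E'\subseteq E$ with $\lambda_{(V,E')}(s,t)\ge\alpha\lambda_G(s,t)$ for all $(s,t)\in V^2$. A vertex pair $(s,t)$ is covered by an edge set $F$ if $\lambda_{(V,F)}(s,t)\ge\alpha\lambda_G(s,t)$. A directed $s$-$t$-series-parallel graph (DSP) is a single edge $st$, or arises from the disjoint union of a directed $s_1$-$t_1$- and a directed $s_2$-$t_2$-series-parallel graph by identifying $s_1$ with $s_2$ and $t_1$ with $t_2$ (P-composition, $s=s_1,t=t_1$) or by identifying $t_1$ with $s_2$ (S-composition, $s=s_1,t=t_2$). A series-parallel decomposition tree of $G$ is a rooted binary tree whose leaves correspond to the single edges of $G$ and whose inner nodes are S- or P-compositions of the graphs of their children, the root yielding $G$; each node corresponds to a subgraph $H$ with terminal pair $(s,t)$. The tree is clean if, whenever an $s$-$t$-DSP arises by P-compositions of several $s$-$t$-DSPs $H_0,\dots,H_k$ with $E(H_0)=\{st\}$, the graphs $H_1,\dots,H_k$ are first composed into a common $s$-$t$-DSP $H$ which is then P-composed with $H_0$. Algorithm 1: set $E'\leftarrow E$; compute a clean series-parallel decomposition tree $T$ of $G$;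 traverse the nodes $\sigma$ of $T$ bottom-up; for each node, let $H$ and $(s,t)$ be its graph and terminal pair; if $\sigma$ is a P-composition, $st\in E(H)$, and $(s,t)$ is covered by $(E'\cap E(H))\setminus\{st\}$, remove $st$ from $E'$; finally return $E'$. *)

theory Defs
  imports Complex_Main "Graph_Theory.Graph_Theory"
begin

section \<open>Minimum capacity-preserving subgraphs\<close>

text \<open>For \<open>s = t\<close> the only path is the empty one, so \<open>max_paths H s s = 1\<close> for every finite \<open>H\<close>
  containing \<open>s\<close>, and the pair \<open>(s, s)\<close> imposes no constraint below.\<close>

definition max_paths :: "'a pair_pre_digraph \<Rightarrow> 'a \<Rightarrow> 'a \<Rightarrow> nat" where
  "max_paths H s t = Max {card P | P. (\<forall>p\<in>P. pre_digraph.apath (with_proj H) s p t) \<and>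
     pairwise (\<lambda>p q. set p \<inter> set q = {}) P}"

definition covered :: "real \<Rightarrow> 'a pair_pre_digraph \<Rightarrow> ('a \<times> 'a) set \<Rightarrow> 'a \<Rightarrow> 'a \<Rightarrow> bool" where
  "covered \<alpha> G F s t \<longleftrightarrow>
     real (max_paths \<lparr>pverts = pverts G, parcs = F\<rparr> s t) \<ge> \<alpha> * real (max_paths G s t)"

definition mcps_feasible :: "real \<Rightarrow> 'a pair_pre_digraph \<Rightarrow> ('a \<times> 'a) set \<Rightarrow> bool" where
  "mcps_feasible \<alpha> G F \<longleftrightarrow>
     F \<subseteq> parcs G \<and> (\<forall>s\<in>pverts G. \<forall>t\<in>pverts G. covered \<alpha> G F s t)"

definition mcps_optimal :: "real \<Rightarrow> 'a pair_pre_digraph \<Rightarrow> ('a \<times> 'a) set \<Rightarrow> bool" where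
  "mcps_optimal \<alpha> G F \<longleftrightarrow>
     mcps_feasible \<alpha> G F \<and> (\<forall>F'. mcps_feasible \<alpha> G F' \<longrightarrow> card F \<le> card F')"


section \<open>Directed series-parallel graphs\<close>

definition single_edge :: "'a \<Rightarrow> 'a \<Rightarrow> 'a pair_pre_digraph" where
  "single_edge s t = \<lparr>pverts = {s, t}, parcs = {(s, t)}\<rparr>"

definition graph_union ::
    "'a pair_pre_digraph \<Rightarrow> 'a pair_pre_digraph \<Rightarrow> 'a pair_pre_digraph" where
  "graph_union H K = \<lparr>pverts = pverts H \<union> pverts K, parcs = parcs H \<union> parcs K\<rparr>"

text \<open>Compositions are taken internally: the two parts already share exactly the identified
  terminals. Graphs being simple, two parts of a P-composition must not both contain the edge
  between their terminals; this is the disjointness condition on arcs.\<close>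

inductive dsp :: "'a \<Rightarrow> 'a \<Rightarrow> 'a pair_pre_digraph \<Rightarrow> bool" where
  edge: "s \<noteq> t \<Longrightarrow> dsp s t (single_edge s t)"
| parallel: "dsp s t H \<Longrightarrow> dsp s t K \<Longrightarrow> pverts H \<inter> pverts K = {s, t} \<Longrightarrow>
    parcs H \<inter> parcs K = {} \<Longrightarrow> dsp s t (graph_union H K)"
| series: "dsp s u H \<Longrightarrow> dsp u t K \<Longrightarrow> pverts H \<inter> pverts K = {u} \<Longrightarrow>
    dsp s t (graph_union H K)"

definition directed_series_parallel :: "'a pair_pre_digraph \<Rightarrow> bool" where
  "directed_series_parallel G \<longleftrightarrow> (\<exists>s t. dsp s t G)"


section \<open>Decomposition trees\<close>

datatype 'a sptree = Leaf "'a \<times> 'a" | Ser "'a sptree" "'a sptree" | Par "'a sptree" "'a sptree"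

fun tree_source :: "'a sptree \<Rightarrow> 'a" where
  "tree_source (Leaf e) = fst e"
| "tree_source (Ser l r) = tree_source l"
| "tree_source (Par l r) = tree_source l"

fun tree_sink :: "'a sptree \<Rightarrow> 'a" where
  "tree_sink (Leaf e) = snd e"
| "tree_sink (Ser l r) = tree_sink r"
| "tree_sink (Par l r) = tree_sink l"

fun tree_graph :: "'a sptree \<Rightarrow> 'a pair_pre_digraph" where
  "tree_graph (Leaf e) = single_edge (fst e) (snd e)"
| "tree_graph (Ser l r) = graph_union (tree_graph l) (tree_graph r)"
| "tree_graph (Par l r) = graph_union (tree_graph l) (tree_graph r)"

fun sp_tree :: "'a sptree \<Rightarrow> bool" where
  "sp_tree (Leaf e) \<longleftrightarrow> fst e \<noteq> snd e"
| "sp_tree (Ser l r) \<longleftrightarrow> sp_tree l \<and> sp_tree r \<and> tree_sink l = tree_source r \<and>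
     pverts (tree_graph l) \<inter> pverts (tree_graph r) = {tree_sink l}"
| "sp_tree (Par l r) \<longleftrightarrow> sp_tree l \<and> sp_tree r \<and>
     tree_source l = tree_source r \<and> tree_sink l = tree_sink r \<and>
     pverts (tree_graph l) \<inter> pverts (tree_graph r) = {tree_source l, tree_sink l} \<and>
     parcs (tree_graph l) \<inter> parcs (tree_graph r) = {}"

text \<open>The graphs \<open>H\<^sub>0, \<dots>, H\<^sub>k\<close> from which a node arises by P-compositions only.\<close>

fun par_parts :: "'a sptree \<Rightarrow> 'a sptree set" where
  "par_parts (Par l r) = par_parts l \<union> par_parts r"
| "par_parts (Leaf e) = {Leaf e}"
| "par_parts (Ser l r) = {Ser l r}"

text \<open>If a single edge is among these graphs, it must enter in the topmost P-composition, the
  other child of which is then the composition of all remaining ones. Children are unordered.\<close>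

fun clean :: "'a sptree \<Rightarrow> bool" where
  "clean (Leaf e) \<longleftrightarrow> True"
| "clean (Ser l r) \<longleftrightarrow> clean l \<and> clean r"
| "clean (Par l r) \<longleftrightarrow> clean l \<and> clean r \<and>
     (\<forall>e. Leaf e \<in> par_parts (Par l r) \<longrightarrow> l = Leaf e \<or> r = Leaf e)"

definition clean_decomposition_tree :: "'a pair_pre_digraph \<Rightarrow> 'a sptree \<Rightarrow> bool" where
  "clean_decomposition_tree G T \<longleftrightarrow> sp_tree T \<and> clean T \<and> tree_graph T = G"


section \<open>The algorithm\<close>

text \<open>The nodes of a tree satisfying \<^const>\<open>sp_tree\<close> have pairwise different arc sets, so a node
  can be identified with the subtree rooted at it.\<close>

fun nodes :: "'a sptree \<Rightarrow> 'a sptree set" where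
  "nodes (Leaf e) = {Leaf e}"
| "nodes (Ser l r) = insert (Ser l r) (nodes l \<union> nodes r)"
| "nodes (Par l r) = insert (Par l r) (nodes l \<union> nodes r)"

text \<open>Every node occurs exactly once, and after all nodes below it (a repeated node would violate
  the second condition because \<open>\<sigma> \<in> nodes \<sigma>\<close>).\<close>

definition bottom_up :: "'a sptree \<Rightarrow> 'a sptree list \<Rightarrow> bool" where
  "bottom_up T \<sigma>s \<longleftrightarrow> set \<sigma>s = nodes T \<and> sorted_wrt (\<lambda>\<sigma> \<tau>. \<tau> \<notin> nodes \<sigma>) \<sigma>s"

definition process_node ::
    "real \<Rightarrow> 'a pair_pre_digraph \<Rightarrow> 'a sptree \<Rightarrow> ('a \<times> 'a) set \<Rightarrow> ('a \<times> 'a) set" where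
  "process_node \<alpha> G \<sigma> E' =
     (let H = tree_graph \<sigma>; s = tree_source \<sigma>; t = tree_sink \<sigma> in
      if (\<exists>l r. \<sigma> = Par l r) \<and> (s, t) \<in> parcs H \<and>
         covered \<alpha> G ((E' \<inter> parcs H) - {(s, t)}) s t
      then E' - {(s, t)} else E')"

definition retained_edges ::
    "real \<Rightarrow> 'a pair_pre_digraph \<Rightarrow> 'a sptree list \<Rightarrow> ('a \<times> 'a) set" where
  "retained_edges \<alpha> G \<sigma>s = fold (process_node \<alpha> G) \<sigma>s (parcs G)"

text \<open>The choice of the clean tree and of the bottom-up order is left open by the algorithm.\<close>

definition algorithm_returns :: "real \<Rightarrow> 'a pair_pre_digraph \<Rightarrow> ('a \<times> 'a) set \<Rightarrow> bool" where
  "algorithm_returns \<alpha> G E' \<longleftrightarrow>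
     (\<exists>T \<sigma>s. clean_decomposition_tree G T \<and> bottom_up T \<sigma>s \<and> E' = retained_edges \<alpha> G \<sigma>s)"


section \<open>Unit-cost random access programs\<close>

text \<open>A fixed finite program over finitely many arrays of natural numbers; a scalar is an array
  used at index 0 only. Arithmetic is restricted to addition and truncated subtraction. The real
  number \<open>\<alpha>\<close> is accessible only through the comparison \<open>AtLeastAlpha a b\<close>, that is
  \<open>a \<ge> \<alpha> \<cdot> b\<close>. A step evaluates a bounded number of fixed expressions, each of which costs
  a constant depending on the program alone.\<close>

type_synonym memory = "string \<Rightarrow> nat \<Rightarrow> nat"

datatype aexp = Const nat | Read string aexp | Plus aexp aexp | Minus aexp aexp

datatype bexp = Less aexp aexp | AtLeastAlpha aexp aexp | Not bexp | And bexp bexp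

datatype program =
    Skip
  | Write string aexp aexp
  | Seq program program
  | Cond bexp program program
  | While bexp program

fun aval :: "memory \<Rightarrow> aexp \<Rightarrow> nat" where
  "aval M (Const k) = k"
| "aval M (Read x a) = M x (aval M a)"
| "aval M (Plus a b) = aval M a + aval M b"
| "aval M (Minus a b) = aval M a - aval M b"

fun bval :: "real \<Rightarrow> memory \<Rightarrow> bexp \<Rightarrow> bool" where
  "bval \<alpha> M (Less a b) \<longleftrightarrow> aval M a < aval M b"
| "bval \<alpha> M (AtLeastAlpha a b) \<longleftrightarrow> real (aval M a) \<ge> \<alpha> * real (aval M b)"
| "bval \<alpha> M (Not p) \<longleftrightarrow> \<not> bval \<alpha> M p"
| "bval \<alpha> M (And p q) \<longleftrightarrow> bval \<alpha> M p \<and> bval \<alpha> M q"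

fun step :: "real \<Rightarrow> program \<times> memory \<Rightarrow> program \<times> memory" where
  "step \<alpha> (Skip, M) = (Skip, M)"
| "step \<alpha> (Write x a b, M) = (Skip, M(x := (M x)(aval M a := aval M b)))"
| "step \<alpha> (Seq c d, M) =
     (if c = Skip then (d, M) else let (c', M') = step \<alpha> (c, M) in (Seq c' d, M'))"
| "step \<alpha> (Cond p c d, M) = (if bval \<alpha> M p then c else d, M)"
| "step \<alpha> (While p c, M) = (if bval \<alpha> M p then Seq c (While p c) else Skip, M)"

definition run :: "real \<Rightarrow> program \<Rightarrow> memory \<Rightarrow> nat \<Rightarrow> program \<times> memory" where
  "run \<alpha> c M k = (step \<alpha> ^^ k) (c, M)"


section \<open>Executing the algorithm on such a machine\<close>

text \<open>The input graph is an arbitrarily ordered list of edges between arbitrarily numbered vertices;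
  terminals are not supplied. All other memory cells are 0.\<close>

definition graph_encoding ::
    "'a pair_pre_digraph \<Rightarrow> ('a \<Rightarrow> nat) \<Rightarrow> ('a \<times> 'a) list \<Rightarrow> bool" where
  "graph_encoding G \<nu> es \<longleftrightarrow>
     bij_betw \<nu> (pverts G) {..<card (pverts G)} \<and> distinct es \<and> set es = parcs G"

definition input :: "'a pair_pre_digraph \<Rightarrow> ('a \<Rightarrow> nat) \<Rightarrow> ('a \<times> 'a) list \<Rightarrow> memory" where
  "input G \<nu> es x i =
     (if x = ''n'' \<and> i = 0 then card (pverts G)
      else if x = ''m'' \<and> i = 0 then length es
      else if x = ''tail'' \<and> i < length es then \<nu> (fst (es ! i))
      else if x = ''head'' \<and> i < length es then \<nu> (snd (es ! i))
      else 0)"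

text \<open>The tree is stored as linked records in three arrays, with a leaf pointing to its edge.\<close>

fun holds_tree :: "('a \<times> 'a) list \<Rightarrow> memory \<Rightarrow> 'a sptree \<Rightarrow> nat \<Rightarrow> bool" where
  "holds_tree es M (Leaf e) a \<longleftrightarrow>
     M ''kind'' a = 0 \<and> M ''left'' a < length es \<and> es ! M ''left'' a = e"
| "holds_tree es M (Ser l r) a \<longleftrightarrow>
     M ''kind'' a = 1 \<and> holds_tree es M l (M ''left'' a) \<and> holds_tree es M r (M ''right'' a)"
| "holds_tree es M (Par l r) a \<longleftrightarrow>
     M ''kind'' a = 2 \<and> holds_tree es M l (M ''left'' a) \<and> holds_tree es M r (M ''right'' a)"

definition holds_edges :: "('a \<times> 'a) list \<Rightarrow> memory \<Rightarrow> ('a \<times> 'a) set \<Rightarrow> bool" where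
  "holds_edges es M F \<longleftrightarrow>
     (\<forall>j<length es. M ''E'' j = (if es ! j \<in> F then 1 else 0))"

text \<open>The program follows the algorithm node by node: there are times
  \<open>\<theta> 0 < \<theta> 1 < \<dots>\<close> such that at time \<open>\<theta> 0\<close> a clean decomposition tree has been computed, and at
  time \<open>\<theta> k\<close> the first \<open>k\<close> nodes have been processed. It has halted at time \<open>B\<close> with the result in
  memory.\<close>

definition executes_algorithm_within :: "real \<Rightarrow> 'a pair_pre_digraph \<Rightarrow> ('a \<Rightarrow> nat) \<Rightarrow>
    ('a \<times> 'a) list \<Rightarrow> program \<Rightarrow> nat \<Rightarrow> bool" where
  "executes_algorithm_within \<alpha> G \<nu> es c B \<longleftrightarrow>
     (\<exists>T \<sigma>s \<theta>. clean_decomposition_tree G T \<and> bottom_up T \<sigma>s \<and>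
        (\<forall>k<length \<sigma>s. \<theta> k < \<theta> (Suc k)) \<and> \<theta> (length \<sigma>s) \<le> B \<and>
        (\<forall>k\<le>length \<sigma>s. let M = snd (run \<alpha> c (input G \<nu> es) (\<theta> k)) in
           holds_tree es M T (M ''root'' 0) \<and>
           holds_edges es M (retained_edges \<alpha> G (take k \<sigma>s))) \<and>
        fst (run \<alpha> c (input G \<nu> es) (\<theta> (length \<sigma>s))) = Skip)"

end

theory Submission
  imports Defs
begin

text \<open>
  A path between two vertices of a node of the decomposition tree stays inside the node, unless it joins
  the terminals of a node that is composed in parallel with others. Hence maximum flows between terminals
  are minima at S-nodes and sums at P-nodes, and the algorithm's test at a P-node is a test on its subtree.
  Feasibility follows by induction on the tree. For optimality, one shows at every node \<open>H\<close> that a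
  feasible \<open>F\<close> has at least \<open>max 0 (f - e)\<close> more edges in \<open>H\<close> than the result of the algorithm, where
  \<open>f\<close> and \<open>e\<close> are the flows between the terminals of \<open>H\<close> inside the two solutions.

  For the running time, a vertex with a single incoming and a single outgoing edge is eliminated as long
  as there is one, replacing the two edges by a single one. The remaining graph stays series-parallel, so
  this only stops at a single edge. Parallel edges are recognised in constant time by a
  matrix of initially zero memory cells, and the neighbours of a vertex of degree one by maintaining sums
  of neighbours. At most one original edge runs between two vertices; it is kept apart from
  the composed graph between them until one of them is eliminated, which makes the tree clean.
\<close>

section \<open>Edge-disjoint paths\<close>

text \<open>Cleanness makes the test of the algorithm local. A removable edge is a child of a P-node
  whose other child contains all remaining parallel parts, so this P-node is not a part of a larger
  P-composition. All paths between its terminals stay inside it, and the flow of the whole graph, to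
  which coverage refers, equals the flow inside the node. At other P-nodes this can fail, but
  nothing is tested there.

  Both inductions break down at a leaf whose edge is missing from the set in question; such a leaf
  is therefore treated together with its parent. If the algorithm keeps an edge that a feasible
  \<open>F\<close> lacks, then \<open>F\<close> has more flow in the sibling of the leaf, and this
  surplus has already been paid for by edges. This is why the difference of flows enters the count.

  The time is linear because a series-parallel graph on \<open>n\<close> vertices has at most
  \<open>2n - 3\<close> edges, every round of the reduction eliminates a vertex, and tree nodes are
  allocated in an order that is already bottom-up, so that one pass with stored flows performs all
  tests.\<close>

text \<open>A path is represented by any arc set that connects its ends; thus a packing of edge-disjoint
  paths becomes a family of disjoint arc sets.\<close>

definition packing :: "nat \<Rightarrow> ('a \<times> 'a) set \<Rightarrow> 'a \<Rightarrow> 'a \<Rightarrow> bool" where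
  "packing k F x y \<longleftrightarrow> (\<exists>D. (\<forall>i<k. D i \<subseteq> F \<and> (x, y) \<in> (D i)\<^sup>*) \<and>
     (\<forall>i<k. \<forall>j<k. i \<noteq> j \<longrightarrow> D i \<inter> D j = {}))"

text \<open>For \<open>x = y\<close> empty arc sets form packings of every size, so the set is
  unbounded and \<open>Max\<close> says nothing. Hence \<open>x \<noteq> y\<close> is assumed or
  implied wherever the value matters, and the pairs \<open>(s, s)\<close> are treated
  separately.\<close>

definition flow :: "('a \<times> 'a) set \<Rightarrow> 'a \<Rightarrow> 'a \<Rightarrow> nat" where
  "flow F x y = Max {k. packing k F x y}"

lemma packingE:
  assumes "packing k F x y"
  obtains D where "\<And>i. i < k \<Longrightarrow> D i \<subseteq> F" "\<And>i. i < k \<Longrightarrow> (x, y) \<in> (D i)\<^sup>*"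
    "\<And>i j. i < k \<Longrightarrow> j < k \<Longrightarrow> i \<noteq> j \<Longrightarrow> D i \<inter> D j = {}"
proof -
  obtain D where D: "\<forall>i<k. D i \<subseteq> F \<and> (x, y) \<in> (D i)\<^sup>*"
    "\<forall>i<k. \<forall>j<k. i \<noteq> j \<longrightarrow> D i \<inter> D j = {}"
    using assms unfolding packing_def by (elim exE conjE)
  show ?thesis by (rule that[of D]) (use D in simp_all)
qed

text \<open>Admits families indexed by any finite set, such as a set of paths, a subset of the
  indices of another packing, or a disjoint sum of two index ranges.\<close>

lemma packing_indexed:
  assumes "finite I" "\<And>i. i \<in> I \<Longrightarrow> D i \<subseteq> F \<and> (x, y) \<in> (D i)\<^sup>*"
    "\<And>i j. i \<in> I \<Longrightarrow> j \<in> I \<Longrightarrow> i \<noteq> j \<Longrightarrow> D i \<inter> D j = {}"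
  shows "packing (card I) F x y"
proof -
  obtain h where h: "bij_betw h {0..<card I} I"
    using ex_bij_betw_nat_finite[OF assms(1)] by blast
  have "\<forall>i<card I. h i \<in> I" using h by (auto simp: bij_betw_def)
  moreover have "\<forall>i<card I. \<forall>j<card I. i \<noteq> j \<longrightarrow> h i \<noteq> h j"
    using h by (auto simp: bij_betw_def inj_on_def)
  ultimately show ?thesis
    unfolding packing_def using assms(2,3)
    by (intro exI[of _ "\<lambda>i. D (h i)"]) blast
qed

lemma packing_0 [simp]: "packing 0 F x y"
  by (simp add: packing_def)

lemma packing_antimono: "packing k F x y \<Longrightarrow> j \<le> k \<Longrightarrow> packing j F x y"
  unfolding packing_def by (meson less_le_trans)

lemma packing_mono: "packing k F x y \<Longrightarrow> F \<subseteq> F' \<Longrightarrow> packing k F' x y"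
  unfolding packing_def by (meson subset_trans)

text \<open>Since \<open>x \<noteq> y\<close>, no connecting arc set is empty; one arc chosen from
  each gives an injection into \<open>F\<close>.\<close>

lemma packing_card:
  assumes "packing k F x y" "finite F" "x \<noteq> y"
  shows "k \<le> card F"
proof -
  obtain D where D: "\<forall>i<k. D i \<subseteq> F \<and> (x, y) \<in> (D i)\<^sup>*"
      "\<forall>i<k. \<forall>j<k. i \<noteq> j \<longrightarrow> D i \<inter> D j = {}"
    using assms(1) unfolding packing_def by blast
  have "\<forall>i<k. \<exists>e. e \<in> D i"
    using D(1) assms(3) by (metis ex_in_conv rtrancl_empty pair_in_Id_conv)
  then obtain e where e: "\<forall>i<k. e i \<in> D i" by metis
  have "inj_on e {..<k}" using e D(2) by (fastforce simp: inj_on_def)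
  moreover have "e ` {..<k} \<subseteq> F" using e D(1) by blast
  ultimately show ?thesis using card_inj_on_le[OF _ _ assms(2)] by fastforce
qed

lemma finite_packings: "finite F \<Longrightarrow> x \<noteq> y \<Longrightarrow> finite {k. packing k F x y}"
  by (rule finite_subset[of _ "{..card F}"]) (auto dest: packing_card)

text \<open>Packings may be thinned out, so their sizes form an initial segment of the naturals.
  Flows are compared through this equivalence from here on.\<close>

lemma le_flow_iff:
  assumes "finite F" "x \<noteq> y"
  shows "k \<le> flow F x y \<longleftrightarrow> packing k F x y"
proof
  have ne: "{k. packing k F x y} \<noteq> {}" using packing_0 by (metis empty_iff mem_Collect_eq)
  show "k \<le> flow F x y \<Longrightarrow> packing k F x y"
    using Max_in[OF finite_packings[OF assms] ne] unfolding flow_def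
    by (blast intro: packing_antimono)
  show "packing k F x y \<Longrightarrow> k \<le> flow F x y"
    unfolding flow_def by (rule Max_ge[OF finite_packings[OF assms]]) simp
qed

lemma flow_eqI:
  assumes "finite F" "x \<noteq> y" "\<And>k. packing k F x y \<longleftrightarrow> k \<le> f"
  shows "flow F x y = f"
  using le_flow_iff[OF assms(1,2)] assms(3) by (metis order_antisym order_refl)

lemma flow_le_card: "finite F \<Longrightarrow> x \<noteq> y \<Longrightarrow> flow F x y \<le> card F"
  using le_flow_iff packing_card order_refl by metis

text \<open>Intersecting the sets of a packing with \<open>A\<close> keeps them disjoint, so it
  suffices that each single connecting set can be cut down to \<open>A\<close>.\<close>

lemma flow_local:
  assumes "finite F" "x \<noteq> y" "\<And>X. X \<subseteq> F \<Longrightarrow> (x, y) \<in> X\<^sup>* \<Longrightarrow> (x, y) \<in> (X \<inter> A)\<^sup>*"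
  shows "flow F x y = flow (F \<inter> A) x y"
proof (rule flow_eqI[OF assms(1,2)])
  fix k
  have "packing k F x y \<longleftrightarrow> packing k (F \<inter> A) x y"
  proof
    assume "packing k F x y"
    then obtain D where "\<forall>i<k. D i \<subseteq> F \<and> (x, y) \<in> (D i)\<^sup>*"
      "\<forall>i<k. \<forall>j<k. i \<noteq> j \<longrightarrow> D i \<inter> D j = {}"
      unfolding packing_def by blast
    then show "packing k (F \<inter> A) x y"
      unfolding packing_def using assms(3)
      by (intro exI[of _ "\<lambda>i. D i \<inter> A"]) blast
  qed (erule packing_mono, blast)
  then show "packing k F x y \<longleftrightarrow> k \<le> flow (F \<inter> A) x y"
    using le_flow_iff assms(1,2) by (metis finite_Int)
qed

lemma flow_arc:
  assumes "x \<noteq> y" "F \<subseteq> {(x, y)}"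
  shows "flow F x y = card F"
proof (cases "F = {}")
  case True
  then show ?thesis using flow_le_card[of F x y] assms by simp
next
  case False
  then have F: "F = {(x, y)}" using assms by blast
  have "packing 1 F x y" unfolding packing_def F
    by (intro exI[of _ "\<lambda>_. {(x, y)}"]) auto
  then show ?thesis using flow_le_card[of F x y] le_flow_iff[of F x y 1] assms F by simp
qed

lemma flow_unreachable:
  assumes "finite F" "(x, y) \<notin> F\<^sup>*"
  shows "flow F x y = 0"
proof (rule flow_eqI)
  show "packing k F x y \<longleftrightarrow> k \<le> 0" for k
  proof
    assume "packing k F x y"
    then have "k = 0 \<or> (x, y) \<in> F\<^sup>*"
      unfolding packing_def by (metis bot_nat_0.not_eq_extremum rtrancl_mono subsetD)
    then show "k \<le> 0" using assms by simp
  qed simp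
qed (use assms in auto)

text \<open>Reachability yields a walk that may repeat vertices; cutting out its cycles leaves a
  path on a subset of the same arcs. This is the bridge between the paths of the library and the arc
  sets of \<open>packing\<close>.\<close>

lemma apath_iff_connecting:
  assumes "pair_wf_digraph H" "x \<in> pverts H"
  shows "(\<exists>p. pre_digraph.apath (with_proj H) x p y \<and> set p \<subseteq> D) \<longleftrightarrow> (x, y) \<in> (D \<inter> parcs H)\<^sup>*"
proof
  interpret pair_wf_digraph H by fact
  have walk: "(u, y) \<in> (D \<inter> parcs H)\<^sup>*" if "cas u p y" "set p \<subseteq> D" "set p \<subseteq> parcs H" for u p
    using that
  proof (induction p arbitrary: u)
    case (Cons e p)
    then have "(u, snd e) \<in> D \<inter> parcs H" "(snd e, y) \<in> (D \<inter> parcs H)\<^sup>*" by auto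
    then show ?case by (rule converse_rtrancl_into_rtrancl)
  qed simp
  show "\<exists>p. apath x p y \<and> set p \<subseteq> D \<Longrightarrow> (x, y) \<in> (D \<inter> parcs H)\<^sup>*"
    using walk by (auto simp: apath_def awalk_def)
  assume "(x, y) \<in> (D \<inter> parcs H)\<^sup>*"
  then have "x \<in> pverts H \<longrightarrow> (\<exists>p. awalk x p y \<and> set p \<subseteq> D)"
  proof (induction rule: converse_rtrancl_induct)
    case base
    show ?case by (metis awalk_Nil_iff empty_set empty_subsetI with_proj_simps(1))
  next
    case (step u v)
    then obtain p where "awalk v p y" "set p \<subseteq> D" using in_arcsD2 by auto
    then have "awalk u ((u, v) # p) y \<and> set ((u, v) # p) \<subseteq> D"
      using step(1) in_arcsD1 by (auto simp: awalk_Cons_iff)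
    then show ?case by blast
  qed
  then obtain p where p: "awalk x p y" "set p \<subseteq> D" using assms(2) by blast
  show "\<exists>p. apath x p y \<and> set p \<subseteq> D"
    using apath_awalk_to_apath[OF p(1)] awalk_to_apath_subset[OF p(1)] p(2) by blast
qed

lemma finite_apaths:
  assumes "pair_wf_digraph H" "finite (pverts H)" "finite (parcs H)"
  shows "finite {p. pre_digraph.apath (with_proj H) x p y}"
proof -
  interpret pair_wf_digraph H by fact
  interpret pair_fin_digraph H
    by unfold_locales (use assms in \<open>auto simp: pair_fin_digraph_axioms_def\<close>)
  show ?thesis by (rule apaths_finite)
qed

text \<open>The only path from \<open>s\<close> to \<open>s\<close> is the empty list. As pairwise
  disjointness concerns distinct paths only, the admissible sets are \<open>{}\<close> and
  \<open>{[]}\<close>.\<close>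

lemma max_paths_self:
  assumes "pair_wf_digraph H" "s \<in> pverts H"
  shows "max_paths H s s = 1"
proof -
  interpret pair_wf_digraph H by fact
  have p: "apath s p s \<longleftrightarrow> p = []" for p
  proof
    assume "apath s p s"
    then show "p = []" using apath_nonempty_ends by blast
  qed (use assms in \<open>simp add: apath_Nil_iff\<close>)
  have "{card P | P. (\<forall>p\<in>P. apath s p s) \<and> pairwise (\<lambda>p q. set p \<inter> set q = {}) P} = {0, 1}"
  proof (intro equalityI subsetI)
    fix k assume "k \<in> {card P | P. (\<forall>p\<in>P. apath s p s) \<and> pairwise (\<lambda>p q. set p \<inter> set q = {}) P}"
    then obtain P where "k = card P" "\<forall>p\<in>P. apath s p s" by blast
    then have "k = card P" "P \<subseteq> {[]}" using p by auto
    then have "k = card P" "P = {} \<or> P = {[]}" by auto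
    then show "k \<in> {0, 1}" by auto
  next
    fix k :: nat assume "k \<in> {0, 1}"
    then have "k = card (if k = 0 then {} else {[] :: ('a \<times> 'a) list})" by auto
    then show "k \<in> {card P | P. (\<forall>p\<in>P. apath s p s) \<and> pairwise (\<lambda>p q. set p \<inter> set q = {}) P}"
      using p by (intro CollectI exI[of _ "if k = 0 then {} else {[] :: ('a \<times> 'a) list}"])
        (auto simp: pairwise_def)
  qed
  then show ?thesis unfolding max_paths_def by simp
qed

lemma max_paths_eq_flow:
  assumes "pair_wf_digraph H" "finite (pverts H)" "finite (parcs H)" "x \<in> pverts H" "x \<noteq> y"
  shows "max_paths H x y = flow (parcs H) x y"
proof -
  interpret pair_wf_digraph H by fact
  have "{card P | P. (\<forall>p\<in>P. apath x p y) \<and> pairwise (\<lambda>p q. set p \<inter> set q = {}) P} =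
    {k. packing k (parcs H) x y}"
  proof (intro equalityI subsetI)
    fix k assume "k \<in> {card P | P. (\<forall>p\<in>P. apath x p y) \<and> pairwise (\<lambda>p q. set p \<inter> set q = {}) P}"
    then obtain P where P: "k = card P" "\<forall>p\<in>P. apath x p y"
      "pairwise (\<lambda>p q. set p \<inter> set q = {}) P" by blast
    have "finite P" by (rule finite_subset[OF _ finite_apaths[OF assms(1-3)]]) (use P(2) in blast)
    then have "packing (card P) (parcs H) x y"
    proof (rule packing_indexed[where D = set])
      fix p assume "p \<in> P"
      then have "apath x p y \<and> set p \<subseteq> set p" using P(2) by blast
      then show "set p \<subseteq> parcs H \<and> (x, y) \<in> (set p)\<^sup>*"
        using apath_iff_connecting[OF assms(1,4), of y "set p"]
        by (metis apath_def awalk_def inf.orderE with_proj_simps(2))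
    qed (use P(3) in \<open>auto simp: pairwise_def\<close>)
    then show "k \<in> {k. packing k (parcs H) x y}" using P(1) by simp
  next
    fix k assume "k \<in> {k. packing k (parcs H) x y}"
    then obtain D where D: "\<forall>i<k. D i \<subseteq> parcs H \<and> (x, y) \<in> (D i)\<^sup>*"
      "\<forall>i<k. \<forall>j<k. i \<noteq> j \<longrightarrow> D i \<inter> D j = {}" unfolding packing_def by blast
    have "\<forall>i<k. \<exists>p. apath x p y \<and> set p \<subseteq> D i"
      using apath_iff_connecting[OF assms(1,4)] D(1) by (metis inf.orderE)
    then obtain p where p: "\<forall>i<k. apath x (p i) y \<and> set (p i) \<subseteq> D i" by metis
    \<comment> \<open>Disjoint arc sets belong to different paths only if they are nonempty, which
      is where \<open>x \<noteq> y\<close> is needed; so there are really \<open>k\<close>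
      paths.\<close>
    have ne: "\<forall>i<k. set (p i) \<noteq> {}" using p assms(5)
      by (metis apath_Nil_iff set_empty)
    have disj: "\<forall>i<k. \<forall>j<k. i \<noteq> j \<longrightarrow> set (p i) \<inter> set (p j) = {}" using p D(2) by blast
    then have "inj_on p {..<k}" using ne by (fastforce simp: inj_on_def)
    then have "k = card (p ` {..<k})" by (simp add: card_image)
    moreover have "pairwise (\<lambda>p q. set p \<inter> set q = {}) (p ` {..<k})"
      using disj by (auto simp: pairwise_def)
    ultimately show "k \<in> {card P | P. (\<forall>p\<in>P. apath x p y) \<and> pairwise (\<lambda>p q. set p \<inter> set q = {}) P}"
      using p by blast
  qed
  then show ?thesis unfolding max_paths_def flow_def by simp
qed

section \<open>Paths in decomposition trees\<close>

abbreviation tverts :: "'a sptree \<Rightarrow> 'a set" where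
  "tverts \<sigma> \<equiv> pverts (tree_graph \<sigma>)"

abbreviation tarcs :: "'a sptree \<Rightarrow> ('a \<times> 'a) set" where
  "tarcs \<sigma> \<equiv> parcs (tree_graph \<sigma>)"

section \<open>Vertices, arcs and terminals of decomposition trees\<close>

lemma tree_graph_sel [simp]:
  "tverts (Leaf e) = {fst e, snd e}" "tarcs (Leaf e) = {e}"
  "tverts (Ser l r) = tverts l \<union> tverts r" "tarcs (Ser l r) = tarcs l \<union> tarcs r"
  "tverts (Par l r) = tverts l \<union> tverts r" "tarcs (Par l r) = tarcs l \<union> tarcs r"
  by (simp_all add: single_edge_def graph_union_def)

declare tree_graph.simps [simp del]

lemma finite_tree [simp]: "finite (tverts \<sigma>)" "finite (tarcs \<sigma>)"
  by (induction \<sigma>) auto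

lemma terminals_in_tverts [simp]:
  "tree_source \<sigma> \<in> tverts \<sigma>" "sp_tree \<sigma> \<Longrightarrow> tree_sink \<sigma> \<in> tverts \<sigma>"
  by (induction \<sigma>) auto

lemma tarcs_nonempty: "tarcs \<sigma> \<noteq> {}"
  by (induction \<sigma>) auto

lemma tarcs_in_tverts: "(x, y) \<in> tarcs \<sigma> \<Longrightarrow> x \<in> tverts \<sigma> \<and> y \<in> tverts \<sigma>"
  by (induction \<sigma>) auto

lemma terminals_neq: "sp_tree \<sigma> \<Longrightarrow> tree_source \<sigma> \<noteq> tree_sink \<sigma>"
proof (induction \<sigma>)
  case (Ser l r)
  show ?case
  proof
    assume "tree_source (Ser l r) = tree_sink (Ser l r)"
    then have "tree_source l = tree_sink r" by simp
    then have "tree_source l \<in> tverts r" using Ser.prems by simp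
    then have "tree_source l \<in> tverts l \<inter> tverts r" using terminals_in_tverts(1)[of l] by blast
    then show False using Ser by auto
  qed
qed auto

lemma loopfree: "sp_tree \<sigma> \<Longrightarrow> (x, x) \<notin> tarcs \<sigma>"
  by (induction \<sigma>) auto

lemma ser_common: "sp_tree (Ser l r) \<Longrightarrow> x \<in> tverts l \<Longrightarrow> x \<in> tverts r \<Longrightarrow> x = tree_sink l"
  by (metis IntI singletonD sp_tree.simps(2))

lemma par_common:
  "sp_tree (Par l r) \<Longrightarrow> x \<in> tverts l \<Longrightarrow> x \<in> tverts r \<Longrightarrow> x = tree_source l \<or> x = tree_sink l"
  by (metis IntI empty_iff insert_iff sp_tree.simps(3))

lemma ser_arcs_disjoint: "sp_tree (Ser l r) \<Longrightarrow> tarcs l \<inter> tarcs r = {}"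
proof (rule ccontr)
  assume sp: "sp_tree (Ser l r)" and "tarcs l \<inter> tarcs r \<noteq> {}"
  then obtain x y where "(x, y) \<in> tarcs l" "(x, y) \<in> tarcs r" by auto
  moreover from this have "x = tree_sink l" "y = tree_sink l"
    using ser_common[OF sp] by (auto dest!: tarcs_in_tverts)
  ultimately show False using sp loopfree[of l x] by auto
qed

lemma children_arcs_disjoint:
  "sp_tree (Ser l r) \<Longrightarrow> e \<in> tarcs l \<Longrightarrow> e \<notin> tarcs r"
  "sp_tree (Par l r) \<Longrightarrow> e \<in> tarcs l \<Longrightarrow> e \<notin> tarcs r"
  using ser_arcs_disjoint by auto

text \<open>Consequently a path meets a source only at its beginning and a sink only at its end,
  which restricts how it can move between the parts of a composition. In an S-composition the outer
  source is not in the right part, where it would have to be the shared vertex; dually for the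
  sink.\<close>

lemma terminal_arcs:
  "sp_tree \<sigma> \<Longrightarrow> (x, tree_source \<sigma>) \<notin> tarcs \<sigma>"
  "sp_tree \<sigma> \<Longrightarrow> (tree_sink \<sigma>, x) \<notin> tarcs \<sigma>"
proof (induction \<sigma> arbitrary: x)
  case (Ser l r)
  { case 1
    then have "tree_source l \<noteq> tree_source r" using terminals_neq[of l] by auto
    then have "tree_source l \<notin> tverts r"
      using 1 ser_common[OF 1, of "tree_source l"] terminals_neq[of l] by auto
    then show ?case using 1 Ser.IH(1) by (auto dest: tarcs_in_tverts)
  next
    case 2
    then have "tree_sink r \<noteq> tree_sink l" using terminals_neq[of r] by auto
    then have "tree_sink r \<notin> tverts l"
      using 2 ser_common[OF 2, of "tree_sink r"] by auto
    then show ?case using 2 Ser.IH(4) by (auto dest: tarcs_in_tverts)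
  }
next
  case (Par l r)
  { case 1 then show ?case using Par.IH(1)[of x] Par.IH(3)[of x] by auto
  next
    case 2 then show ?case using Par.IH(2)[of x] Par.IH(4)[of x] by auto
  }
qed auto

section \<open>Paths and flows in S- and P-compositions\<close>

lemma sink_reaches: "sp_tree \<sigma> \<Longrightarrow> X \<subseteq> tarcs \<sigma> \<Longrightarrow> (tree_sink \<sigma>, y) \<in> X\<^sup>* \<Longrightarrow> y = tree_sink \<sigma>"
  by (erule converse_rtranclE) (auto dest: terminal_arcs)

lemma reaches_source: "sp_tree \<sigma> \<Longrightarrow> X \<subseteq> tarcs \<sigma> \<Longrightarrow> (x, tree_source \<sigma>) \<in> X\<^sup>* \<Longrightarrow> x = tree_source \<sigma>"
  by (erule rtranclE) (auto dest: terminal_arcs)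

text \<open>The parts meet only in the middle vertex, which no arc of the left part leaves: once a
  path has moved on to the right part, it cannot return.\<close>

lemma ser_path_from_left:
  assumes sp: "sp_tree (Ser l r)" and X: "X \<subseteq> tarcs l \<union> tarcs r"
    and p: "(x, y) \<in> X\<^sup>*" and x: "x \<in> tverts l"
  shows "y \<in> tverts l \<and> (x, y) \<in> (X \<inter> tarcs l)\<^sup>* \<or>
    y \<in> tverts r \<and> (x, tree_sink l) \<in> (X \<inter> tarcs l)\<^sup>* \<and> (tree_sink l, y) \<in> (X \<inter> tarcs r)\<^sup>*"
  using p
proof (induction rule: rtrancl_induct)
  case (step y z)
  from step(2) X consider "(y, z) \<in> X \<inter> tarcs l" | "(y, z) \<in> X \<inter> tarcs r" by auto
  then show ?case
  proof cases
    case 1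
    from step.IH show ?thesis
    proof
      assume "y \<in> tverts l \<and> (x, y) \<in> (X \<inter> tarcs l)\<^sup>*"
      then show ?thesis using 1 by (auto dest: tarcs_in_tverts intro: rtrancl_into_rtrancl)
    next
      assume "y \<in> tverts r \<and> (x, tree_sink l) \<in> (X \<inter> tarcs l)\<^sup>* \<and> (tree_sink l, y) \<in> (X \<inter> tarcs r)\<^sup>*"
      then have "y = tree_sink l" using 1 ser_common[OF sp] tarcs_in_tverts[of y z l] by auto
      then show ?thesis using 1 sp terminal_arcs(2)[of l z] by auto
    qed
  next
    case 2
    from step.IH show ?thesis
    proof
      assume a: "y \<in> tverts l \<and> (x, y) \<in> (X \<inter> tarcs l)\<^sup>*"
      then have "y = tree_sink l" using 2 ser_common[OF sp] tarcs_in_tverts[of y z r] by auto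
      then show ?thesis using a 2 by (auto dest: tarcs_in_tverts)
    next
      assume "y \<in> tverts r \<and> (x, tree_sink l) \<in> (X \<inter> tarcs l)\<^sup>* \<and> (tree_sink l, y) \<in> (X \<inter> tarcs r)\<^sup>*"
      then show ?thesis using 2 by (auto dest: tarcs_in_tverts intro: rtrancl_into_rtrancl)
    qed
  qed
qed (use x in simp)

lemma ser_path_from_right:
  assumes sp: "sp_tree (Ser l r)" and X: "X \<subseteq> tarcs l \<union> tarcs r"
    and p: "(x, y) \<in> X\<^sup>*" and x: "x \<in> tverts r"
  shows "y \<in> tverts r \<and> (x, y) \<in> (X \<inter> tarcs r)\<^sup>*"
  using p
proof (induction rule: rtrancl_induct)
  case (step y z)
  have "(y, z) \<notin> tarcs l"
  proof
    assume a: "(y, z) \<in> tarcs l"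
    then have "y = tree_sink l" using step.IH ser_common[OF sp] tarcs_in_tverts[of y z l] by auto
    then show False using a sp terminal_arcs(2)[of l z] by auto
  qed
  then have "(y, z) \<in> X \<inter> tarcs r" using step(2) X by auto
  then show ?case using step.IH by (auto dest: tarcs_in_tverts intro: rtrancl_into_rtrancl)
qed (use x in simp)

lemma ser_path_in_left:
  assumes sp: "sp_tree (Ser l r)" and X: "X \<subseteq> tarcs l \<union> tarcs r"
    and p: "(x, y) \<in> X\<^sup>*" and "x \<in> tverts l" "y \<in> tverts l"
  shows "(x, y) \<in> (X \<inter> tarcs l)\<^sup>*"
proof -
  have "(x, y) \<in> (X \<inter> tarcs l)\<^sup>* \<or>
    y \<in> tverts r \<and> (x, tree_sink l) \<in> (X \<inter> tarcs l)\<^sup>* \<and> (tree_sink l, y) \<in> (X \<inter> tarcs r)\<^sup>*"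
    using ser_path_from_left[OF sp X p] assms(4) by blast
  moreover have "y \<in> tverts r \<Longrightarrow> y = tree_sink l" using ser_common[OF sp] assms(5) by auto
  ultimately show ?thesis by auto
qed

lemma sp_tree_Par_comm: "sp_tree (Par l r) \<Longrightarrow> sp_tree (Par r l)"
  by auto

text \<open>A change of parts could happen only at a shared terminal. The sink has no outgoing arc
  and the source no incoming one, so a path chooses its part at the very start, and has a choice
  only if it starts in the source.\<close>

lemma par_path:
  assumes sp: "sp_tree (Par l r)" and X: "X \<subseteq> tarcs l \<union> tarcs r"
    and p: "(x, y) \<in> X\<^sup>*" and x: "x \<in> tverts l"
  shows "y \<in> tverts l \<and> (x, y) \<in> (X \<inter> tarcs l)\<^sup>* \<or>
    x = tree_source l \<and> y \<in> tverts r \<and> (x, y) \<in> (X \<inter> tarcs r)\<^sup>*"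
  using p
proof (induction rule: rtrancl_induct)
  case (step y z)
  let ?s = "tree_source l" and ?t = "tree_sink l"
  have sps: "sp_tree l" "sp_tree r" "tree_source r = ?s" "tree_sink r = ?t"
    "tverts l \<inter> tverts r = {?s, ?t}" using sp by auto
  from step(2) X consider "(y, z) \<in> X \<inter> tarcs l" | "(y, z) \<in> X \<inter> tarcs r" by auto
  then show ?case
  proof cases
    case 1
    then have yz: "y \<in> tverts l" "z \<in> tverts l" "y \<noteq> ?t" using tarcs_in_tverts[of y z l] terminal_arcs(2)[of l z] sps by auto
    from step.IH show ?thesis
    proof
      assume "y \<in> tverts l \<and> (x, y) \<in> (X \<inter> tarcs l)\<^sup>*"
      then show ?thesis using 1 yz by (auto intro: rtrancl_into_rtrancl)
    next
      assume a: "x = ?s \<and> y \<in> tverts r \<and> (x, y) \<in> (X \<inter> tarcs r)\<^sup>*"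
      then have "y = ?s" using yz sps by blast
      then show ?thesis using 1 a yz by blast
    qed
  next
    case 2
    then have yz: "y \<in> tverts r" "z \<in> tverts r" "y \<noteq> ?t" using tarcs_in_tverts[of y z r] terminal_arcs(2)[of r z] sps by auto
    from step.IH show ?thesis
    proof
      assume a: "y \<in> tverts l \<and> (x, y) \<in> (X \<inter> tarcs l)\<^sup>*"
      then have "y = ?s" using yz sps by blast
      moreover from this have "x = ?s" using a reaches_source[of l "X \<inter> tarcs l" x] sps by auto
      ultimately show ?thesis using 2 yz by blast
    next
      assume "x = ?s \<and> y \<in> tverts r \<and> (x, y) \<in> (X \<inter> tarcs r)\<^sup>*"
      then show ?thesis using 2 yz by (auto intro: rtrancl_into_rtrancl)
    qed
  qed
qed (use x in simp)

lemma par_path_in_left: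
  assumes sp: "sp_tree (Par l r)" and X: "X \<subseteq> tarcs l \<union> tarcs r"
    and p: "(x, y) \<in> X\<^sup>*" and xy: "x \<in> tverts l" "y \<in> tverts l"
    and "(x, y) \<noteq> (tree_source l, tree_sink l)"
  shows "(x, y) \<in> (X \<inter> tarcs l)\<^sup>*"
proof -
  have "(x, y) \<in> (X \<inter> tarcs l)\<^sup>* \<or> x = tree_source l \<and> y \<in> tverts r"
    using par_path[OF sp X p xy(1)] by blast
  moreover have "y \<in> tverts r \<Longrightarrow> y = tree_source l \<or> y = tree_sink l"
    using par_common[OF sp xy(2)] by blast
  ultimately show ?thesis using assms(6) by auto
qed

lemma par_path_terminals:
  assumes sp: "sp_tree (Par l r)" and X: "X \<subseteq> tarcs l \<union> tarcs r"
    and p: "(tree_source l, tree_sink l) \<in> X\<^sup>*"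
  shows "(tree_source l, tree_sink l) \<in> (X \<inter> tarcs l)\<^sup>* \<or> (tree_source l, tree_sink l) \<in> (X \<inter> tarcs r)\<^sup>*"
  using par_path[OF sp X p] by auto

text \<open>Vertices strictly inside different parts are not connected at all; such pairs impose no
  constraint in the feasibility proof.\<close>

lemma par_path_crossing:
  assumes sp: "sp_tree (Par l r)" and X: "X \<subseteq> tarcs l \<union> tarcs r"
    and p: "(x, y) \<in> X\<^sup>*" and xy: "x \<in> tverts l" "y \<in> tverts r"
  shows "x \<in> tverts r \<or> y \<in> tverts l"
  using par_path[OF sp X p xy(1)] sp by auto

lemma flow_ser:
  assumes sp: "sp_tree (Ser l r)" and F: "F \<subseteq> tarcs l \<union> tarcs r"
    and xy: "x \<in> tverts l" "y \<in> tverts r" "x \<noteq> tree_sink l" "y \<noteq> tree_sink l"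
  shows "flow F x y = min (flow (F \<inter> tarcs l) x (tree_sink l)) (flow (F \<inter> tarcs r) (tree_sink l) y)"
proof (rule flow_eqI)
  let ?u = "tree_sink l"
  show fin: "finite F" using F finite_subset finite_tree(2) by blast
  show neq: "x \<noteq> y" using xy ser_common[OF sp] by blast
  have disj: "tarcs l \<inter> tarcs r = {}" using ser_arcs_disjoint[OF sp] .
  fix k
  have "packing k F x y \<longleftrightarrow> packing k (F \<inter> tarcs l) x ?u \<and> packing k (F \<inter> tarcs r) ?u y"
  proof
    assume "packing k F x y"
    then obtain D where D: "\<And>i. i < k \<Longrightarrow> D i \<subseteq> F" "\<And>i. i < k \<Longrightarrow> (x, y) \<in> (D i)\<^sup>*"
      "\<And>i j. i < k \<Longrightarrow> j < k \<Longrightarrow> i \<noteq> j \<Longrightarrow> D i \<inter> D j = {}" by (rule packingE) (rule that)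
    have split: "(x, ?u) \<in> (D i \<inter> tarcs l)\<^sup>* \<and> (?u, y) \<in> (D i \<inter> tarcs r)\<^sup>*" if "i < k" for i
    proof -
      have "D i \<subseteq> tarcs l \<union> tarcs r" using D(1)[OF that] F by blast
      from ser_path_from_left[OF sp this D(2)[OF that] xy(1)] have "y \<in> tverts l \<or> ?thesis" by blast
      moreover have "y \<notin> tverts l" using ser_common[OF sp] xy by blast
      ultimately show ?thesis by blast
    qed
    have "packing (card {..<k}) (F \<inter> tarcs l) x ?u"
    proof (rule packing_indexed[where D = "\<lambda>i. D i \<inter> tarcs l"])
      fix i j assume "i \<in> {..<k}" "j \<in> {..<k}" "i \<noteq> j"
      then show "(D i \<inter> tarcs l) \<inter> (D j \<inter> tarcs l) = {}" using D(3)[of i j] by auto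
    next
      fix i assume "i \<in> {..<k}"
      then show "D i \<inter> tarcs l \<subseteq> F \<inter> tarcs l \<and> (x, ?u) \<in> (D i \<inter> tarcs l)\<^sup>*"
        using D(1)[of i] split[of i] by auto
    qed simp
    moreover have "packing (card {..<k}) (F \<inter> tarcs r) ?u y"
    proof (rule packing_indexed[where D = "\<lambda>i. D i \<inter> tarcs r"])
      fix i j assume "i \<in> {..<k}" "j \<in> {..<k}" "i \<noteq> j"
      then show "(D i \<inter> tarcs r) \<inter> (D j \<inter> tarcs r) = {}" using D(3)[of i j] by auto
    next
      fix i assume "i \<in> {..<k}"
      then show "D i \<inter> tarcs r \<subseteq> F \<inter> tarcs r \<and> (?u, y) \<in> (D i \<inter> tarcs r)\<^sup>*"
        using D(1)[of i] split[of i] by auto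
    qed simp
    ultimately show "packing k (F \<inter> tarcs l) x ?u \<and> packing k (F \<inter> tarcs r) ?u y" by simp
  next
    assume pk: "packing k (F \<inter> tarcs l) x ?u \<and> packing k (F \<inter> tarcs r) ?u y"
    from conjunct1[OF this] obtain D where D: "\<And>i. i < k \<Longrightarrow> D i \<subseteq> F \<inter> tarcs l" "\<And>i. i < k \<Longrightarrow> (x, ?u) \<in> (D i)\<^sup>*"
      "\<And>i j. i < k \<Longrightarrow> j < k \<Longrightarrow> i \<noteq> j \<Longrightarrow> D i \<inter> D j = {}" by (rule packingE) (rule that)
    from conjunct2[OF pk] obtain D' where D': "\<And>i. i < k \<Longrightarrow> D' i \<subseteq> F \<inter> tarcs r" "\<And>i. i < k \<Longrightarrow> (?u, y) \<in> (D' i)\<^sup>*"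
      "\<And>i j. i < k \<Longrightarrow> j < k \<Longrightarrow> i \<noteq> j \<Longrightarrow> D' i \<inter> D' j = {}" by (rule packingE) (rule that)
    have "packing (card {..<k}) F x y"
    proof (rule packing_indexed[where D = "\<lambda>i. D i \<union> D' i"])
      fix i j assume ij: "i \<in> {..<k}" "j \<in> {..<k}" "i \<noteq> j"
      then have "D i \<inter> D j = {}" "D' i \<inter> D' j = {}" using D(3) D'(3) by auto
      moreover have "D i \<inter> D' j = {}" "D' i \<inter> D j = {}"
        using D(1)[of i] D'(1)[of i] D(1)[of j] D'(1)[of j] disj ij by (simp_all, blast+)
      ultimately show "(D i \<union> D' i) \<inter> (D j \<union> D' j) = {}" by blast
    next
      fix i assume "i \<in> {..<k}"
      then show "D i \<union> D' i \<subseteq> F \<and> (x, y) \<in> (D i \<union> D' i)\<^sup>*"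
        using D(1,2)[of i] D'(1,2)[of i] by (auto intro: in_rtrancl_UnI rtrancl_trans)
    qed simp
    then show "packing k F x y" by simp
  qed
  then show "packing k F x y \<longleftrightarrow> k \<le> min (flow (F \<inter> tarcs l) x ?u) (flow (F \<inter> tarcs r) ?u y)"
    using fin xy by (simp add: le_flow_iff[symmetric])
qed

text \<open>Every set of a packing connects the terminals inside one of the parts, and packings of
  the two arc-disjoint parts can be put together.\<close>

lemma flow_par:
  assumes sp: "sp_tree (Par l r)" and F: "F \<subseteq> tarcs l \<union> tarcs r"
  shows "flow F (tree_source l) (tree_sink l) =
    flow (F \<inter> tarcs l) (tree_source l) (tree_sink l) + flow (F \<inter> tarcs r) (tree_source l) (tree_sink l)"
    (is "flow F ?s ?t = ?a + ?b")
proof (rule flow_eqI)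
  show fin: "finite F" using F finite_subset finite_tree(2) by blast
  show neq: "?s \<noteq> ?t" using terminals_neq sp by auto
  have disj: "tarcs l \<inter> tarcs r = {}" using sp by simp
  have "packing k F ?s ?t \<Longrightarrow> k \<le> ?a + ?b" for k
  proof -
    assume "packing k F ?s ?t"
    then obtain D where D: "\<And>i. i < k \<Longrightarrow> D i \<subseteq> F" "\<And>i. i < k \<Longrightarrow> (?s, ?t) \<in> (D i)\<^sup>*"
      "\<And>i j. i < k \<Longrightarrow> j < k \<Longrightarrow> i \<noteq> j \<Longrightarrow> D i \<inter> D j = {}" by (rule packingE) (rule that)
    \<comment> \<open>\<open>I\<close> and \<open>J\<close> may overlap, as an arc set that is not a
      path may connect the terminals in both parts; for the upper bound it suffices that they cover
      all indices.\<close>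
    define I where "I = {i. i < k \<and> (?s, ?t) \<in> (D i \<inter> tarcs l)\<^sup>*}"
    define J where "J = {i. i < k \<and> (?s, ?t) \<in> (D i \<inter> tarcs r)\<^sup>*}"
    have fIJ: "finite I" "finite J" unfolding I_def J_def by auto
    have "{..<k} \<subseteq> I \<union> J"
    proof
      fix i assume i: "i \<in> {..<k}"
      then have "D i \<subseteq> tarcs l \<union> tarcs r" "(?s, ?t) \<in> (D i)\<^sup>*" using D(1,2)[of i] F by auto
      from par_path_terminals[OF sp this] show "i \<in> I \<union> J" using i by (auto simp: I_def J_def)
    qed
    then have "card {..<k} \<le> card (I \<union> J)"
      by (rule card_mono[rotated]) (simp add: fIJ)
    then have "k \<le> card I + card J" using card_Un_le[of I J] by simp
    moreover have "packing (card I) (F \<inter> tarcs l) ?s ?t"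
    proof (rule packing_indexed[where D = "\<lambda>i. D i \<inter> tarcs l"])
      fix i j assume "i \<in> I" "j \<in> I" "i \<noteq> j"
      then show "(D i \<inter> tarcs l) \<inter> (D j \<inter> tarcs l) = {}" using D(3)[of i j] unfolding I_def by blast
    next
      fix i assume "i \<in> I"
      then show "D i \<inter> tarcs l \<subseteq> F \<inter> tarcs l \<and> (?s, ?t) \<in> (D i \<inter> tarcs l)\<^sup>*"
        using D(1)[of i] unfolding I_def by blast
    qed (rule fIJ)
    moreover have "packing (card J) (F \<inter> tarcs r) ?s ?t"
    proof (rule packing_indexed[where D = "\<lambda>i. D i \<inter> tarcs r"])
      fix i j assume "i \<in> J" "j \<in> J" "i \<noteq> j"
      then show "(D i \<inter> tarcs r) \<inter> (D j \<inter> tarcs r) = {}" using D(3)[of i j] unfolding J_def by blast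
    next
      fix i assume "i \<in> J"
      then show "D i \<inter> tarcs r \<subseteq> F \<inter> tarcs r \<and> (?s, ?t) \<in> (D i \<inter> tarcs r)\<^sup>*"
        using D(1)[of i] unfolding J_def by blast
    qed (rule fIJ)
    ultimately show ?thesis using fin neq by (simp add: le_flow_iff[symmetric])
  qed
  moreover have "packing (?a + ?b) F ?s ?t"
  proof -
    have pk: "packing ?a (F \<inter> tarcs l) ?s ?t" "packing ?b (F \<inter> tarcs r) ?s ?t"
      using fin neq le_flow_iff[of "F \<inter> tarcs l" ?s ?t ?a] le_flow_iff[of "F \<inter> tarcs r" ?s ?t ?b]
      by simp_all
    from pk(1) obtain D where D: "\<And>i. i < ?a \<Longrightarrow> D i \<subseteq> F \<inter> tarcs l" "\<And>i. i < ?a \<Longrightarrow> (?s, ?t) \<in> (D i)\<^sup>*"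
      "\<And>i j. i < ?a \<Longrightarrow> j < ?a \<Longrightarrow> i \<noteq> j \<Longrightarrow> D i \<inter> D j = {}" by (rule packingE) (rule that)
    from pk(2) obtain D' where D': "\<And>i. i < ?b \<Longrightarrow> D' i \<subseteq> F \<inter> tarcs r" "\<And>i. i < ?b \<Longrightarrow> (?s, ?t) \<in> (D' i)\<^sup>*"
      "\<And>i j. i < ?b \<Longrightarrow> j < ?b \<Longrightarrow> i \<noteq> j \<Longrightarrow> D' i \<inter> D' j = {}" by (rule packingE) (rule that)
    \<comment> \<open>The disjoint sum keeps the indices of the two packings apart, so that their
      sizes add up.\<close>
    have "packing (card ({..<?a} <+> {..<?b})) F ?s ?t"
    proof (rule packing_indexed[where D = "case_sum D D'"])
      fix i j assume ij: "i \<in> {..<?a} <+> {..<?b}" "j \<in> {..<?a} <+> {..<?b}" "i \<noteq> j"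
      have cross: "D i \<inter> D' j = {}" if "i < ?a" "j < ?b" for i j
        using D(1)[OF that(1)] D'(1)[OF that(2)] disj by blast
      show "case_sum D D' i \<inter> case_sum D D' j = {}"
      proof (cases i; cases j)
        fix i' j' assume "i = Inl i'" "j = Inl j'"
        then show ?thesis using ij D(3)[of i' j'] by auto
      next
        fix i' j' assume "i = Inr i'" "j = Inr j'"
        then show ?thesis using ij D'(3)[of i' j'] by auto
      next
        fix i' j' assume "i = Inl i'" "j = Inr j'"
        then show ?thesis using ij cross[of i' j'] by auto
      next
        fix i' j' assume "i = Inr i'" "j = Inl j'"
        then show ?thesis using ij cross[of j' i'] by auto
      qed
    next
      fix i assume i: "i \<in> {..<?a} <+> {..<?b}"
      show "case_sum D D' i \<subseteq> F \<and> (?s, ?t) \<in> (case_sum D D' i)\<^sup>*"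
      proof (cases i)
        case (Inl i')
        then show ?thesis using i D(1,2)[of i'] by auto
      next
        case (Inr i')
        then show ?thesis using i D'(1,2)[of i'] by auto
      qed
    qed simp
    then show ?thesis by (simp add: card_Plus)
  qed
  ultimately show "packing k F ?s ?t \<longleftrightarrow> k \<le> ?a + ?b" for k
    by (intro iffI) (assumption | erule packing_antimono[rotated])+
qed

section \<open>Nodes of a clean decomposition tree\<close>

lemma node_refl [simp]: "\<sigma> \<in> nodes \<sigma>"
  by (cases \<sigma>) auto

lemma finite_nodes [simp]: "finite (nodes \<sigma>)"
  by (induction \<sigma>) auto

lemma nodes_trans: "\<rho> \<in> nodes \<sigma> \<Longrightarrow> \<sigma> \<in> nodes \<tau> \<Longrightarrow> \<rho> \<in> nodes \<tau>"
  by (induction \<tau>) auto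

lemma size_node: "\<sigma> \<in> nodes \<tau> \<Longrightarrow> \<sigma> = \<tau> \<or> size \<sigma> < size \<tau>"
  by (induction \<tau>) auto

lemma node_sub:
  assumes "\<sigma> \<in> nodes \<tau>"
  shows "tarcs \<sigma> \<subseteq> tarcs \<tau>" "tverts \<sigma> \<subseteq> tverts \<tau>"
    "sp_tree \<tau> \<Longrightarrow> sp_tree \<sigma>" "clean \<tau> \<Longrightarrow> clean \<sigma>"
  using assms by (induction \<tau>) auto

text \<open>The children of a node have disjoint arc sets, so two nodes sharing an arc descend into
  the same child until one of them is reached.\<close>

lemma nodes_laminar:
  assumes "sp_tree T" "\<sigma> \<in> nodes T" "\<tau> \<in> nodes T" "e \<in> tarcs \<sigma>" "e \<in> tarcs \<tau>"
  shows "\<sigma> \<in> nodes \<tau> \<or> \<tau> \<in> nodes \<sigma>"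
  using assms
proof (induction T)
  case (Ser l r)
  have disj: "tarcs l \<inter> tarcs r = {}" using ser_arcs_disjoint Ser.prems(1) .
  then have "\<not> (\<sigma> \<in> nodes l \<and> \<tau> \<in> nodes r)" "\<not> (\<tau> \<in> nodes l \<and> \<sigma> \<in> nodes r)"
    using Ser.prems(4,5) node_sub(1) by blast+
  then show ?case using Ser by auto
next
  case (Par l r)
  have disj: "tarcs l \<inter> tarcs r = {}" using Par.prems(1) by simp
  then have "\<not> (\<sigma> \<in> nodes l \<and> \<tau> \<in> nodes r)" "\<not> (\<tau> \<in> nodes l \<and> \<sigma> \<in> nodes r)"
    using Par.prems(4,5) node_sub(1) by blast+
  then show ?case using Par by auto
qed auto

text \<open>The syntactic counterpart of the removal condition: in a clean tree the P-node at which
  an edge can be removed is the parent of its leaf. S-nodes are included because the edges directly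
  below them must be shown to stay.\<close>

definition leaf_parent :: "('a \<times> 'a) \<Rightarrow> 'a sptree \<Rightarrow> bool" where
  "leaf_parent e \<sigma> \<longleftrightarrow> (\<exists>l r. (\<sigma> = Ser l r \<or> \<sigma> = Par l r) \<and> (l = Leaf e \<or> r = Leaf e))"

lemma leaf_parent_simps [simp]:
  "\<not> leaf_parent e (Leaf f)"
  "leaf_parent e (Ser l r) \<longleftrightarrow> l = Leaf e \<or> r = Leaf e"
  "leaf_parent e (Par l r) \<longleftrightarrow> l = Leaf e \<or> r = Leaf e"
  by (auto simp: leaf_parent_def)

lemma leaf_parent_arc: "leaf_parent e \<sigma> \<Longrightarrow> e \<in> tarcs \<sigma>"
  by (cases \<sigma>) auto

text \<open>The sibling of the leaf does not contain \<open>e\<close>, so among the nodes further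
  down only the leaf itself does.\<close>

lemma node_below_leaf_parent:
  assumes "sp_tree \<tau>" "leaf_parent e \<tau>" "\<sigma> \<in> nodes \<tau>" "e \<in> tarcs \<sigma>"
  shows "\<sigma> = \<tau> \<or> \<sigma> = Leaf e"
proof -
  consider \<rho> where "\<tau> = Ser (Leaf e) \<rho> \<or> \<tau> = Ser \<rho> (Leaf e) \<or> \<tau> = Par (Leaf e) \<rho> \<or> \<tau> = Par \<rho> (Leaf e)"
    using assms(2) unfolding leaf_parent_def by blast
  then show ?thesis
  proof cases
    case 1
    then have "e \<notin> tarcs \<rho>"
      using assms(1) children_arcs_disjoint(1)[of "Leaf e" \<rho> e] children_arcs_disjoint(1)[of \<rho> "Leaf e" e]
        children_arcs_disjoint(2)[of "Leaf e" \<rho> e] children_arcs_disjoint(2)[of \<rho> "Leaf e" e]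
      by (elim disjE) (simp_all del: sp_tree.simps, blast+)
    then have "\<sigma> \<notin> nodes \<rho>" using assms(4) node_sub(1) by blast
    then show ?thesis using 1 assms(3) by auto
  qed
qed

lemma leaf_parent_unique:
  assumes "sp_tree T" "\<sigma> \<in> nodes T" "\<tau> \<in> nodes T" "leaf_parent e \<sigma>" "leaf_parent e \<tau>"
  shows "\<sigma> = \<tau>"
proof -
  have *: "\<sigma> = \<tau>" if "\<sigma> \<in> nodes \<tau>" "leaf_parent e \<sigma>" "leaf_parent e \<tau>" "\<tau> \<in> nodes T" for \<sigma> \<tau>
    using node_below_leaf_parent[of \<tau> e \<sigma>] leaf_parent_arc[of e \<sigma>] that node_sub(3)[of \<tau> T] assms(1)
    by auto
  show ?thesis
    using nodes_laminar[OF assms(1-3) leaf_parent_arc leaf_parent_arc, OF assms(4,5)]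
      *[of \<sigma> \<tau>] *[of \<tau> \<sigma>] assms by blast
qed

lemma par_parts_Leaf:
  assumes "sp_tree \<sigma>" "Leaf e \<in> par_parts \<sigma>"
  shows "e = (tree_source \<sigma>, tree_sink \<sigma>)" "e \<in> tarcs \<sigma>"
  using assms by (induction \<sigma>) auto

text \<open>In an S-node the source is missing from the right part and the sink from the left one,
  so an arc between the terminals can only have entered by P-compositions.\<close>

lemma terminal_arc_par_parts:
  assumes "sp_tree \<sigma>" "(tree_source \<sigma>, tree_sink \<sigma>) \<in> tarcs \<sigma>"
  shows "Leaf (tree_source \<sigma>, tree_sink \<sigma>) \<in> par_parts \<sigma>"
  using assms
proof (induction \<sigma>)
  case (Ser l r)
  have "tree_sink r \<notin> tverts l" "tree_source l \<notin> tverts r"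
    using ser_common[OF Ser.prems(1), of "tree_sink r"] ser_common[OF Ser.prems(1), of "tree_source l"]
      terminals_neq[of l] terminals_neq[of r] Ser.prems(1) by auto
  then show ?case using Ser.prems by (auto dest: tarcs_in_tverts)
qed auto

text \<open>The edge that the algorithm considers for removal at the node \<open>\<sigma>\<close>.\<close>

definition candidate :: "'a sptree \<Rightarrow> ('a \<times> 'a) \<Rightarrow> bool" where
  "candidate \<sigma> e \<longleftrightarrow> (\<exists>l r. \<sigma> = Par l r) \<and> e = (tree_source \<sigma>, tree_sink \<sigma>) \<and> e \<in> tarcs \<sigma>"

text \<open>Here cleanness enters: an arc joining the terminals is among the parallel parts, and a
  clean P-node has such a leaf as a child.\<close>

lemma candidate_iff:
  assumes "sp_tree \<sigma>" "clean \<sigma>"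
  shows "candidate \<sigma> e \<longleftrightarrow> (\<exists>l r. \<sigma> = Par l r) \<and> leaf_parent e \<sigma>"
proof
  assume c: "candidate \<sigma> e"
  then obtain l r where \<sigma>: "\<sigma> = Par l r" by (auto simp: candidate_def)
  have "Leaf e \<in> par_parts \<sigma>" using c terminal_arc_par_parts[OF assms(1)] by (auto simp: candidate_def)
  then show "(\<exists>l r. \<sigma> = Par l r) \<and> leaf_parent e \<sigma>"
    using assms(2) \<sigma> by (metis clean.simps(3) leaf_parent_simps(3))
next
  assume a: "(\<exists>l r. \<sigma> = Par l r) \<and> leaf_parent e \<sigma>"
  then obtain l r where \<sigma>: "\<sigma> = Par l r" by blast
  then have "Leaf e \<in> par_parts \<sigma>" using a by auto
  from par_parts_Leaf[OF assms(1) this] show "candidate \<sigma> e" using \<sigma> by (auto simp: candidate_def)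
qed

text \<open>By cleanness the leaf is one of the two children, and it is not the other one, whose
  arcs are disjoint from those of this child. So a child of a P-node that is not a leaf has no
  single edge among its parallel parts.\<close>

lemma clean_par_child:
  assumes "clean (Par l r)" "sp_tree (Par l r)"
  shows "Leaf e \<in> par_parts l \<Longrightarrow> l = Leaf e" "Leaf e \<in> par_parts r \<Longrightarrow> r = Leaf e"
proof -
  have disj: "tarcs l \<inter> tarcs r = {}" "sp_tree l" "sp_tree r" using assms(2) by auto
  show "l = Leaf e" if "Leaf e \<in> par_parts l"
  proof -
    have "e \<in> tarcs l" using par_parts_Leaf[OF disj(2) that] by blast
    then have "r \<noteq> Leaf e" using disj(1) by auto
    then show ?thesis using assms(1) that by (metis UnI1 clean.simps(3) par_parts.simps(1))
  qed
  show "r = Leaf e" if "Leaf e \<in> par_parts r"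
  proof -
    have "e \<in> tarcs r" using par_parts_Leaf[OF disj(3) that] by blast
    then have "l \<noteq> Leaf e" using disj(1) by auto
    then show ?thesis using assms(1) that by (metis UnI2 clean.simps(3) par_parts.simps(1))
  qed
qed

text \<open>A path of the whole graph between two vertices of a node can leave the node only between its
  terminals, and not even there if \<open>b\<close> holds.\<close>

definition confined :: "('a \<times> 'a) set \<Rightarrow> 'a sptree \<Rightarrow> bool \<Rightarrow> bool" where
  "confined A \<sigma> b \<longleftrightarrow> (\<forall>X x y. X \<subseteq> A \<longrightarrow> x \<in> tverts \<sigma> \<longrightarrow> y \<in> tverts \<sigma> \<longrightarrow> (x, y) \<in> X\<^sup>* \<longrightarrow>
     b \<or> (x, y) \<noteq> (tree_source \<sigma>, tree_sink \<sigma>) \<longrightarrow> (x, y) \<in> (X \<inter> tarcs \<sigma>)\<^sup>*)"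

lemma confinedD:
  "confined A \<sigma> b \<Longrightarrow> X \<subseteq> A \<Longrightarrow> x \<in> tverts \<sigma> \<Longrightarrow> y \<in> tverts \<sigma> \<Longrightarrow> (x, y) \<in> X\<^sup>* \<Longrightarrow>
     b \<or> (x, y) \<noteq> (tree_source \<sigma>, tree_sink \<sigma>) \<Longrightarrow> (x, y) \<in> (X \<inter> tarcs \<sigma>)\<^sup>*"
  unfolding confined_def by blast

lemma confined_self: "confined (tarcs \<sigma>) \<sigma> True"
  by (simp add: confined_def inf.absorb1)

text \<open>The terminals of the composition lie in different children, so the exceptional pair
  never occurs within one child. Hence the children are confined without exception, whatever
  \<open>b\<close> is.\<close>

lemma confined_ser:
  assumes sp: "sp_tree (Ser l r)" and c: "confined A (Ser l r) b"
  shows "confined A l True" "confined A r True"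
proof -
  have nt: "tree_sink r \<notin> tverts l" "tree_source l \<notin> tverts r"
    using ser_common[OF sp, of "tree_sink r"] ser_common[OF sp, of "tree_source l"]
      terminals_neq[of l] terminals_neq[of r] sp by auto
  show "confined A l True" unfolding confined_def
  proof (intro allI impI)
    fix X x y assume a: "X \<subseteq> A" "x \<in> tverts l" "y \<in> tverts l" "(x, y) \<in> X\<^sup>*"
    have "(x, y) \<in> (X \<inter> tarcs (Ser l r))\<^sup>*" using confinedD[OF c a(1) _ _ a(4)] a nt by auto
    from ser_path_in_left[OF sp _ this a(2,3)]
    have "(x, y) \<in> (X \<inter> tarcs (Ser l r) \<inter> tarcs l)\<^sup>*" by simp
    moreover have "X \<inter> tarcs (Ser l r) \<inter> tarcs l = X \<inter> tarcs l" by auto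
    ultimately show "(x, y) \<in> (X \<inter> tarcs l)\<^sup>*" by simp
  qed
  show "confined A r True" unfolding confined_def
  proof (intro allI impI)
    fix X x y assume a: "X \<subseteq> A" "x \<in> tverts r" "y \<in> tverts r" "(x, y) \<in> X\<^sup>*"
    have "(x, y) \<in> (X \<inter> tarcs (Ser l r))\<^sup>*" using confinedD[OF c a(1) _ _ a(4)] a nt by auto
    from ser_path_from_right[OF sp _ this a(2)]
    have "(x, y) \<in> (X \<inter> tarcs (Ser l r) \<inter> tarcs r)\<^sup>*" by simp
    moreover have "X \<inter> tarcs (Ser l r) \<inter> tarcs r = X \<inter> tarcs r" by auto
    ultimately show "(x, y) \<in> (X \<inter> tarcs r)\<^sup>*" by simp
  qed
qed

text \<open>Between the common terminals a path may run through the sibling, so this pair becomes an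
  exception even if \<open>b\<close> holds.\<close>

lemma confined_par_left:
  assumes sp: "sp_tree (Par l r)" and c: "confined A (Par l r) b"
  shows "confined A l False"
  unfolding confined_def
proof (intro allI impI)
  fix X x y assume a: "X \<subseteq> A" "x \<in> tverts l" "y \<in> tverts l" "(x, y) \<in> X\<^sup>*"
    and ne: "False \<or> (x, y) \<noteq> (tree_source l, tree_sink l)"
  have "(x, y) \<in> (X \<inter> tarcs (Par l r))\<^sup>*" using confinedD[OF c a(1) _ _ a(4)] a ne by auto
  from par_path_in_left[OF sp _ this a(2,3)] ne
  have "(x, y) \<in> (X \<inter> tarcs (Par l r) \<inter> tarcs l)\<^sup>*" by simp
  moreover have "X \<inter> tarcs (Par l r) \<inter> tarcs l = X \<inter> tarcs l" by auto
  ultimately show "(x, y) \<in> (X \<inter> tarcs l)\<^sup>*" by simp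
qed

lemma confined_par:
  assumes sp: "sp_tree (Par l r)" and c: "confined A (Par l r) b"
  shows "confined A l False" "confined A r False"
proof -
  show "confined A l False" using confined_par_left[OF sp c] .
  have "confined A (Par r l) b" using c sp unfolding confined_def by (simp add: Un_commute)
  then show "confined A r False" using confined_par_left sp_tree_Par_comm[OF sp] by blast
qed

text \<open>The flag \<open>b\<close> is lost only in passing from a P-node to a child. By cleanness
  such a child has no single edge among its parallel parts, unless it is a leaf; this is the
  alternative in the assumption. So the P-nodes at which an edge can be removed still have the
  flag.\<close>

lemma confined_nodes:
  assumes "sp_tree \<rho>" "clean \<rho>" "confined A \<rho> b"
    "b \<or> (\<forall>e. Leaf e \<in> par_parts \<rho> \<longrightarrow> \<rho> = Leaf e)" "\<sigma> \<in> nodes \<rho>"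
  shows "(\<forall>l r. \<sigma> = Par l r \<and> leaf_parent e \<sigma> \<longrightarrow> confined A \<sigma> True) \<and>
    (\<forall>l r. \<sigma> = Ser l r \<longrightarrow> confined A l True \<and> confined A r True)"
  using assms
proof (induction \<rho> arbitrary: b)
  case (Ser l r)
  have "confined A l True" "confined A r True" using confined_ser Ser.prems(1,3) by blast+
  then show ?case using Ser.IH(1)[of True] Ser.IH(2)[of True] Ser.prems by auto
next
  case (Par l r)
  have c: "confined A l False" "confined A r False" using confined_par Par.prems(1,3) by blast+
  have "\<forall>e. Leaf e \<in> par_parts l \<longrightarrow> l = Leaf e" "\<forall>e. Leaf e \<in> par_parts r \<longrightarrow> r = Leaf e"
    using clean_par_child[OF Par.prems(2,1)] by blast+
  then have "\<sigma> \<in> nodes l \<or> \<sigma> \<in> nodes r \<Longrightarrow> ?case"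
    using Par.IH(1)[of False] Par.IH(2)[of False] Par.prems(1,2) c by auto
  moreover have "?case" if "\<sigma> = Par l r"
  proof -
    have "leaf_parent e \<sigma> \<Longrightarrow> Leaf e \<in> par_parts (Par l r)" using that by auto
    then have "leaf_parent e \<sigma> \<Longrightarrow> b" using Par.prems(4) by (metis sptree.distinct(3))
    then show ?thesis using that Par.prems(3) by auto
  qed
  ultimately show ?case using Par.prems(5) by auto
qed auto

section \<open>Correctness of the algorithm\<close>

lemma tree_graph_eta: "\<lparr>pverts = tverts T, parcs = tarcs T\<rparr> = tree_graph T"
  by simp

lemma pair_wf_tree: "F \<subseteq> tarcs T \<Longrightarrow> pair_wf_digraph \<lparr>pverts = tverts T, parcs = F\<rparr>"
  by unfold_locales (auto dest!: subsetD tarcs_in_tverts)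

lemma max_paths_tree:
  assumes "F \<subseteq> tarcs T" "x \<in> tverts T" "x \<noteq> y"
  shows "max_paths \<lparr>pverts = tverts T, parcs = F\<rparr> x y = flow F x y"
  using max_paths_eq_flow[OF pair_wf_tree[OF assms(1)] _ _ _ assms(3)] assms
  by (simp add: finite_subset[OF _ finite_tree(2)])

lemma covered_iff:
  assumes "F \<subseteq> tarcs T" "x \<in> tverts T" "x \<noteq> y"
  shows "covered \<alpha> (tree_graph T) F x y \<longleftrightarrow> \<alpha> * flow (tarcs T) x y \<le> flow F x y"
  using max_paths_tree[OF assms] max_paths_tree[OF order_refl assms(2,3), unfolded tree_graph_eta]
  by (simp add: covered_def)

lemma covered_self:
  assumes "F \<subseteq> tarcs T" "x \<in> tverts T" "\<alpha> < 1"
  shows "covered \<alpha> (tree_graph T) F x x"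
proof -
  have "max_paths \<lparr>pverts = tverts T, parcs = tarcs T\<rparr> x x = 1"
    by (rule max_paths_self[OF pair_wf_tree]) (use assms in simp_all)
  then show ?thesis
    using max_paths_self[OF pair_wf_tree[OF assms(1)], of x] assms
    unfolding tree_graph_eta by (simp add: covered_def)
qed

lemma flow_confined:
  assumes "confined A \<sigma> b" "finite A" "F \<subseteq> A" "x \<in> tverts \<sigma>" "y \<in> tverts \<sigma>" "x \<noteq> y"
    "b \<or> (x, y) \<noteq> (tree_source \<sigma>, tree_sink \<sigma>)"
  shows "flow F x y = flow (F \<inter> tarcs \<sigma>) x y"
proof (rule flow_local)
  show "finite F" using assms(2,3) finite_subset by blast
  show "(x, y) \<in> (X \<inter> tarcs \<sigma>)\<^sup>*" if "X \<subseteq> F" "(x, y) \<in> X\<^sup>*" for X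
    using confinedD[OF assms(1) _ assms(4,5) that(2) assms(7)] that(1) assms(3) by blast
qed fact

abbreviation tflow :: "('a \<times> 'a) set \<Rightarrow> 'a sptree \<Rightarrow> nat" where
  "tflow F \<sigma> \<equiv> flow (F \<inter> tarcs \<sigma>) (tree_source \<sigma>) (tree_sink \<sigma>)"

lemma tflow_Leaf: "sp_tree (Leaf e) \<Longrightarrow> tflow F (Leaf e) = (if e \<in> F then 1 else 0)"
  using flow_arc[of "fst e" "snd e" "F \<inter> {e}"] by (cases e) auto

lemma tflow_Ser:
  assumes "sp_tree (Ser l r)"
  shows "tflow F (Ser l r) = min (tflow F l) (tflow F r)"
proof -
  have F: "F \<inter> tarcs (Ser l r) \<inter> tarcs l = F \<inter> tarcs l" "F \<inter> tarcs (Ser l r) \<inter> tarcs r = F \<inter> tarcs r" by auto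
  have "tree_source l \<noteq> tree_sink l" "tree_sink r \<noteq> tree_sink l" "tree_source r = tree_sink l"
    using assms terminals_neq[of l] terminals_neq[of r] by auto
  then show ?thesis
    using flow_ser[OF assms, of "F \<inter> tarcs (Ser l r)" "tree_source l" "tree_sink r"] assms F by simp
qed

lemma tflow_Par:
  assumes "sp_tree (Par l r)"
  shows "tflow F (Par l r) = tflow F l + tflow F r"
proof -
  have F: "F \<inter> tarcs (Par l r) \<inter> tarcs l = F \<inter> tarcs l" "F \<inter> tarcs (Par l r) \<inter> tarcs r = F \<inter> tarcs r" by auto
  show ?thesis using flow_par[OF assms, of "F \<inter> tarcs (Par l r)"] assms F by simp
qed

lemma scaled_min_le:
  fixes a b c d :: nat
  assumes "0 < (\<alpha> :: real)" "\<alpha> * a \<le> c" "\<alpha> * b \<le> d"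
  shows "\<alpha> * min a b \<le> min c d"
proof -
  have "\<alpha> * real (min a b) \<le> \<alpha> * a" "\<alpha> * real (min a b) \<le> \<alpha> * b" using assms(1) by auto
  then show ?thesis using assms(2,3) by (simp add: min_def split: if_splits)
qed

section \<open>The effect of processing a part of a bottom-up order\<close>

locale clean_tree =
  fixes T :: "'a sptree" and \<alpha> :: real
  assumes sp: "sp_tree T" and clean: "clean T" and alpha: "0 < \<alpha>" "\<alpha> < 1"
begin

lemmas sp_node = node_sub(3)[OF _ sp]
lemmas clean_node = node_sub(4)[OF _ clean]

lemma confined_node:
  assumes "\<sigma> \<in> nodes T"
  shows "\<sigma> = Par l r \<Longrightarrow> leaf_parent e \<sigma> \<Longrightarrow> confined (tarcs T) \<sigma> True"
    "\<sigma> = Ser l r \<Longrightarrow> confined (tarcs T) l True" "\<sigma> = Ser l r \<Longrightarrow> confined (tarcs T) r True"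
  using confined_nodes[OF sp clean confined_self, of \<sigma> e] assms by auto

text \<open>The test of the algorithm in terms of flows inside the node. The edge set is a
  parameter, since the test will be evaluated again with sets that have shrunk in the
  meantime.\<close>

definition removable :: "('a \<times> 'a) set \<Rightarrow> 'a sptree \<Rightarrow> ('a \<times> 'a) \<Rightarrow> bool" where
  "removable E \<sigma> e \<longleftrightarrow> candidate \<sigma> e \<and> \<alpha> * tflow (tarcs T) \<sigma> \<le> tflow (E - {e}) \<sigma>"

text \<open>Coverage compares with the flow of the whole graph; a candidate node is confined without
  exception, so this is the flow inside the node.\<close>

lemma process_node_eq:
  assumes \<sigma>: "\<sigma> \<in> nodes T" and E: "E \<subseteq> tarcs T"
  shows "process_node \<alpha> (tree_graph T) \<sigma> E = E - {e. removable E \<sigma> e}"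
proof -
  let ?s = "tree_source \<sigma>" and ?t = "tree_sink \<sigma>"
  have sps: "sp_tree \<sigma>" "clean \<sigma>" using sp_node clean_node \<sigma> by auto
  have cov: "covered \<alpha> (tree_graph T) (E \<inter> tarcs \<sigma> - {(?s, ?t)}) ?s ?t \<longleftrightarrow>
    \<alpha> * tflow (tarcs T) \<sigma> \<le> tflow (E - {(?s, ?t)}) \<sigma>" if c: "candidate \<sigma> (?s, ?t)"
  proof -
    obtain l r where lr: "\<sigma> = Par l r" and p: "leaf_parent (?s, ?t) \<sigma>"
      using iffD1[OF candidate_iff[OF sps] c] by (elim conjE exE)
    have "flow (tarcs T) ?s ?t = tflow (tarcs T) \<sigma>"
      by (rule flow_confined[OF confined_node(1)[OF \<sigma> lr p]])
        (use sps in \<open>auto simp: terminals_neq\<close>)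
    moreover have "E \<inter> tarcs \<sigma> - {(?s, ?t)} = (E - {(?s, ?t)}) \<inter> tarcs \<sigma>" by auto
    moreover have "E \<inter> tarcs \<sigma> - {(?s, ?t)} \<subseteq> tarcs T" using E by blast
    moreover have "?s \<in> tverts T" using node_sub(2)[OF \<sigma>] terminals_in_tverts(1)[of \<sigma>] by blast
    ultimately show ?thesis
      using covered_iff[of "E \<inter> tarcs \<sigma> - {(?s, ?t)}" T ?s ?t \<alpha>] terminals_neq[OF sps(1)] by simp
  qed
  have rem: "removable E \<sigma> e \<longleftrightarrow> e = (?s, ?t) \<and> candidate \<sigma> (?s, ?t) \<and>
    covered \<alpha> (tree_graph T) (E \<inter> tarcs \<sigma> - {(?s, ?t)}) ?s ?t" for e
    using cov unfolding removable_def candidate_def by blast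
  have "candidate \<sigma> (?s, ?t) \<longleftrightarrow> (\<exists>l r. \<sigma> = Par l r) \<and> (?s, ?t) \<in> tarcs \<sigma>"
    by (auto simp: candidate_def)
  then show ?thesis unfolding process_node_def Let_def rem by auto
qed

text \<open>A removal at \<tau> leaves earlier nodes alone: a node that contains the edge but does
  not have \<tau> below it lies below \<tau>, the parent of the leaf, and is therefore the
  leaf.\<close>

lemma candidate_outside:
  assumes "\<tau> \<in> nodes T" "candidate \<tau> e" "\<sigma> \<in> nodes T" "\<tau> \<notin> nodes \<sigma>" "\<sigma> \<noteq> Leaf e"
  shows "e \<notin> tarcs \<sigma>"
proof
  assume e: "e \<in> tarcs \<sigma>"
  have sps: "sp_tree \<tau>" "clean \<tau>" using sp_node clean_node assms(1) by auto
  have "leaf_parent e \<tau>" using candidate_iff[OF sps] assms(2) by blast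
  moreover have "e \<in> tarcs \<tau>" using assms(2) unfolding candidate_def by blast
  then have "\<sigma> \<in> nodes \<tau>" using nodes_laminar[OF sp assms(3,1) e] assms(4) by blast
  ultimately have "\<sigma> = \<tau> \<or> \<sigma> = Leaf e" using node_below_leaf_parent[OF sps(1)] e by blast
  then show False using assms(4,5) node_refl by blast
qed

abbreviation retained :: "'a sptree list \<Rightarrow> ('a \<times> 'a) set" where
  "retained \<equiv> retained_edges \<alpha> (tree_graph T)"

text \<open>Completeness is dropped from \<open>bottom_up\<close> because the intermediate states of
  the program correspond to initial segments of the order.\<close>

definition bottom_up_prefix :: "'a sptree list \<Rightarrow> bool" where
  "bottom_up_prefix \<sigma>s \<longleftrightarrow> set \<sigma>s \<subseteq> nodes T \<and> sorted_wrt (\<lambda>\<sigma> \<tau>. \<tau> \<notin> nodes \<sigma>) \<sigma>s"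

lemma bottom_up_prefix_snoc:
  "bottom_up_prefix (\<sigma>s @ [\<tau>]) \<longleftrightarrow> bottom_up_prefix \<sigma>s \<and> \<tau> \<in> nodes T \<and> (\<forall>\<sigma>\<in>set \<sigma>s. \<tau> \<notin> nodes \<sigma>)"
  by (auto simp: bottom_up_prefix_def sorted_wrt_append)

lemma retained_Nil: "retained [] = tarcs T"
  by (simp add: retained_edges_def)

lemma retained_snoc:
  assumes "\<tau> \<in> nodes T" "retained \<sigma>s \<subseteq> tarcs T"
  shows "retained (\<sigma>s @ [\<tau>]) = retained \<sigma>s - {e. removable (retained \<sigma>s) \<tau> e}"
  using process_node_eq[OF assms] by (simp add: retained_edges_def)

lemma retained_subset: "bottom_up_prefix \<sigma>s \<Longrightarrow> retained \<sigma>s \<subseteq> tarcs T"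
proof (induction \<sigma>s rule: rev_induct)
  case (snoc \<tau> \<sigma>s)
  then show ?case using retained_snoc[of \<tau> \<sigma>s] by (auto simp: bottom_up_prefix_snoc)
qed (simp add: retained_Nil)

lemma retained_stable:
  assumes "bottom_up_prefix (\<sigma>s @ [\<tau>])" "\<sigma> \<in> set \<sigma>s" "\<And>e. \<sigma> \<noteq> Leaf e"
  shows "retained (\<sigma>s @ [\<tau>]) \<inter> tarcs \<sigma> = retained \<sigma>s \<inter> tarcs \<sigma>"
proof -
  have p: "bottom_up_prefix \<sigma>s" "\<tau> \<in> nodes T" "\<tau> \<notin> nodes \<sigma>"
    using assms by (auto simp: bottom_up_prefix_snoc)
  then have "\<sigma> \<in> nodes T" using assms(2) by (auto simp: bottom_up_prefix_def)
  then have "e \<notin> tarcs \<sigma>" if "removable (retained \<sigma>s) \<tau> e" for e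
    using candidate_outside[OF p(2) _ _ p(3) assms(3)] that by (simp add: removable_def)
  then show ?thesis unfolding retained_snoc[OF p(2) retained_subset[OF p(1)]] by blast
qed

text \<open>The test may be evaluated with the current set instead of the one present when the node
  was processed: it looks only at arcs inside the node other than \<open>e\<close>, and these have
  not changed since. The result thus satisfies a condition that does not mention the
  history.\<close>

lemma not_retained_iff:
  assumes "bottom_up_prefix \<sigma>s" "e \<in> tarcs T"
  shows "e \<notin> retained \<sigma>s \<longleftrightarrow> (\<exists>\<sigma>\<in>set \<sigma>s. removable (retained \<sigma>s) \<sigma> e)"
  using assms
proof (induction \<sigma>s rule: rev_induct)
  case (snoc \<tau> \<sigma>s)
  have p: "bottom_up_prefix \<sigma>s" "\<tau> \<in> nodes T" using snoc.prems(1) unfolding bottom_up_prefix_snoc by blast+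
  let ?E = "retained \<sigma>s" and ?E' = "retained (\<sigma>s @ [\<tau>])"
  have E': "?E' = ?E - {e. removable ?E \<tau> e}" using retained_snoc[OF p(2) retained_subset[OF p(1)]] .
  have old: "removable ?E' \<sigma> e \<longleftrightarrow> removable ?E \<sigma> e" if "\<sigma> \<in> set \<sigma>s" for \<sigma>
  proof (cases "candidate \<sigma> e")
    case True
    then have "\<And>e. \<sigma> \<noteq> Leaf e" by (auto simp: candidate_def)
    from retained_stable[OF snoc.prems(1) that this]
    have "(?E' - {e}) \<inter> tarcs \<sigma> = (?E - {e}) \<inter> tarcs \<sigma>" by auto
    then show ?thesis by (simp add: removable_def)
  qed (simp add: removable_def)
  \<comment> \<open>Processing \<tau> can remove no edge but \<open>e\<close> itself, which the test
    disregards anyway.\<close>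
  have new: "removable ?E' \<tau> e \<longleftrightarrow> removable ?E \<tau> e"
  proof (cases "candidate \<tau> e")
    case True
    then have "f = e" if "candidate \<tau> f" for f using that by (auto simp: candidate_def)
    then have "?E' - {e} = ?E - {e}" using E' unfolding removable_def by blast
    then show ?thesis by (simp add: removable_def)
  qed (simp add: removable_def)
  have "e \<notin> ?E' \<longleftrightarrow> e \<notin> ?E \<or> removable ?E \<tau> e" using E' by blast
  also have "\<dots> \<longleftrightarrow> (\<exists>\<sigma>\<in>set \<sigma>s. removable ?E' \<sigma> e) \<or> removable ?E' \<tau> e"
    using snoc.IH[OF p(1) snoc.prems(2)] old new by blast
  finally show ?case by auto
qed (simp add: retained_Nil)

text \<open>An edge can be removed only at the parent of its leaf. So edges directly below S-nodes
  stay forever, those below P-nodes until their parent is processed.\<close>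

lemma leaf_retained:
  assumes p: "bottom_up_prefix \<sigma>s" and \<tau>: "\<tau> \<in> nodes T" "leaf_parent e \<tau>"
    and "\<tau> \<notin> set \<sigma>s \<or> (\<forall>l r. \<tau> \<noteq> Par l r)"
  shows "e \<in> retained \<sigma>s"
proof (rule ccontr)
  assume a: "e \<notin> retained \<sigma>s"
  have "e \<in> tarcs T" using leaf_parent_arc[OF \<tau>(2)] node_sub(1)[OF \<tau>(1)] by blast
  then obtain \<sigma> where \<sigma>: "\<sigma> \<in> set \<sigma>s" "candidate \<sigma> e"
    using not_retained_iff[OF p] a unfolding removable_def by blast
  then have T: "\<sigma> \<in> nodes T" using p by (auto simp: bottom_up_prefix_def)
  then have "leaf_parent e \<sigma>" "\<exists>l r. \<sigma> = Par l r"
    using candidate_iff[OF sp_node clean_node, OF T T] \<sigma>(2) by blast+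
  moreover from this have "\<sigma> = \<tau>" using leaf_parent_unique[OF sp T \<tau>(1) _ \<tau>(2)] by blast
  ultimately show False using assms(4) \<sigma>(1) by blast
qed

text \<open>\<open>k\<close> is the sibling of the leaf. The test compares the flow of
  \<open>E\<close> in the sibling with that of the graph plus one unit for \<open>e\<close>; whether
  \<open>e\<close> belongs to \<open>E\<close> has no influence.\<close>

lemma removable_par_iff:
  assumes \<sigma>: "\<sigma> = Par l r" "\<sigma> \<in> nodes T" and c: "l = Leaf e \<and> k = r \<or> r = Leaf e \<and> k = l"
  shows "removable E \<sigma> f \<longleftrightarrow> f = e \<and> \<alpha> * real (tflow (tarcs T) k + 1) \<le> tflow E k"
    "tflow E \<sigma> = tflow E k + (if e \<in> E then 1 else 0)"
    "tflow (tarcs T) \<sigma> = tflow (tarcs T) k + 1"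
proof -
  have sps: "sp_tree (Par l r)" "clean (Par l r)" using sp_node clean_node \<sigma> by metis+
  then have spl: "sp_tree l" "sp_tree r" by auto
  have ek: "e \<notin> tarcs k"
    using c children_arcs_disjoint(2)[OF sps(1), of e] by (elim disjE) auto
  have eT: "e \<in> tarcs T" using c node_sub(1)[OF \<sigma>(2)] \<sigma>(1) by auto
  have "candidate \<sigma> e" using candidate_iff[OF sps] c \<sigma>(1) by auto
  then have cand: "candidate \<sigma> f \<longleftrightarrow> f = e" unfolding candidate_def by blast
  have fl: "tflow F \<sigma> = tflow F k + (if e \<in> F then 1 else 0)" for F
  proof -
    have "sp_tree (Leaf e)" using c spl by blast
    then have "tflow F l + tflow F r = tflow F k + (if e \<in> F then 1 else 0)"
      using c tflow_Leaf[of e F] by (elim disjE) simp_all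
    then show ?thesis unfolding \<sigma>(1) tflow_Par[OF sps(1)] .
  qed
  have "(E - {e}) \<inter> tarcs k = E \<inter> tarcs k" using ek by blast
  then have "tflow (E - {e}) \<sigma> = tflow E k" using fl[of "E - {e}"] by simp
  then show "removable E \<sigma> f \<longleftrightarrow> f = e \<and> \<alpha> * real (tflow (tarcs T) k + 1) \<le> tflow E k"
    unfolding removable_def cand using fl[of "tarcs T"] eT
    by (cases "f = e") (simp_all only: if_True simp_thms)
  show "tflow E \<sigma> = tflow E k + (if e \<in> E then 1 else 0)" by (rule fl)
  show "tflow (tarcs T) \<sigma> = tflow (tarcs T) k + 1" using fl[of "tarcs T"] eT by simp
qed

section \<open>Feasibility and minimality of the final edge set\<close>

context
  fixes \<sigma>s :: "'a sptree list" and E :: "('a \<times> 'a) set"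
  assumes bu: "bottom_up T \<sigma>s"
  defines "E \<equiv> retained \<sigma>s"
begin

lemma prefix_all: "bottom_up_prefix \<sigma>s" "set \<sigma>s = nodes T"
  using bu by (auto simp: bottom_up_def bottom_up_prefix_def)

lemma E_subset: "E \<subseteq> tarcs T"
  unfolding E_def using retained_subset prefix_all by blast

text \<open>Only the parent of the leaf decides about \<open>e\<close>, so the quantifier in
  \<open>not_retained_iff\<close> collapses to that node.\<close>

lemma not_in_E_iff:
  assumes "\<sigma> \<in> nodes T" "candidate \<sigma> e"
  shows "e \<notin> E \<longleftrightarrow> removable E \<sigma> e"
proof -
  have lp: "\<tau> \<in> nodes T \<Longrightarrow> candidate \<tau> e \<Longrightarrow> leaf_parent e \<tau>" for \<tau>
    using candidate_iff[OF sp_node clean_node] by blast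
  have uniq: "\<tau> = \<sigma>" if "\<tau> \<in> nodes T" "candidate \<tau> e" for \<tau>
    using leaf_parent_unique[OF sp that(1) assms(1) lp lp] that assms by blast
  have "e \<in> tarcs T" using assms node_sub(1) by (auto simp: candidate_def)
  then show ?thesis
    using not_retained_iff[OF prefix_all(1)] prefix_all(2) uniq assms(1)
    unfolding E_def removable_def by blast
qed

text \<open>The claim would be false for a leaf whose edge has been removed. Leaves are therefore
  assumed to be retained, and a P-node never applies the induction hypothesis to a leaf.\<close>

lemma flows_covered:
  assumes "\<sigma> \<in> nodes T" "\<And>e. \<sigma> = Leaf e \<Longrightarrow> e \<in> E"
    "x \<in> tverts \<sigma>" "y \<in> tverts \<sigma>" "x \<noteq> y"
  shows "\<alpha> * flow (tarcs \<sigma>) x y \<le> flow (E \<inter> tarcs \<sigma>) x y"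
  using assms
proof (induction \<sigma> arbitrary: x y)
  case (Leaf e)
  then have "E \<inter> tarcs (Leaf e) = tarcs (Leaf e)" by auto
  then show ?case using alpha by (simp add: mult_left_le_one_le)
next
  case (Ser l r)
  have sps: "sp_tree (Ser l r)" using sp_node Ser.prems(1) .
  have nodes: "l \<in> nodes T" "r \<in> nodes T" using nodes_trans[OF _ Ser.prems(1)] by auto
  have leaf: "e \<in> E" if "l = Leaf e \<or> r = Leaf e" for e
    unfolding E_def using leaf_retained[OF prefix_all(1) Ser.prems(1)] that by auto
  have IHl: "\<alpha> * flow (tarcs l) x y \<le> flow (E \<inter> tarcs l) x y" if "x \<in> tverts l" "y \<in> tverts l" "x \<noteq> y" for x y
    using Ser.IH(1)[OF nodes(1)] leaf that by blast
  have IHr: "\<alpha> * flow (tarcs r) x y \<le> flow (E \<inter> tarcs r) x y" if "x \<in> tverts r" "y \<in> tverts r" "x \<noteq> y" for x y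
    using Ser.IH(2)[OF nodes(2)] leaf that by blast
  let ?A = "tarcs (Ser l r)"
  have inter: "?A \<inter> tarcs l = tarcs l" "E \<inter> ?A \<inter> tarcs l = E \<inter> tarcs l"
    "?A \<inter> tarcs r = tarcs r" "E \<inter> ?A \<inter> tarcs r = E \<inter> tarcs r" by auto
  have conf: "confined ?A l True" "confined ?A r True" using confined_ser[OF sps confined_self] by auto
  consider "x \<in> tverts l" "y \<in> tverts l" | "x \<in> tverts r" "y \<in> tverts r"
    | "x \<in> tverts l" "y \<in> tverts r" "x \<notin> tverts r" "y \<notin> tverts l"
    | "x \<in> tverts r" "y \<in> tverts l" "x \<notin> tverts l" "y \<notin> tverts r" using Ser.prems(3,4) unfolding tree_graph_sel by blast
  then show ?case
  proof cases
    case 1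
    have "flow ?A x y = flow (?A \<inter> tarcs l) x y" "flow (E \<inter> ?A) x y = flow (E \<inter> ?A \<inter> tarcs l) x y"
      by (rule flow_confined[OF conf(1) finite_tree(2) _ 1 Ser.prems(5)]; blast)+
    then show ?thesis using IHl[OF 1 Ser.prems(5)] inter by simp
  next
    case 2
    have "flow ?A x y = flow (?A \<inter> tarcs r) x y" "flow (E \<inter> ?A) x y = flow (E \<inter> ?A \<inter> tarcs r) x y"
      by (rule flow_confined[OF conf(2) finite_tree(2) _ 2 Ser.prems(5)]; blast)+
    then show ?thesis using IHr[OF 2 Ser.prems(5)] inter by simp
  next
    case 3
    let ?u = "tree_sink l"
    have "sp_tree l" "?u = tree_source r" using sps by simp_all
    then have u: "?u \<in> tverts l" "?u \<in> tverts r" using terminals_in_tverts by metis+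
    have ne: "x \<noteq> ?u" "y \<noteq> ?u" using 3 u by blast+
    have "flow ?A x y = min (flow (tarcs l) x ?u) (flow (tarcs r) ?u y)"
      using flow_ser[OF sps _ 3(1,2) ne, of ?A] inter by simp
    moreover have "flow (E \<inter> ?A) x y = min (flow (E \<inter> tarcs l) x ?u) (flow (E \<inter> tarcs r) ?u y)"
      using flow_ser[OF sps _ 3(1,2) ne, of "E \<inter> ?A"] inter by simp
    ultimately show ?thesis
      using scaled_min_le[OF alpha(1) IHl[OF 3(1) u(1) ne(1)] IHr[OF u(2) 3(2) ne(2)[symmetric]]] by simp
  next
    case 4
    \<comment> \<open>There is no way back from the right part, so such a pair requires
      nothing.\<close>
    have "(x, y) \<notin> ?A\<^sup>*" using ser_path_from_right[OF sps _ _ 4(1), of ?A y] 4(4) by auto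
    then have "flow ?A x y = 0" by (simp add: flow_unreachable)
    then show ?thesis by simp
  qed
next
  case (Par l r)
  have sps: "sp_tree (Par l r)" "clean (Par l r)" using sp_node clean_node Par.prems(1) by blast+
  have nodes: "l \<in> nodes T" "r \<in> nodes T" using nodes_trans[OF _ Par.prems(1)] by auto
  let ?A = "tarcs (Par l r)" and ?s = "tree_source l" and ?t = "tree_sink l"
  have st: "?s \<in> tverts l" "?t \<in> tverts l" "?s \<in> tverts r" "?t \<in> tverts r" "?s \<noteq> ?t"
    "tree_source r = ?s" "tree_sink r = ?t" using sps(1) terminals_neq by auto
  have inter: "?A \<inter> tarcs l = tarcs l" "E \<inter> ?A \<inter> tarcs l = E \<inter> tarcs l"
    "?A \<inter> tarcs r = tarcs r" "E \<inter> ?A \<inter> tarcs r = E \<inter> tarcs r" by auto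
  \<comment> \<open>A leaf has no vertices but the two terminals, so for every other pair of
    distinct vertices the child containing them is not a leaf and the induction hypothesis
    applies.\<close>
  have leafs: "x \<in> {?s, ?t} \<and> y \<in> {?s, ?t}" if "l = Leaf e \<and> x \<in> tverts l \<and> y \<in> tverts l \<or>
      r = Leaf e \<and> x \<in> tverts r \<and> y \<in> tverts r" for e x y
    using that st(6,7) by auto
  have rev: "flow F ?t ?s = 0" if "F \<subseteq> ?A" for F
  proof (rule flow_unreachable)
    show "(?t, ?s) \<notin> F\<^sup>*" using sink_reaches[OF sps(1) that] st(5) by auto
  qed (use that finite_subset finite_tree(2) in blast)
  have IHl: "\<alpha> * flow (tarcs l) x y \<le> flow (E \<inter> tarcs l) x y" if "x \<in> tverts l" "y \<in> tverts l" "x \<noteq> y" "\<And>e. l \<noteq> Leaf e" for x y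
    using Par.IH(1)[OF nodes(1) _ that(1-3)] that(4) by blast
  have IHr: "\<alpha> * flow (tarcs r) x y \<le> flow (E \<inter> tarcs r) x y" if "x \<in> tverts r" "y \<in> tverts r" "x \<noteq> y" "\<And>e. r \<noteq> Leaf e" for x y
    using Par.IH(2)[OF nodes(2) _ that(1-3)] that(4) by blast
  have conf: "confined ?A l False" "confined ?A r False" using confined_par[OF sps(1) confined_self] by auto
  show ?case
  proof (cases "(x, y) = (?s, ?t) \<or> (x, y) = (?t, ?s)")
    case True
    have "\<alpha> * flow ?A ?s ?t \<le> flow (E \<inter> ?A) ?s ?t"
    proof (cases "\<exists>e. l = Leaf e \<or> r = Leaf e")
      case False
      have "\<alpha> * flow (tarcs l) ?s ?t \<le> flow (E \<inter> tarcs l) ?s ?t" using IHl st False by blast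
      moreover have "\<alpha> * flow (tarcs r) ?s ?t \<le> flow (E \<inter> tarcs r) ?s ?t" using IHr st False by blast
      ultimately show ?thesis using flow_par[OF sps(1), of ?A] flow_par[OF sps(1), of "E \<inter> ?A"] inter
        by (simp add: algebra_simps)
    next
      case True
      then obtain e k where k: "l = Leaf e \<and> k = r \<or> r = Leaf e \<and> k = l" by blast
      note R = removable_par_iff(1,2)[OF refl Par.prems(1) k, of E] removable_par_iff(3)[OF refl Par.prems(1) k]
      have kn: "\<And>e. k \<noteq> Leaf e"
      proof
        fix f assume "k = Leaf f"
        then show False using k sps(1) by (cases e; cases f) auto
      qed
      have ks: "tree_source k = ?s" "tree_sink k = ?t" using k st by auto
      have T: "tflow (tarcs T) k = flow (tarcs k) ?s ?t" "tflow (tarcs T) (Par l r) = flow ?A ?s ?t"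
        using ks k nodes Par.prems(1) node_sub(1)[of _ T] by (auto simp: inf.absorb2)
      have IHk: "\<alpha> * flow (tarcs k) ?s ?t \<le> flow (E \<inter> tarcs k) ?s ?t"
        using k IHl[OF st(1,2,5)] IHr[OF st(3,4,5)] kn by blast
      have sum: "flow (E \<inter> ?A) ?s ?t = flow (E \<inter> tarcs k) ?s ?t + (if e \<in> E then 1 else 0)"
        using R(2) ks by simp
      have sumA: "flow ?A ?s ?t = flow (tarcs k) ?s ?t + 1" using R(3) T by simp
      \<comment> \<open>A retained edge adds one unit to the right-hand side but only \<alpha> < 1
        to the left-hand side. A removed edge has passed the test, which is precisely the
        claim.\<close>
      show ?thesis
      proof (cases "e \<in> E")
        case True
        have "\<alpha> * real (flow ?A ?s ?t) = \<alpha> * flow (tarcs k) ?s ?t + \<alpha>" using sumA by (simp add: algebra_simps)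
        then show ?thesis using sum True IHk alpha by simp
      next
        case False
        have "candidate (Par l r) e" using candidate_iff[OF sps] k by auto
        then have "removable E (Par l r) e" using not_in_E_iff[OF Par.prems(1)] False by blast
        then show ?thesis using R(1) sum sumA T(1) ks False by auto
      qed
    qed
    then show ?thesis using True rev[of ?A] by auto
  next
    case False
    consider "x \<in> tverts l" "y \<in> tverts l" | "x \<in> tverts r" "y \<in> tverts r"
      | "x \<in> tverts l" "y \<in> tverts r" "x \<notin> tverts r" "y \<notin> tverts l"
      | "x \<in> tverts r" "y \<in> tverts l" "x \<notin> tverts l" "y \<notin> tverts r" using Par.prems(3,4) unfolding tree_graph_sel by blast
    then show ?thesis
    proof cases
      case 1
      have nl: "\<And>e. l \<noteq> Leaf e" using leafs 1 False Par.prems(5) by auto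
      have "flow ?A x y = flow (?A \<inter> tarcs l) x y" "flow (E \<inter> ?A) x y = flow (E \<inter> ?A \<inter> tarcs l) x y"
        by (rule flow_confined[OF conf(1) finite_tree(2) _ 1 Par.prems(5)]; use False in blast)+
      then show ?thesis using IHl[OF 1 Par.prems(5) nl] inter by simp
    next
      case 2
      have nl: "\<And>e. r \<noteq> Leaf e" using leafs 2 False Par.prems(5) by auto
      have "flow ?A x y = flow (?A \<inter> tarcs r) x y" "flow (E \<inter> ?A) x y = flow (E \<inter> ?A \<inter> tarcs r) x y"
        by (rule flow_confined[OF conf(2) finite_tree(2) _ 2 Par.prems(5)]; use False st(6,7) in fastforce)+
      then show ?thesis using IHr[OF 2 Par.prems(5) nl] inter by simp
    next
      case 3
      have "(x, y) \<notin> ?A\<^sup>*" using par_path_crossing[OF sps(1) _ _ 3(1,2), of ?A] 3 by auto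
      then have "flow ?A x y = 0" by (simp add: flow_unreachable)
      then show ?thesis by simp
    next
      case 4
      have "(x, y) \<notin> ?A\<^sup>*"
        using par_path_crossing[OF sp_tree_Par_comm[OF sps(1)] _ _ 4(1,2), of ?A] 4 by auto
      then have "flow ?A x y = 0" by (simp add: flow_unreachable)
      then show ?thesis by simp
    qed
  qed
qed

lemma retained_feasible: "mcps_feasible \<alpha> (tree_graph T) E"
  unfolding mcps_feasible_def
proof (intro conjI ballI)
  show "E \<subseteq> tarcs T" by (rule E_subset)
  fix x y assume xy: "x \<in> tverts T" "y \<in> tverts T"
  show "covered \<alpha> (tree_graph T) E x y"
  proof (cases "x = y")
    case True
    then show ?thesis using covered_self[OF E_subset xy(1) alpha(2)] by simp
  next
    case False
    \<comment> \<open>A tree consisting of a leaf has no P-node, so nothing has been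
      removed.\<close>
    have "e \<in> E" if "T = Leaf e" for e
    proof -
      have "\<not> candidate \<sigma> e" if "\<sigma> \<in> nodes T" for \<sigma> using that \<open>T = Leaf e\<close> by (auto simp: candidate_def)
      then show ?thesis using not_retained_iff[OF prefix_all(1), of e] prefix_all(2) that
        unfolding E_def removable_def by auto
    qed
    from flows_covered[OF node_refl this xy False]
    show ?thesis using covered_iff[OF E_subset xy(1) False] E_subset by (simp add: inf.absorb1)
  qed
qed

text \<open>Every unit of flow by which a feasible solution exceeds the one of the algorithm has been paid
  for by an additional edge.\<close>

lemma retained_minimal:
  assumes F: "mcps_feasible \<alpha> (tree_graph T) F" and "\<sigma> \<in> nodes T" "\<And>e. \<sigma> = Leaf e \<Longrightarrow> e \<in> F"
  shows "card (E \<inter> tarcs \<sigma>) + (tflow F \<sigma> - tflow E \<sigma>) \<le> card (F \<inter> tarcs \<sigma>)"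
  using assms(2,3)
proof (induction \<sigma>)
  case (Leaf e)
  have "sp_tree (Leaf e)" using sp_node Leaf.prems(1) .
  then show ?case using tflow_Leaf[of e F] tflow_Leaf[of e E] Leaf.prems(2) by (cases "e \<in> E") auto
next
  case (Ser l r)
  have sps: "sp_tree (Ser l r)" using sp_node Ser.prems(1) .
  have nodes: "l \<in> nodes T" "r \<in> nodes T" using nodes_trans[OF _ Ser.prems(1)] by auto
  \<comment> \<open>Children of an S-node are confined without exception, so the flow of the whole
    graph between the ends of such a leaf is one. As \<alpha> > 0, a feasible set must contain the
    edge.\<close>
  have leaf: "e \<in> F" if e: "k = Leaf e" "k = l \<or> k = r" for e k
  proof -
    have kT: "k \<in> nodes T" "sp_tree k" using nodes e(2) sp_node by auto
    have c: "confined (tarcs T) k True" using confined_node(2,3)[OF Ser.prems(1) refl] e(2) by auto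
    have v: "tree_source k \<in> tverts T" "tree_sink k \<in> tverts T" "tree_source k \<noteq> tree_sink k"
      using node_sub(2)[OF kT(1)] kT(2) terminals_in_tverts[of k] terminals_neq[OF kT(2)] by auto
    have Fs: "F \<subseteq> tarcs T" using F by (simp add: mcps_feasible_def)
    have "flow F (tree_source k) (tree_sink k) = tflow F k"
      by (rule flow_confined[OF c _ Fs _ _ v(3)]) (use kT in auto)
    moreover have "flow (tarcs T) (tree_source k) (tree_sink k) = tflow (tarcs T) k"
      by (rule flow_confined[OF c _ order_refl _ _ v(3)]) (use kT in auto)
    moreover have "covered \<alpha> (tree_graph T) F (tree_source k) (tree_sink k)"
      using F v by (simp add: mcps_feasible_def)
    moreover have "tflow (tarcs T) k = 1"
      using tflow_Leaf[of e "tarcs T"] e(1) kT node_sub(1)[OF kT(1)] by auto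
    ultimately have "\<alpha> \<le> tflow F k" using covered_iff[OF Fs v(1,3)] by simp
    then show ?thesis using tflow_Leaf[of e F] e(1) kT(2) alpha by (auto split: if_splits)
  qed
  have inter: "E \<inter> tarcs (Ser l r) = (E \<inter> tarcs l) \<union> (E \<inter> tarcs r)"
    "F \<inter> tarcs (Ser l r) = (F \<inter> tarcs l) \<union> (F \<inter> tarcs r)" by auto
  have "card (E \<inter> tarcs (Ser l r)) = card (E \<inter> tarcs l) + card (E \<inter> tarcs r)"
    "card (F \<inter> tarcs (Ser l r)) = card (F \<inter> tarcs l) + card (F \<inter> tarcs r)"
    unfolding inter by (rule card_Un_disjoint; use ser_arcs_disjoint[OF sps] in auto)+
  moreover have "card (E \<inter> tarcs l) + (tflow F l - tflow E l) \<le> card (F \<inter> tarcs l)"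
    using Ser.IH(1)[OF nodes(1)] leaf by blast
  moreover have "card (E \<inter> tarcs r) + (tflow F r - tflow E r) \<le> card (F \<inter> tarcs r)"
    using Ser.IH(2)[OF nodes(2)] leaf by blast
  \<comment> \<open>The difference of the two minima is at most the difference at the child with the
    smaller flow in \<open>E\<close>, and the induction hypothesis for that child pays for
    it.\<close>
  ultimately show ?case using tflow_Ser[OF sps, of E] tflow_Ser[OF sps, of F] by linarith
next
  case (Par l r)
  have sps: "sp_tree (Par l r)" "clean (Par l r)" using sp_node clean_node Par.prems(1) by blast+
  have nodes: "l \<in> nodes T" "r \<in> nodes T" using nodes_trans[OF _ Par.prems(1)] by auto
  have inter: "E \<inter> tarcs (Par l r) = (E \<inter> tarcs l) \<union> (E \<inter> tarcs r)"
    "F \<inter> tarcs (Par l r) = (F \<inter> tarcs l) \<union> (F \<inter> tarcs r)" by auto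
  have card: "card (E \<inter> tarcs (Par l r)) = card (E \<inter> tarcs l) + card (E \<inter> tarcs r)"
    "card (F \<inter> tarcs (Par l r)) = card (F \<inter> tarcs l) + card (F \<inter> tarcs r)"
    unfolding inter by (rule card_Un_disjoint; use sps(1) in auto)+
  show ?case
  proof (cases "\<exists>e. l = Leaf e \<or> r = Leaf e")
    case False
    then have "card (E \<inter> tarcs l) + (tflow F l - tflow E l) \<le> card (F \<inter> tarcs l)"
      "card (E \<inter> tarcs r) + (tflow F r - tflow E r) \<le> card (F \<inter> tarcs r)"
      using Par.IH nodes by blast+
    then show ?thesis using tflow_Par[OF sps(1), of E] tflow_Par[OF sps(1), of F] card by linarith
  next
    case True
    then obtain e k where k: "l = Leaf e \<and> k = r \<or> r = Leaf e \<and> k = l" by blast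
    note RE = removable_par_iff(1,2)[OF refl Par.prems(1) k, of E]
    note RF = removable_par_iff(1,2)[OF refl Par.prems(1) k, of F] removable_par_iff(3)[OF refl Par.prems(1) k]
    have kn: "\<And>e. k \<noteq> Leaf e"
    proof
      fix f assume "k = Leaf f"
      then show False using k sps(1) by (cases e; cases f) auto
    qed
    have IH: "card (E \<inter> tarcs k) + (tflow F k - tflow E k) \<le> card (F \<inter> tarcs k)"
      using k Par.IH nodes kn by blast
    have "card (X \<inter> tarcs (Leaf e)) = (if e \<in> X then 1 else 0)" for X by auto
    then have cards: "card (E \<inter> tarcs (Par l r)) = card (E \<inter> tarcs k) + (if e \<in> E then 1 else 0)"
      "card (F \<inter> tarcs (Par l r)) = card (F \<inter> tarcs k) + (if e \<in> F then 1 else 0)"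
      using k card by auto
    have cand: "candidate (Par l r) e" using candidate_iff[OF sps] k by auto
    let ?c = "\<alpha> * real (tflow (tarcs T) k + 1)"
    have E: "e \<notin> E \<longleftrightarrow> ?c \<le> tflow E k" using not_in_E_iff[OF Par.prems(1) cand] RE(1) by blast
    have Fk: "?c \<le> tflow F (Par l r)"
    proof -
      let ?s = "tree_source (Par l r)" and ?t = "tree_sink (Par l r)"
      have Fs: "F \<subseteq> tarcs T" using F by (simp add: mcps_feasible_def)
      have c: "confined (tarcs T) (Par l r) True" using confined_node(1)[OF Par.prems(1) refl, of e] k by auto
      note st = terminals_in_tverts(1)[of "Par l r"] terminals_in_tverts(2)[OF sps(1)]
      then have v: "?s \<in> tverts T" "?t \<in> tverts T" "?s \<noteq> ?t"
        using node_sub(2)[OF Par.prems(1)] terminals_neq[OF sps(1)] by blast+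
      have "flow F ?s ?t = tflow F (Par l r)"
        by (rule flow_confined[OF c finite_tree(2) Fs st v(3)]) blast
      moreover have "flow (tarcs T) ?s ?t = tflow (tarcs T) (Par l r)"
        by (rule flow_confined[OF c finite_tree(2) order_refl st v(3)]) blast
      moreover have "covered \<alpha> (tree_graph T) F ?s ?t" using F v by (simp add: mcps_feasible_def)
      ultimately show ?thesis using covered_iff[OF Fs v(1,3)] RF(3) by simp
    qed
    \<comment> \<open>If the algorithm kept \<open>e\<close>, its flow in the sibling is below
      \<open>?c\<close>, whereas \<open>F\<close> without \<open>e\<close> has to reach
      \<open>?c\<close> inside the sibling. The resulting surplus of at least one unit, paid for by
      the induction hypothesis, makes up for the edge \<open>e\<close>.\<close>
    have "tflow E k < tflow F k" if "e \<in> E" "e \<notin> F"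
    proof -
      have "real (tflow E k) < real (tflow F k)" using E that Fk RF(2) by auto
      then show ?thesis by simp
    qed
    then show ?thesis using IH cards RE(2) RF(2) by auto
  qed
qed

lemma retained_optimal: "mcps_optimal \<alpha> (tree_graph T) E"
  unfolding mcps_optimal_def
proof (intro conjI allI impI)
  show "mcps_feasible \<alpha> (tree_graph T) E" by (rule retained_feasible)
  fix F assume F: "mcps_feasible \<alpha> (tree_graph T) F"
  then have Fs: "F \<subseteq> tarcs T" by (simp add: mcps_feasible_def)
  \<comment> \<open>For a single edge there is no parent that forces it into \<open>F\<close>; its
    own constraint does so because \<alpha> > 0.\<close>
  have "e \<in> F" if T: "T = Leaf e" for e
  proof -
    have v: "fst e \<in> tverts T" "fst e \<noteq> snd e" "sp_tree (Leaf e)" using T sp by auto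
    have "covered \<alpha> (tree_graph T) F (fst e) (snd e)" using F T by (simp add: mcps_feasible_def)
    then have "\<alpha> * flow {e} (fst e) (snd e) \<le> flow F (fst e) (snd e)" "F \<inter> {e} = F"
      using covered_iff[OF Fs v(1,2)] Fs T by auto
    then show ?thesis
      using tflow_Leaf[OF v(3), of F] tflow_Leaf[OF v(3), of "{e}"] alpha by (auto split: if_splits)
  qed
  from retained_minimal[OF F node_refl this] show "card E \<le> card F"
    using E_subset Fs by (simp add: inf.absorb1)
qed

end

end

section \<open>Reducing series-parallel graphs\<close>

lemma graph_union_sel [simp]:
  "pverts (graph_union H K) = pverts H \<union> pverts K"
  "parcs (graph_union H K) = parcs H \<union> parcs K"
  by (simp_all add: graph_union_def)

lemma single_edge_sel [simp]:
  "pverts (single_edge s t) = {s, t}" "parcs (single_edge s t) = {(s, t)}"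
  by (simp_all add: single_edge_def)

lemma pair_pre_digraph_eqI:
  fixes G H :: "'a pair_pre_digraph"
  shows "pverts G = pverts H \<Longrightarrow> parcs G = parcs H \<Longrightarrow> G = H"
  by (rule pair_pre_digraph.equality) simp_all

lemma dsp_cong:
  assumes "dsp s t H" "pverts G = pverts H" "parcs G = parcs H"
  shows "dsp s t G"
  using assms(1) pair_pre_digraph_eqI[OF assms(2,3)] by simp

lemma dsp_edgeI:
  assumes "s \<noteq> t" "pverts G = {s, t}" "parcs G = {(s, t)}"
  shows "dsp s t G"
  by (rule dsp_cong[OF dsp.edge[OF assms(1)]]) (simp_all add: assms)

lemma dsp_parallelI:
  assumes "dsp s t H" "dsp s t K" "pverts H \<inter> pverts K = {s, t}" "parcs H \<inter> parcs K = {}"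
    "pverts G = pverts H \<union> pverts K" "parcs G = parcs H \<union> parcs K"
  shows "dsp s t G"
  by (rule dsp_cong[OF dsp.parallel[OF assms(1-4)]]) (simp_all add: assms)

lemma dsp_seriesI:
  assumes "dsp s u H" "dsp u t K" "pverts H \<inter> pverts K = {u}"
    "pverts G = pverts H \<union> pverts K" "parcs G = parcs H \<union> parcs K"
  shows "dsp s t G"
  by (rule dsp_cong[OF dsp.series[OF assms(1-3)]]) (simp_all add: assms)

lemma dsp_basic:
  assumes "dsp s t G"
  shows "s \<in> pverts G" "t \<in> pverts G" "s \<noteq> t" "finite (pverts G)" "finite (parcs G)"
  using assms by (induction) auto

lemma dsp_arcs_in_verts: "dsp s t G \<Longrightarrow> (x, y) \<in> parcs G \<Longrightarrow> x \<in> pverts G \<and> y \<in> pverts G"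
  by (induction rule: dsp.induct) auto

lemma dsp_verts:
  assumes "dsp s t G"
  shows "pverts G = fst ` parcs G \<union> snd ` parcs G"
  using assms
proof (induction rule: dsp.induct)
  case (parallel s t H K)
  then show ?case unfolding graph_union_sel image_Un by blast
next
  case (series s u H t K)
  then show ?case unfolding graph_union_sel image_Un by blast
qed auto

lemma dsp_series_disjoint:
  assumes "dsp s u H" "dsp u t K" "pverts H \<inter> pverts K = {u}"
  shows "s \<notin> pverts K" "t \<notin> pverts H" "s \<noteq> t"
proof -
  show s: "s \<notin> pverts K" using dsp_basic(1,3)[OF assms(1)] assms(3) by blast
  show "t \<notin> pverts H" using dsp_basic(2,3)[OF assms(2)] assms(3) by (metis IntI singletonD)
  show "s \<noteq> t" using s dsp_basic(2)[OF assms(2)] by blast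
qed

lemma dsp_terminal_arcs:
  assumes "dsp s t G"
  shows "(x, s) \<notin> parcs G \<and> (t, x) \<notin> parcs G"
  using assms
proof (induction arbitrary: x rule: dsp.induct)
  case (series s u H t K)
  then show ?case
    using dsp_series_disjoint[OF series.hyps(1-3)] dsp_arcs_in_verts[OF series.hyps(1)]
      dsp_arcs_in_verts[OF series.hyps(2)] by (metis UnE graph_union_sel(2))
qed auto

text \<open>An arc and its reverse in different parts would join shared vertices, and then one of
  them would leave a sink. In particular the two neighbours of an eliminated vertex differ.\<close>

lemma dsp_asym:
  assumes "dsp s t G" "(x, y) \<in> parcs G"
  shows "(y, x) \<notin> parcs G"
  using assms
proof (induction arbitrary: x y rule: dsp.induct)
  case (parallel s t H K)
  have "(y, x) \<notin> parcs K" if "(x, y) \<in> parcs H" for x y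
  proof
    assume a: "(y, x) \<in> parcs K"
    then have "x \<in> {s, t}" "y \<in> {s, t}"
      using dsp_arcs_in_verts[OF parallel.hyps(1) that] dsp_arcs_in_verts[OF parallel.hyps(2) a]
        parallel.hyps(3) by blast+
    then show False
      using dsp_terminal_arcs[OF parallel.hyps(1)] dsp_terminal_arcs[OF parallel.hyps(2)] that a
        by (metis insertE singletonD)
  qed
  then show ?case using parallel by (metis UnE graph_union_sel(2))
next
  case (series s u H t K)
  have "(y, x) \<notin> parcs K" if "(x, y) \<in> parcs H" for x y
  proof
    assume a: "(y, x) \<in> parcs K"
    then have "x = u" using dsp_arcs_in_verts[OF series.hyps(1) that]
        dsp_arcs_in_verts[OF series.hyps(2) a] series.hyps(3) by blast
    then show False using dsp_terminal_arcs[OF series.hyps(1)] that by blast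
  qed
  then show ?case using series by (metis UnE graph_union_sel(2))
qed auto

text \<open>The case distinction carries the induction: at most one of two parallel parts contains
  the arc \<open>(s, t)\<close>, so their constants add up to at least 7, of which the two shared
  vertices consume 4. In an S-composition the constants give at least 6, of which the shared vertex
  consumes 2.\<close>

lemma dsp_few_arcs:
  assumes "dsp s t G"
  shows "card (parcs G) + (if (s, t) \<in> parcs G then 3 else 4) \<le> 2 * card (pverts G)"
  using assms
proof (induction rule: dsp.induct)
  case (parallel s t H K)
  have "card (parcs H \<union> parcs K) = card (parcs H) + card (parcs K)"
    using parallel.hyps dsp_basic(5) by (intro card_Un_disjoint) auto
  moreover have "card (pverts H \<union> pverts K) + 2 = card (pverts H) + card (pverts K)"
    using card_Un_Int[of "pverts H" "pverts K"] parallel.hyps dsp_basic[OF parallel.hyps(1)]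
      dsp_basic[OF parallel.hyps(2)] by simp
  ultimately show ?case using parallel.IH parallel.hyps(4) by (auto split: if_splits)
next
  case (series s u H t K)
  have "parcs H \<inter> parcs K = {}"
  proof (rule ccontr)
    assume "parcs H \<inter> parcs K \<noteq> {}"
    then obtain x y where a: "(x, y) \<in> parcs H" "(x, y) \<in> parcs K" by auto
    then have "x = u" using dsp_arcs_in_verts[OF series.hyps(1) a(1)]
        dsp_arcs_in_verts[OF series.hyps(2) a(2)] series.hyps(3) by blast
    then show False using dsp_terminal_arcs[OF series.hyps(1)] a by blast
  qed
  then have "card (parcs H \<union> parcs K) = card (parcs H) + card (parcs K)"
    using series.hyps dsp_basic(5) by (intro card_Un_disjoint) auto
  moreover have "card (pverts H \<union> pverts K) + 1 = card (pverts H) + card (pverts K)"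
    using card_Un_Int[of "pverts H" "pverts K"] series.hyps dsp_basic[OF series.hyps(1)]
      dsp_basic[OF series.hyps(2)] by simp
  moreover have "(s, t) \<notin> parcs (graph_union H K)"
    using dsp_series_disjoint[OF series.hyps(1-3)] dsp_arcs_in_verts[OF series.hyps(1)]
      dsp_arcs_in_verts[OF series.hyps(2)] by auto
  ultimately show ?case using series.IH by (auto split: if_splits)
qed auto

lemma dsp_sink_in: "dsp s t G \<Longrightarrow> \<exists>u. (u, t) \<in> parcs G"
  by (induction rule: dsp.induct) auto

text \<open>Duality: what is shown about the last arc of a graph carries over to the first
  one.\<close>

lemma dsp_reverse: "dsp s t G \<Longrightarrow> dsp t s \<lparr>pverts = pverts G, parcs = (parcs G)\<inverse>\<rparr>"
proof (induction rule: dsp.induct)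
  case (edge s t)
  then show ?case by (intro dsp_edgeI) auto
next
  case (parallel s t H K)
  show ?case by (rule dsp_parallelI[OF parallel.IH]) (use parallel.hyps in auto)
next
  case (series s u H t K)
  show ?case by (rule dsp_seriesI[OF series.IH(2,1)]) (use series.hyps in auto)
qed

section \<open>Splitting off arcs at the terminals\<close>

definition preds :: "('a \<times> 'a) set \<Rightarrow> 'a \<Rightarrow> 'a set" where
  "preds A v = {u. (u, v) \<in> A}"

definition succs :: "('a \<times> 'a) set \<Rightarrow> 'a \<Rightarrow> 'a set" where
  "succs A v = {w. (v, w) \<in> A}"

text \<open>The last arc is a series component of its own. The graph cannot be a P-composition: both
  parts have an arc into \<open>t\<close>, by uniqueness the same one, but their arc sets are
  disjoint.\<close>

lemma dsp_unique_pred_of_sink: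
  assumes "dsp s t G" "preds (parcs G) t = {u}"
  shows "u = s \<and> pverts G = {s, t} \<and> parcs G = {(s, t)} \<or>
    (\<exists>H. dsp s u H \<and> t \<notin> pverts H \<and> pverts G = insert t (pverts H) \<and> parcs G = insert (u, t) (parcs H))"
  using assms
proof (induction rule: dsp.induct)
  case (edge s t)
  then show ?case by (auto simp: preds_def)
next
  case (parallel s t H K)
  obtain x y where a: "(x, t) \<in> parcs H" "(y, t) \<in> parcs K"
    using dsp_sink_in[OF parallel.hyps(1)] dsp_sink_in[OF parallel.hyps(2)] by blast
  then have "x = u" "y = u" using parallel.prems by (auto simp: preds_def)
  then show ?case using a parallel.hyps(3,4) dsp_arcs_in_verts parallel.hyps(1,2) by blast
next
  case (series s x H t K)
  note d = dsp_series_disjoint[OF series.hyps(1-3)]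
  have "preds (parcs K) t = {u}"
    using series.prems d dsp_arcs_in_verts[OF series.hyps(1)] by (auto simp: preds_def)
  from series.IH(2)[OF this] show ?case
  proof
    assume "u = x \<and> pverts K = {x, t} \<and> parcs K = {(x, t)}"
    then show ?thesis using series.hyps(1) d dsp_basic(2)[OF series.hyps(1)]
      by (intro disjI2 exI[of _ H]) auto
  next
    assume "\<exists>K'. dsp x u K' \<and> t \<notin> pverts K' \<and> pverts K = insert t (pverts K') \<and> parcs K = insert (u, t) (parcs K')"
    then obtain K' where K': "dsp x u K'" "t \<notin> pverts K'" "pverts K = insert t (pverts K')"
      "parcs K = insert (u, t) (parcs K')" by blast
    have "pverts H \<inter> pverts K' = {x}" using series.hyps(3) K'(3) d dsp_basic(1)[OF K'(1)]
        dsp_basic(2)[OF series.hyps(1)] by blast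
    then have "dsp s u (graph_union H K')" using dsp.series[OF series.hyps(1) K'(1)] by blast
    then show ?thesis using K' d by (intro disjI2 exI[of _ "graph_union H K'"]) auto
  qed
qed

lemma dsp_unique_succ_of_source:
  assumes "dsp s t G" "succs (parcs G) s = {u}"
  shows "u = t \<and> pverts G = {s, t} \<and> parcs G = {(s, t)} \<or>
    (\<exists>H. dsp u t H \<and> s \<notin> pverts H \<and> pverts G = insert s (pverts H) \<and> parcs G = insert (s, u) (parcs H))"
proof -
  have "preds (parcs \<lparr>pverts = pverts G, parcs = (parcs G)\<inverse>\<rparr>) s = {u}"
    using assms(2) by (simp add: preds_def succs_def)
  from dsp_unique_pred_of_sink[OF dsp_reverse[OF assms(1)] this]
  show ?thesis
  proof
    assume "u = t \<and> pverts \<lparr>pverts = pverts G, parcs = (parcs G)\<inverse>\<rparr> = {t, s} \<and>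
      parcs \<lparr>pverts = pverts G, parcs = (parcs G)\<inverse>\<rparr> = {(t, s)}"
    then have "u = t" "pverts G = {s, t}" "converse (converse (parcs G)) = converse {(t, s)}" by auto
    moreover have "converse {(t, s)} = {(s, t)}" by auto
    ultimately show ?thesis by simp
  next
    assume "\<exists>H. dsp t u H \<and> s \<notin> pverts H \<and>
      pverts \<lparr>pverts = pverts G, parcs = (parcs G)\<inverse>\<rparr> = insert s (pverts H) \<and>
      parcs \<lparr>pverts = pverts G, parcs = (parcs G)\<inverse>\<rparr> = insert (u, s) (parcs H)"
    then obtain H where H: "dsp t u H" "s \<notin> pverts H" "pverts G = insert s (pverts H)"
      "(parcs G)\<inverse> = insert (u, s) (parcs H)" by auto
    have "parcs G = converse (converse (parcs G))" by simp
    also have "\<dots> = converse (insert (u, s) (parcs H))" using H(4) by (simp only:)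
    also have "\<dots> = insert (s, u) (converse (parcs H))" by auto
    finally show ?thesis using H dsp_reverse[OF H(1)]
      by (intro disjI2 exI[of _ "\<lparr>pverts = pverts H, parcs = converse (parcs H)\<rparr>"]) simp
  qed
qed

text \<open>Meant for an elimination that creates an arc already present in a parallel part: one of
  the two copies is given up, and the rest must again be series-parallel.\<close>

lemma dsp_remove_direct_arc:
  assumes "dsp s t G" "(s, t) \<in> parcs G" "parcs G \<noteq> {(s, t)}"
  shows "dsp s t \<lparr>pverts = pverts G, parcs = parcs G - {(s, t)}\<rparr>"
  using assms
proof (induction rule: dsp.induct)
  case (parallel s t H K)
  have *: "dsp s t \<lparr>pverts = pverts H \<union> pverts K, parcs = (parcs H \<union> parcs K) - {(s, t)}\<rparr>"
    if HK: "dsp s t H" "dsp s t K" "pverts H \<inter> pverts K = {s, t}" "parcs H \<inter> parcs K = {}"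
      "(s, t) \<in> parcs H"
      "parcs H \<noteq> {(s, t)} \<Longrightarrow> dsp s t \<lparr>pverts = pverts H, parcs = parcs H - {(s, t)}\<rparr>" for H K
  proof (cases "parcs H = {(s, t)}")
    case True
    then have "pverts H = {s, t}" using dsp_verts[OF HK(1)] by auto
    then show ?thesis using True HK dsp_basic[OF HK(2)] by (intro dsp_cong[OF HK(2)]) auto
  next
    case False
    show ?thesis by (rule dsp_parallelI[OF HK(6)[OF False] HK(2)]) (use HK in auto)
  qed
  show ?case
  proof (cases "(s, t) \<in> parcs H")
    case True
    then show ?thesis using *[OF parallel.hyps True parallel.IH(1)[OF True]] by simp
  next
    case False
    then have t: "(s, t) \<in> parcs K" using parallel.prems by auto
    have "pverts K \<inter> pverts H = {s, t}" "parcs K \<inter> parcs H = {}" using parallel.hyps by auto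
    from *[OF parallel.hyps(2,1) this t parallel.IH(2)[OF t]] show ?thesis by (simp add: Un_commute)
  qed
next
  case (series s u H t K)
  then show ?case using dsp_series_disjoint[OF series.hyps(1-3)] dsp_arcs_in_verts[OF series.hyps(1)]
      dsp_arcs_in_verts[OF series.hyps(2)] by auto
qed auto

section \<open>Existence and elimination of inner vertices\<close>

definition inner :: "('a \<times> 'a) set \<Rightarrow> 'a \<Rightarrow> 'a \<Rightarrow> 'a \<Rightarrow> bool" where
  "inner A u v w \<longleftrightarrow> preds A v = {u} \<and> succs A v = {w}"

lemma inner_arcs: "inner A u v w \<Longrightarrow> (u, v) \<in> A \<and> (v, w) \<in> A"
  by (auto simp: inner_def preds_def succs_def)

lemma inner_not_terminal: "dsp s t G \<Longrightarrow> inner (parcs G) u v w \<Longrightarrow> v \<noteq> s \<and> v \<noteq> t"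
  by (metis dsp_terminal_arcs inner_arcs)

lemma inner_Un:
  assumes "dsp s t K" "v \<notin> pverts K"
  shows "inner (A \<union> parcs K) u v w \<longleftrightarrow> inner A u v w"
proof -
  have "preds (A \<union> parcs K) v = preds A v" "succs (A \<union> parcs K) v = succs A v"
    using dsp_arcs_in_verts[OF assms(1)] assms(2) unfolding preds_def succs_def by blast+
  then show ?thesis by (simp add: inner_def)
qed

text \<open>The reduction cannot get stuck. Of two arc-disjoint parallel parts at least one is more
  than the arc between the terminals; if both parts of an S-composition are single arcs, the middle
  vertex qualifies. Inner vertices of a part are not terminals and hence remain inner.\<close>

lemma dsp_has_inner:
  assumes "dsp s t G" "parcs G \<noteq> {(s, t)}"
  shows "\<exists>u v w. inner (parcs G) u v w"
  using assms
proof (induction rule: dsp.induct)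
  case (edge s t)
  then show ?case by simp
next
  case (parallel s t H K)
  have *: "\<exists>u v w. inner (parcs H \<union> parcs K) u v w"
    if HK: "dsp s t H" "dsp s t K" "pverts H \<inter> pverts K = {s, t}" "\<exists>u v w. inner (parcs H) u v w" for H K
  proof -
    from HK(4) obtain u v w where i: "inner (parcs H) u v w" by blast
    then have "v \<in> pverts H" "v \<noteq> s" "v \<noteq> t"
      using inner_not_terminal[OF HK(1) i] inner_arcs[OF i] dsp_arcs_in_verts[OF HK(1)] by blast+
    then have "v \<notin> pverts K" using HK(3) by blast
    then show ?thesis using inner_Un[OF HK(2)] i by blast
  qed
  have "parcs H \<noteq> {(s, t)} \<or> parcs K \<noteq> {(s, t)}" using parallel.hyps(4) by auto
  then show ?case
  proof
    assume "parcs H \<noteq> {(s, t)}"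
    from *[OF parallel.hyps(1-3) parallel.IH(1)[OF this]] show ?thesis by simp
  next
    assume a: "parcs K \<noteq> {(s, t)}"
    have "pverts K \<inter> pverts H = {s, t}" using parallel.hyps(3) by blast
    from *[OF parallel.hyps(2,1) this parallel.IH(2)[OF a]] show ?thesis by (simp add: Un_commute)
  qed
next
  case (series s x H t K)
  note d = dsp_series_disjoint[OF series.hyps(1-3)]
  consider "parcs H \<noteq> {(s, x)}" | "parcs K \<noteq> {(x, t)}" | "parcs H = {(s, x)}" "parcs K = {(x, t)}" by blast
  then show ?case
  proof cases
    case 1
    from series.IH(1)[OF 1] obtain u v w where i: "inner (parcs H) u v w" by blast
    then have "v \<in> pverts H" "v \<noteq> x"
      using inner_not_terminal[OF series.hyps(1) i] inner_arcs[OF i] dsp_arcs_in_verts[OF series.hyps(1)] by blast+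
    then have "v \<notin> pverts K" using series.hyps(3) by blast
    then show ?thesis using inner_Un[OF series.hyps(2)] i by (metis graph_union_sel(2))
  next
    case 2
    from series.IH(2)[OF 2] obtain u v w where i: "inner (parcs K) u v w" by blast
    then have "v \<in> pverts K" "v \<noteq> x"
      using inner_not_terminal[OF series.hyps(2) i] inner_arcs[OF i] dsp_arcs_in_verts[OF series.hyps(2)] by blast+
    then have "v \<notin> pverts H" using series.hyps(3) by blast
    then show ?thesis using inner_Un[OF series.hyps(1)] i by (metis graph_union_sel(2) Un_commute)
  next
    case 3
    then have "inner (parcs (graph_union H K)) s x t"
      using dsp_basic(3)[OF series.hyps(1)] dsp_basic(3)[OF series.hyps(2)]
      by (auto simp: inner_def preds_def succs_def)
    then show ?thesis by blast
  qed
qed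

text \<open>Arcs form a set, so a new arc merges with an existing \<open>(u, w)\<close>: the series
  reduction and the ensuing parallel reduction happen at once.\<close>

definition contract :: "('a \<times> 'a) set \<Rightarrow> 'a \<Rightarrow> 'a \<Rightarrow> 'a \<Rightarrow> ('a \<times> 'a) set" where
  "contract A u v w = insert (u, w) (A - {(u, v), (v, w)})"

text \<open>Eliminating the cut vertex of an S-composition leaves neither part as it is. Uniqueness
  of the neighbours permits splitting off the last arc of \<open>H\<close> and the first arc of
  \<open>K\<close>, and the new arc takes their place in the series.\<close>

lemma dsp_contract_middle:
  assumes H: "dsp s v H" and K: "dsp v t K" and HK: "pverts H \<inter> pverts K = {v}"
    and p: "preds (parcs H) v = {u}" and q: "succs (parcs K) v = {w}"
  shows "dsp s t \<lparr>pverts = (pverts H \<union> pverts K) - {v}, parcs = contract (parcs H \<union> parcs K) u v w\<rparr>"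
proof -
  note d = dsp_series_disjoint[OF H K HK]
  have "(u, v) \<in> parcs H" using p by (auto simp: preds_def)
  then have uH: "(u, v) \<in> parcs H" "u \<in> pverts H" "u \<noteq> v"
    using dsp_arcs_in_verts[OF H] dsp_terminal_arcs[OF H] by blast+
  have "(v, w) \<in> parcs K" using q by (auto simp: succs_def)
  then have wK: "(v, w) \<in> parcs K" "w \<in> pverts K" "w \<noteq> v"
    using dsp_arcs_in_verts[OF K] dsp_terminal_arcs[OF K] by blast+
  have un: "u \<notin> pverts K" "w \<notin> pverts H" "u \<noteq> w" using uH wK HK by blast+
  have nH: "(v, w) \<notin> parcs H" "(u, v) \<notin> parcs K"
    using dsp_terminal_arcs[OF H] dsp_terminal_arcs[OF K] by blast+
  let ?M = "\<lparr>pverts = {u, w}, parcs = {(u, w)}\<rparr>"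
  have M: "dsp u w ?M" using un by (intro dsp_edgeI) auto
  \<comment> \<open>The part before the new arc may consist of the vertex \<open>s\<close> only, which is not a
    series-parallel graph.\<close>
  obtain L where L: "dsp s w L" "pverts L = insert w (pverts H - {v})"
    "parcs L = insert (u, w) (parcs H - {(u, v)})"
    using dsp_unique_pred_of_sink[OF H p]
  proof (elim disjE exE conjE)
    assume "u = s" "pverts H = {s, v}" "parcs H = {(s, v)}"
    then show ?thesis using M uH by (intro that[of ?M]) auto
  next
    fix H' assume H': "dsp s u H'" "v \<notin> pverts H'" "pverts H = insert v (pverts H')" "parcs H = insert (u, v) (parcs H')"
    have n: "(u, v) \<notin> parcs H'" using H' dsp_arcs_in_verts[OF H'(1)] by blast
    have "pverts H' \<inter> {u, w} = {u}" using H'(3) un dsp_basic(2)[OF H'(1)] by auto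
    then have "dsp s w (graph_union H' ?M)" by (intro dsp.series[OF H'(1) M]) simp
    moreover have "pverts H' \<union> {u, w} = insert w (pverts H - {v})"
      using H'(2,3) dsp_basic(2)[OF H'(1)] by blast
    moreover have "parcs H' \<union> {(u, w)} = insert (u, w) (parcs H - {(u, v)})" using H'(4) n by blast
    ultimately show ?thesis by (intro that[of "graph_union H' ?M"]) simp_all
  qed
  from dsp_unique_succ_of_source[OF K q] show ?thesis
  proof (elim disjE exE conjE)
    assume a: "w = t" "pverts K = {v, t}" "parcs K = {(v, t)}"
    have "insert w (pverts H - {v}) = (pverts H \<union> {v, t}) - {v}" using wK(3) a(1) by blast
    moreover have "insert (u, w) (parcs H - {(u, v)}) = contract (parcs H \<union> {(v, t)}) u v w"
      using nH a(1) by (auto simp: contract_def)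
    ultimately show ?thesis
      using L a by (intro dsp_cong[OF L(1)[unfolded a(1)]]) simp_all
  next
    fix K' assume K': "dsp w t K'" "v \<notin> pverts K'" "pverts K = insert v (pverts K')" "parcs K = insert (v, w) (parcs K')"
    have n: "(v, w) \<notin> parcs K'" "(u, v) \<notin> parcs K'" using K' dsp_arcs_in_verts[OF K'(1)] nH by blast+
    have "pverts L \<inter> pverts K' = {w}" using K'(2,3) L(2) HK un dsp_basic(1)[OF K'(1)] by auto
    moreover have "(pverts H \<union> insert v (pverts K')) - {v} = insert w (pverts H - {v}) \<union> pverts K'"
      using K'(2) dsp_basic(1)[OF K'(1)] by blast
    moreover have "contract (parcs H \<union> insert (v, w) (parcs K')) u v w = insert (u, w) (parcs H - {(u, v)}) \<union> parcs K'"
      using n nH(1) by (auto simp: contract_def)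
    ultimately show ?thesis
      by (intro dsp_seriesI[OF L(1) K'(1)]) (simp_all add: L(2,3) K'(3,4))
  qed
qed

text \<open>A vertex inside one part of a composition is eliminated there by induction. The obstacle
  is a P-composition whose other part already contains the new arc.\<close>

lemma dsp_contract:
  assumes "dsp s t G" "inner (parcs G) u v w"
  shows "dsp s t \<lparr>pverts = pverts G - {v}, parcs = contract (parcs G) u v w\<rparr>"
  using assms
proof (induction rule: dsp.induct)
  case (edge s t)
  then show ?case using inner_arcs[OF edge.prems] by auto
next
  case (parallel s t H K)
  have *: "dsp s t \<lparr>pverts = (pverts H \<union> pverts K) - {v}, parcs = contract (parcs H \<union> parcs K) u v w\<rparr>"
    if HK: "dsp s t H" "dsp s t K" "pverts H \<inter> pverts K = {s, t}" "parcs H \<inter> parcs K = {}"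
      and v: "v \<in> pverts H" "v \<noteq> s" "v \<noteq> t" "inner (parcs H \<union> parcs K) u v w"
      and IH: "inner (parcs H) u v w \<Longrightarrow> dsp s t \<lparr>pverts = pverts H - {v}, parcs = contract (parcs H) u v w\<rparr>"
    for H K
  proof -
    have vK: "v \<notin> pverts K" using v HK(3) by blast
    then have "inner (parcs H) u v w" using inner_Un[OF HK(2)] v(4) by blast
    note H' = IH[OF this]
    let ?H' = "\<lparr>pverts = pverts H - {v}, parcs = contract (parcs H) u v w\<rparr>"
    have nK: "(u, v) \<notin> parcs K" "(v, w) \<notin> parcs K" using vK dsp_arcs_in_verts[OF HK(2)] by blast+
    have vs: "(pverts H - {v}) \<inter> pverts K = {s, t}" using HK(3) v by blast
    have ps: "(pverts H \<union> pverts K) - {v} = (pverts H - {v}) \<union> pverts K" using vK by blast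
    have as: "contract (parcs H \<union> parcs K) u v w = contract (parcs H) u v w \<union> parcs K"
      unfolding contract_def using nK by blast
    show ?thesis
    proof (cases "(u, w) \<in> parcs K")
      case False
      then have "contract (parcs H) u v w \<inter> parcs K = {}" using HK(4) unfolding contract_def by blast
      then show ?thesis using vs ps as by (intro dsp_parallelI[OF H' HK(2)]) simp_all
    next
      case True
      have "(u, w) \<in> contract (parcs H) u v w" by (simp add: contract_def)
      then have "u \<in> pverts H - {v}" "w \<in> pverts H - {v}" using dsp_arcs_in_verts[OF H', of u w] by simp_all
      \<comment> \<open>The ends of the doubled arc belong to both parts, so they are
        terminals.\<close>
      then have "u \<in> {s, t}" "w \<in> {s, t}" using dsp_arcs_in_verts[OF HK(2) True] vs by blast+
      moreover have "u \<noteq> t" "w \<noteq> s" using dsp_terminal_arcs[OF HK(2)] True by metis+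
      ultimately have uw: "u = s" "w = t" by simp_all
      have disj: "(contract (parcs H) u v w - {(s, t)}) \<inter> parcs K = {}"
        using HK(4) unfolding contract_def uw by blast
      define B where "B = contract (parcs H) u v w"
      have HB: "dsp s t \<lparr>pverts = pverts H - {v}, parcs = B\<rparr>" using H' by (simp add: B_def)
      have st: "(s, t) \<in> B" "(s, t) \<in> parcs K" using True uw by (simp_all add: B_def contract_def)
      \<comment> \<open>The copy in the contracted part is dropped. If that part consists of this
        arc alone, only \<open>K\<close> remains.\<close>
      show ?thesis
      proof (cases "B = {(s, t)}")
        case only: True
        have "pverts H - {v} \<subseteq> {s, t}" using dsp_verts[OF HB] only by auto
        then have "pverts H - {v} \<union> pverts K = pverts K" using dsp_basic(1,2)[OF HK(2)] by blast
        moreover have "B \<union> parcs K = parcs K" unfolding only using st(2) by auto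
        ultimately show ?thesis unfolding ps as B_def[symmetric] by (intro dsp_cong[OF HK(2)]) simp_all
      next
        case False
        have B': "dsp s t \<lparr>pverts = pverts H - {v}, parcs = B - {(s, t)}\<rparr>"
          using dsp_remove_direct_arc[OF HB] st(1) False by simp
        have "B \<union> parcs K = (B - {(s, t)}) \<union> parcs K" using st(2) by blast
        then show ?thesis unfolding ps as B_def[symmetric]
          by (intro dsp_parallelI[OF B' HK(2)]) (simp_all add: vs disj[folded B_def])
      qed
    qed
  qed
  have i: "inner (parcs H \<union> parcs K) u v w" using parallel.prems by simp
  have v: "v \<noteq> s" "v \<noteq> t" using inner_not_terminal[OF dsp.parallel[OF parallel.hyps] parallel.prems] by blast+
  have "v \<in> pverts H \<or> v \<in> pverts K"
    using inner_arcs[OF i] dsp_arcs_in_verts[OF parallel.hyps(1)] dsp_arcs_in_verts[OF parallel.hyps(2)] by blast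
  then show ?case
  proof
    assume "v \<in> pverts H"
    from *[OF parallel.hyps this v i parallel.IH(1)] show ?thesis by simp
  next
    assume vK: "v \<in> pverts K"
    have "pverts K \<inter> pverts H = {s, t}" "parcs K \<inter> parcs H = {}" "inner (parcs K \<union> parcs H) u v w"
      using parallel.hyps i by (auto simp: Un_commute)
    from *[OF parallel.hyps(2,1) this(1,2) vK v this(3) parallel.IH(2)]
    show ?thesis by (simp add: Un_commute)
  qed
next
  case (series s x H t K)
  have i: "inner (parcs H \<union> parcs K) u v w" using series.prems by simp
  have vHK: "v \<in> pverts H \<or> v \<in> pverts K"
    using inner_arcs[OF i] dsp_arcs_in_verts[OF series.hyps(1)] dsp_arcs_in_verts[OF series.hyps(2)] by blast
  have nt: "v \<noteq> s" "v \<noteq> t" using inner_not_terminal[OF dsp.series[OF series.hyps] series.prems] by blast+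
  consider "v = x" | "v \<in> pverts H" "v \<notin> pverts K" "v \<noteq> x" | "v \<in> pverts K" "v \<notin> pverts H" "v \<noteq> x"
    using vHK series.hyps(3) by blast
  then show ?case
  proof cases
    case 1
    have "preds (parcs H \<union> parcs K) v = preds (parcs H) v" "succs (parcs H \<union> parcs K) v = succs (parcs K) v"
      using dsp_terminal_arcs[OF series.hyps(1)] dsp_terminal_arcs[OF series.hyps(2)]
      unfolding 1 preds_def succs_def by blast+
    then have "preds (parcs H) v = {u}" "succs (parcs K) v = {w}" using i by (simp_all add: inner_def)
    then show ?thesis using dsp_contract_middle[of s v H t K u w] series.hyps 1 by simp
  next
    case 2
    then have H': "dsp s x \<lparr>pverts = pverts H - {v}, parcs = contract (parcs H) u v w\<rparr>"
      using series.IH(1) inner_Un[OF series.hyps(2)] i by blast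
    have "(u, v) \<notin> parcs K" "(v, w) \<notin> parcs K" using 2 dsp_arcs_in_verts[OF series.hyps(2)] by blast+
    then have "contract (parcs H \<union> parcs K) u v w = contract (parcs H) u v w \<union> parcs K"
      by (auto simp: contract_def)
    moreover have "(pverts H - {v}) \<inter> pverts K = {x}" "(pverts H \<union> pverts K) - {v} = (pverts H - {v}) \<union> pverts K"
      using series.hyps(3) 2 by blast+
    ultimately show ?thesis
      by (intro dsp_seriesI[OF H' series.hyps(2)]) simp_all
  next
    case 3
    then have K': "dsp x t \<lparr>pverts = pverts K - {v}, parcs = contract (parcs K) u v w\<rparr>"
      using series.IH(2) inner_Un[OF series.hyps(1)] i by (metis Un_commute)
    have "(u, v) \<notin> parcs H" "(v, w) \<notin> parcs H" using 3 dsp_arcs_in_verts[OF series.hyps(1)] by blast+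
    then have "contract (parcs H \<union> parcs K) u v w = parcs H \<union> contract (parcs K) u v w"
      by (auto simp: contract_def)
    moreover have "pverts H \<inter> (pverts K - {v}) = {x}" "(pverts H \<union> pverts K) - {v} = pverts H \<union> (pverts K - {v})"
      using series.hyps(3) 3 by blast+
    ultimately show ?thesis
      by (intro dsp_seriesI[OF series.hyps(1) K']) simp_all
  qed
qed

section \<open>Running programs\<close>

text \<open>Intermediate states must not have terminated, so that they can be put in front of a continuation.\<close>

inductive reaches :: "real \<Rightarrow> nat \<Rightarrow> program \<times> memory \<Rightarrow> program \<times> memory \<Rightarrow> bool" for \<alpha> where
  stay: "reaches \<alpha> 0 x x"
| move: "fst x \<noteq> Skip \<Longrightarrow> reaches \<alpha> k (step \<alpha> x) y \<Longrightarrow> reaches \<alpha> (Suc k) x y"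

lemma reaches_funpow: "reaches \<alpha> k x y \<Longrightarrow> (step \<alpha> ^^ k) x = y"
  by (induction rule: reaches.induct) (simp_all add: funpow_swap1)

lemma reaches_trans: "reaches \<alpha> j x y \<Longrightarrow> reaches \<alpha> k y z \<Longrightarrow> reaches \<alpha> (j + k) x z"
  by (induction rule: reaches.induct) (auto intro: reaches.move)

lemma reaches_Seq:
  "reaches \<alpha> k x y \<Longrightarrow> reaches \<alpha> k (Seq (fst x) d, snd x) (Seq (fst y) d, snd y)"
proof (induction rule: reaches.induct)
  case (move x k y)
  have "step \<alpha> (Seq (fst x) d, snd x) = (Seq (fst (step \<alpha> x)) d, snd (step \<alpha> x))"
    using move.hyps(1) by (cases x) (simp add: case_prod_beta)
  then show ?case using move.IH by (intro reaches.move) simp_all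
qed (rule reaches.stay)

definition exec :: "real \<Rightarrow> program \<Rightarrow> memory \<Rightarrow> nat \<Rightarrow> memory \<Rightarrow> bool" where
  "exec \<alpha> c M k M' \<longleftrightarrow> reaches \<alpha> k (c, M) (Skip, M')"

lemma exec_Skip: "exec \<alpha> Skip M 0 M"
  by (simp add: exec_def reaches.stay)

lemma exec_Write: "exec \<alpha> (Write x a b) M 1 (M(x := (M x)(aval M a := aval M b)))"
  unfolding exec_def by (simp add: reaches.move reaches.stay)

text \<open>The extra step is the one that discards the finished first program.\<close>

lemma reaches_continuation: "exec \<alpha> c M k M' \<Longrightarrow> reaches \<alpha> (Suc k) (Seq c d, M) (d, M')"
proof -
  assume "exec \<alpha> c M k M'"
  then have "reaches \<alpha> k (Seq c d, M) (Seq Skip d, M')"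
    unfolding exec_def using reaches_Seq[of \<alpha> k "(c, M)" "(Skip, M')" d] by simp
  moreover have "reaches \<alpha> 1 (Seq Skip d, M') (d, M')" by (simp add: reaches.move reaches.stay)
  ultimately show ?thesis using reaches_trans by fastforce
qed

lemma exec_Seq: "exec \<alpha> c M j M1 \<Longrightarrow> exec \<alpha> d M1 k M2 \<Longrightarrow> exec \<alpha> (Seq c d) M (j + 1 + k) M2"
  using reaches_trans[OF reaches_continuation] unfolding exec_def by fastforce

lemma exec_Cond: "exec \<alpha> (if bval \<alpha> M p then c else d) M k M' \<Longrightarrow> exec \<alpha> (Cond p c d) M (Suc k) M'"
  unfolding exec_def by (intro reaches.move) simp_all

lemma exec_While_end: "\<not> bval \<alpha> M p \<Longrightarrow> exec \<alpha> (While p c) M 1 M"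
  unfolding exec_def by (simp add: reaches.move reaches.stay)

lemma reaches_While:
  "bval \<alpha> M p \<Longrightarrow> exec \<alpha> c M k M' \<Longrightarrow> reaches \<alpha> (k + 2) (While p c, M) (While p c, M')"
  using reaches.move[of "(While p c, M)" \<alpha> "Suc k" "(While p c, M')"]
    reaches_continuation[of \<alpha> c M k M' "While p c"] by simp

lemma exec_While_step:
  "bval \<alpha> M p \<Longrightarrow> exec \<alpha> c M j M1 \<Longrightarrow> exec \<alpha> (While p c) M1 k M2 \<Longrightarrow> exec \<alpha> (While p c) M (j + 2 + k) M2"
  unfolding exec_def using reaches_trans[OF reaches_While] exec_def by metis

section \<open>Effect and running time of loop-free programs and of loops\<close>

fun loopfree_prog :: "program \<Rightarrow> bool" where
  "loopfree_prog (Seq c d) \<longleftrightarrow> loopfree_prog c \<and> loopfree_prog d"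
| "loopfree_prog (Cond p c d) \<longleftrightarrow> loopfree_prog c \<and> loopfree_prog d"
| "loopfree_prog (While p c) \<longleftrightarrow> False"
| "loopfree_prog _ \<longleftrightarrow> True"

text \<open>A function, so that loop bodies can be evaluated by simplification. The value at loops
  is a dummy; execution is tied to \<open>sem\<close> under \<open>loopfree_prog\<close>
  only.\<close>

fun sem :: "real \<Rightarrow> program \<Rightarrow> memory \<Rightarrow> memory" where
  "sem \<alpha> (Write x a b) M = M(x := (M x)(aval M a := aval M b))"
| "sem \<alpha> (Seq c d) M = sem \<alpha> d (sem \<alpha> c M)"
| "sem \<alpha> (Cond p c d) M = (if bval \<alpha> M p then sem \<alpha> c M else sem \<alpha> d M)"
| "sem \<alpha> _ M = M"

text \<open>Independent of the memory, so that each execution of a loop body takes a time bounded by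
  a constant of the program.\<close>

fun cost :: "program \<Rightarrow> nat" where
  "cost (Write x a b) = 1"
| "cost (Seq c d) = cost c + 1 + cost d"
| "cost (Cond p c d) = Suc (max (cost c) (cost d))"
| "cost _ = 0"

lemma exec_loopfree: "loopfree_prog c \<Longrightarrow> \<exists>k\<le>cost c. exec \<alpha> c M k (sem \<alpha> c M)"
proof (induction c arbitrary: M)
  case Skip
  then show ?case using exec_Skip by auto
next
  case (Write x a b)
  show ?case by (intro exI[of _ 1]) (simp only: cost.simps sem.simps order_refl simp_thms exec_Write)
next
  case (Seq c d)
  obtain j where j: "j \<le> cost c" "exec \<alpha> c M j (sem \<alpha> c M)" using Seq by auto
  obtain k where k: "k \<le> cost d" "exec \<alpha> d (sem \<alpha> c M) k (sem \<alpha> d (sem \<alpha> c M))" using Seq by auto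
  show ?case using exec_Seq[OF j(2) k(2)] j(1) k(1) by (intro exI[of _ "j + 1 + k"]) simp
next
  case (Cond p c d)
  show ?case
  proof (cases "bval \<alpha> M p")
    case True
    obtain k where k: "k \<le> cost c" "exec \<alpha> c M k (sem \<alpha> c M)" using Cond by auto
    then show ?thesis using exec_Cond[of \<alpha> M p c d k "sem \<alpha> c M"] True by (intro exI[of _ "Suc k"]) auto
  next
    case False
    obtain k where k: "k \<le> cost d" "exec \<alpha> d M k (sem \<alpha> d M)" using Cond by auto
    then show ?thesis using exec_Cond[of \<alpha> M p c d k "sem \<alpha> d M"] False by (intro exI[of _ "Suc k"]) auto
  qed
qed simp

text \<open>A Hoare triple for total correctness with a bound on the number of steps.\<close>

definition triple :: "real \<Rightarrow> (memory \<Rightarrow> bool) \<Rightarrow> program \<Rightarrow> nat \<Rightarrow> (memory \<Rightarrow> bool) \<Rightarrow> bool" where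
  "triple \<alpha> P c B Q \<longleftrightarrow> (\<forall>M. P M \<longrightarrow> (\<exists>M' k. k \<le> B \<and> exec \<alpha> c M k M' \<and> Q M'))"

lemma triple_loopfree:
  assumes "loopfree_prog c" "\<And>M. P M \<Longrightarrow> Q (sem \<alpha> c M)"
  shows "triple \<alpha> P c (cost c) Q"
  unfolding triple_def using exec_loopfree[OF assms(1)] assms(2) by blast

lemma triple_Seq:
  assumes "triple \<alpha> P c B R" "triple \<alpha> R d B' Q"
  shows "triple \<alpha> P (Seq c d) (B + 1 + B') Q"
  unfolding triple_def
proof (intro allI impI)
  fix M assume "P M"
  then obtain M1 j where 1: "j \<le> B" "exec \<alpha> c M j M1" "R M1" using assms(1) unfolding triple_def by blast
  then obtain M2 k where 2: "k \<le> B'" "exec \<alpha> d M1 k M2" "Q M2" using assms(2) unfolding triple_def by blast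
  have "j + 1 + k \<le> B + 1 + B'" using 1(1) 2(1) by simp
  then show "\<exists>M' k. k \<le> B + 1 + B' \<and> exec \<alpha> (Seq c d) M k M' \<and> Q M'"
    using exec_Seq[OF 1(2) 2(2)] 2(3) by blast
qed

lemma triple_conseq:
  "triple \<alpha> P c B Q \<Longrightarrow> (\<And>M. P' M \<Longrightarrow> P M) \<Longrightarrow> (\<And>M. Q M \<Longrightarrow> Q' M) \<Longrightarrow> B \<le> B' \<Longrightarrow> triple \<alpha> P' c B' Q'"
  unfolding triple_def by (meson le_trans)

text \<open>The index of the invariant is the variant. Besides its body an iteration takes two
  steps, to unfold the loop and to discard the finished body; leaving the loop takes one.\<close>

lemma triple_While:
  assumes c: "loopfree_prog c"
    and I: "\<And>n M. I n M \<Longrightarrow> bval \<alpha> M p \<Longrightarrow> \<exists>n'<n. I n' (sem \<alpha> c M)"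
  shows "triple \<alpha> (I n) (While p c) ((cost c + 2) * n + 1) (\<lambda>M. \<not> bval \<alpha> M p \<and> (\<exists>n. I n M))"
  unfolding triple_def
proof (intro allI impI)
  fix M assume "I n M"
  then show "\<exists>M' k. k \<le> (cost c + 2) * n + 1 \<and> exec \<alpha> (While p c) M k M' \<and> \<not> bval \<alpha> M' p \<and> (\<exists>n. I n M')"
  proof (induction n arbitrary: M rule: less_induct)
    case (less n)
    show ?case
    proof (cases "bval \<alpha> M p")
      case True
      then obtain n' where n': "n' < n" "I n' (sem \<alpha> c M)" using I less.prems by blast
      obtain M' k where k: "k \<le> (cost c + 2) * n' + 1" "exec \<alpha> (While p c) (sem \<alpha> c M) k M'"
        "\<not> bval \<alpha> M' p" "\<exists>n. I n M'" using less.IH[OF n'] by blast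
      obtain j where j: "j \<le> cost c" "exec \<alpha> c M j (sem \<alpha> c M)" using exec_loopfree[OF c] by blast
      have "(cost c + 2) * Suc n' \<le> (cost c + 2) * n" using n'(1) by (intro mult_le_mono2) simp
      then have "j + 2 + k \<le> (cost c + 2) * n + 1" using j(1) k(1) by simp
      then show ?thesis using exec_While_step[OF True j(2) k(2)] k(3,4) by blast
    next
      case False
      then show ?thesis using exec_While_end[OF False, of c] less.prems by (intro exI[of _ M] exI[of _ 1]) auto
    qed
  qed
qed

text \<open>Retains the time of every iteration, which a \<open>triple\<close> forgets, because the
  specification asks for the state after each processed node.\<close>

lemma while_trace:
  assumes c: "loopfree_prog c"
    and step: "\<And>k. k < N \<Longrightarrow> bval \<alpha> (mem k) p \<and> mem (Suc k) = sem \<alpha> c (mem k)"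
    and halt: "\<not> bval \<alpha> (mem N) p"
  shows "\<exists>\<theta>. (\<forall>k<N. \<theta> k < \<theta> (Suc k) \<and> reaches \<alpha> (\<theta> k) (While p c, mem 0) (While p c, mem k)) \<and>
    \<theta> N \<le> (cost c + 2) * N + 1 \<and> reaches \<alpha> (\<theta> N) (While p c, mem 0) (Skip, mem N)"
proof -
  have "\<forall>k. \<exists>j\<le>cost c. exec \<alpha> c (mem k) j (sem \<alpha> c (mem k))" using exec_loopfree[OF c] by blast
  then obtain t where t: "\<And>k. t k \<le> cost c" "\<And>k. exec \<alpha> c (mem k) (t k) (sem \<alpha> c (mem k))" by metis
  define \<theta> where "\<theta> k = (\<Sum>i<k. t i + 2)" for k
  have r: "k \<le> N \<Longrightarrow> reaches \<alpha> (\<theta> k) (While p c, mem 0) (While p c, mem k)" for k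
  proof (induction k)
    case (Suc k)
    then have "reaches \<alpha> (t k + 2) (While p c, mem k) (While p c, mem (Suc k))"
      using reaches_While[OF _ t(2)[of k]] step[of k] by simp
    then show ?case using reaches_trans[of \<alpha> "\<theta> k"] Suc unfolding \<theta>_def by fastforce
  qed (simp add: \<theta>_def reaches.stay)
  have "\<theta> N \<le> (\<Sum>i<N. cost c + 2)" unfolding \<theta>_def using t(1) by (intro sum_mono) simp
  then have B: "\<theta> N \<le> (cost c + 2) * N" by (simp add: algebra_simps)
  have h: "reaches \<alpha> (\<theta> N + 1) (While p c, mem 0) (Skip, mem N)"
    using reaches_trans[OF r[OF order_refl] exec_While_end[OF halt, of c, unfolded exec_def]] .
  have "\<theta> k < \<theta> (Suc k)" for k by (simp add: \<theta>_def)
  \<comment> \<open>The last time is one step later than the pattern suggests, when the loop has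
    been left.\<close>
  then show ?thesis using r B h
    by (intro exI[of _ "\<lambda>k. if k = N then \<theta> N + 1 else \<theta> k"]) (auto simp: less_SucI)
qed

section \<open>Forests of partial decomposition trees\<close>

text \<open>The leaves correspond to the arcs, and a binary tree with \<open>m\<close> leaves has
  \<open>2m - 1\<close> nodes.\<close>

lemma card_nodes: "sp_tree \<sigma> \<Longrightarrow> Suc (card (nodes \<sigma>)) \<le> 2 * card (tarcs \<sigma>)"
proof (induction \<sigma>)
  case (Ser l r)
  have "card (nodes (Ser l r)) \<le> Suc (card (nodes l \<union> nodes r))" by (simp add: card_insert_if)
  also have "card (nodes l \<union> nodes r) \<le> card (nodes l) + card (nodes r)" by (rule card_Un_le)
  finally have "card (nodes (Ser l r)) \<le> Suc (card (nodes l) + card (nodes r))" by simp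
  moreover have "card (tarcs (Ser l r)) = card (tarcs l) + card (tarcs r)"
    unfolding tree_graph_sel by (rule card_Un_disjoint) (simp_all add: ser_arcs_disjoint[OF Ser.prems])
  ultimately show ?case using Ser.IH Ser.prems by simp
next
  case (Par l r)
  have "card (nodes (Par l r)) \<le> Suc (card (nodes l \<union> nodes r))" by (simp add: card_insert_if)
  also have "card (nodes l \<union> nodes r) \<le> card (nodes l) + card (nodes r)" by (rule card_Un_le)
  finally have "card (nodes (Par l r)) \<le> Suc (card (nodes l) + card (nodes r))" by simp
  moreover have "card (tarcs (Par l r)) = card (tarcs l) + card (tarcs r)"
    unfolding tree_graph_sel by (rule card_Un_disjoint) (use Par.prems in simp_all)
  ultimately show ?case using Par.IH Par.prems by simp
qed simp

definition ends :: "'a sptree \<Rightarrow> 'a \<times> 'a" where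
  "ends X = (tree_source X, tree_sink X)"

text \<open>Such trees can be composed in parallel with each other, and finally with one single
  edge, without violating cleanness.\<close>

definition no_leaf :: "'a sptree \<Rightarrow> bool" where
  "no_leaf X \<longleftrightarrow> (\<forall>e. Leaf e \<notin> par_parts X)"

text \<open>The pieces \<open>P\<close> into which the algorithm has assembled the edges of \<open>G\<close>; they meet only in the
  vertices \<open>V\<close> that have not been eliminated yet.\<close>

definition forest :: "'a pair_pre_digraph \<Rightarrow> 'a set \<Rightarrow> 'a sptree set \<Rightarrow> bool" where
  "forest G V P \<longleftrightarrow>
     (\<forall>X\<in>P. sp_tree X \<and> clean X \<and> tverts X \<inter> V = {tree_source X, tree_sink X}) \<and>
     (\<forall>X\<in>P. \<forall>Y\<in>P. X \<noteq> Y \<longrightarrow> tverts X \<inter> tverts Y \<subseteq> V \<and> tarcs X \<inter> tarcs Y = {}) \<and>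
     \<Union> (tarcs ` P) = parcs G \<and> \<Union> (tverts ` P) = pverts G"

lemma forestD:
  assumes "forest G V P"
  shows "X \<in> P \<Longrightarrow> sp_tree X" "X \<in> P \<Longrightarrow> clean X"
    "X \<in> P \<Longrightarrow> tverts X \<inter> V = {tree_source X, tree_sink X}"
    "X \<in> P \<Longrightarrow> Y \<in> P \<Longrightarrow> X \<noteq> Y \<Longrightarrow> tverts X \<inter> tverts Y \<subseteq> V"
    "X \<in> P \<Longrightarrow> Y \<in> P \<Longrightarrow> X \<noteq> Y \<Longrightarrow> tarcs X \<inter> tarcs Y = {}"
    "\<Union> (tarcs ` P) = parcs G" "\<Union> (tverts ` P) = pverts G"
  using assms unfolding forest_def by metis+

text \<open>The common part of both compositions: \<open>V'\<close> is \<open>V\<close>, or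
  \<open>V\<close> without the vertex eliminated by an S-composition. By \<open>old\<close> the
  remaining pieces do not notice the difference.\<close>

lemma forest_merge:
  assumes F: "forest G V P" and XY: "X \<in> P" "Y \<in> P" and "V' \<subseteq> V"
    and Z: "sp_tree Z" "clean Z" "tverts Z \<inter> V' = {tree_source Z, tree_sink Z}"
      "tverts Z = tverts X \<union> tverts Y" "tarcs Z = tarcs X \<union> tarcs Y"
    and old: "\<And>W. W \<in> P \<Longrightarrow> W \<noteq> X \<Longrightarrow> W \<noteq> Y \<Longrightarrow> tverts W \<inter> V \<subseteq> V'"
  shows "forest G V' (insert Z (P - {X, Y}))"
  unfolding forest_def
proof (intro conjI ballI impI)
  fix W assume "W \<in> insert Z (P - {X, Y})"
  then consider "W = Z" | "W \<in> P" "W \<noteq> X" "W \<noteq> Y" by blast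
  then have "sp_tree W \<and> clean W \<and> tverts W \<inter> V' = {tree_source W, tree_sink W}"
  proof cases
    case 2
    have "tverts W \<inter> V' = tverts W \<inter> V" using old[OF 2] assms(4) by blast
    then show ?thesis using forestD(1-3)[OF F 2(1)] by simp
  qed (use Z in simp)
  then show "sp_tree W" "clean W" "tverts W \<inter> V' = {tree_source W, tree_sink W}" by auto
next
  fix W W' assume W: "W \<in> insert Z (P - {X, Y})" "W' \<in> insert Z (P - {X, Y})" "W \<noteq> W'"
  have *: "tverts W \<inter> tverts Z \<subseteq> V' \<and> tarcs W \<inter> tarcs Z = {}" if W: "W \<in> P" "W \<noteq> X" "W \<noteq> Y" for W
  proof -
    have "tverts W \<inter> tverts Z \<subseteq> V"
      using forestD(4)[OF F W(1) XY(1) W(2)] forestD(4)[OF F W(1) XY(2) W(3)] Z(4) by blast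
    then have "tverts W \<inter> tverts Z \<subseteq> V'" using old[OF W] by blast
    moreover have "tarcs W \<inter> tarcs Z = {}"
      using forestD(5)[OF F W(1) XY(1) W(2)] forestD(5)[OF F W(1) XY(2) W(3)] Z(5) by blast
    ultimately show ?thesis by blast
  qed
  consider "W = Z" "W' \<in> P" "W' \<noteq> X" "W' \<noteq> Y" | "W' = Z" "W \<in> P" "W \<noteq> X" "W \<noteq> Y"
    | "W \<in> P" "W \<noteq> X" "W \<noteq> Y" "W' \<in> P" "W' \<noteq> X" "W' \<noteq> Y" using W by blast
  then have "tverts W \<inter> tverts W' \<subseteq> V' \<and> tarcs W \<inter> tarcs W' = {}"
  proof cases
    case 1
    then show ?thesis using *[OF 1(2-4)] by (simp add: Int_commute)
  next
    case 2
    then show ?thesis using *[OF 2(2-4)] by simp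
  next
    case 3
    have "tverts W \<inter> tverts W' \<subseteq> V'" using forestD(4)[OF F 3(1,4) W(3)] old[OF 3(1-3)] by blast
    then show ?thesis using forestD(5)[OF F 3(1,4) W(3)] by simp
  qed
  then show "tverts W \<inter> tverts W' \<subseteq> V'" "tarcs W \<inter> tarcs W' = {}" by blast+
next
  show "\<Union> (tarcs ` insert Z (P - {X, Y})) = parcs G" unfolding forestD(6)[OF F, symmetric]
    using Z(5) XY by blast
  show "\<Union> (tverts ` insert Z (P - {X, Y})) = pverts G" unfolding forestD(7)[OF F, symmetric]
    using Z(4) XY by blast
qed

lemma forest_par:
  assumes F: "forest G V P" and XY: "X \<in> P" "Y \<in> P" "X \<noteq> Y" "ends X = ends Y" and c: "clean (Par X Y)"
  shows "forest G V (insert (Par X Y) (P - {X, Y}))"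
proof (rule forest_merge[OF F XY(1,2) order_refl])
  have e: "tree_source X = tree_source Y" "tree_sink X = tree_sink Y" using XY(4) by (simp_all add: ends_def)
  have "tverts X \<inter> tverts Y = tverts X \<inter> V \<inter> (tverts Y \<inter> V)" using forestD(4)[OF F XY(1-3)] by blast
  also have "\<dots> = {tree_source X, tree_sink X}" using forestD(3)[OF F XY(1)] forestD(3)[OF F XY(2)] e by simp
  finally show "sp_tree (Par X Y)"
    using forestD(1)[OF F XY(1)] forestD(1)[OF F XY(2)] forestD(5)[OF F XY(1-3)] e by simp
  show "tverts (Par X Y) \<inter> V = {tree_source (Par X Y), tree_sink (Par X Y)}"
    using forestD(3)[OF F XY(1)] forestD(3)[OF F XY(2)] e by (simp add: Int_Un_distrib2)
qed (use c in auto)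

lemma forest_ser:
  assumes F: "forest G V P" and XY: "X \<in> P" "Y \<in> P" "tree_sink X = v" "tree_source Y = v"
      "tree_source X \<noteq> tree_sink Y"
    and only: "\<And>W. W \<in> P \<Longrightarrow> v \<in> tverts W \<inter> V \<Longrightarrow> W = X \<or> W = Y"
  shows "forest G (V - {v}) (insert (Ser X Y) (P - {X, Y}))"
proof (rule forest_merge[OF F XY(1,2)])
  note X = forestD(1-3)[OF F XY(1)] and Y = forestD(1-3)[OF F XY(2)]
  have ne: "tree_source X \<noteq> v" "tree_sink Y \<noteq> v" using terminals_neq[OF X(1)] terminals_neq[OF Y(1)] XY by auto
  then have "X \<noteq> Y" using XY by auto
  then have "tverts X \<inter> tverts Y = tverts X \<inter> V \<inter> (tverts Y \<inter> V)" using forestD(4)[OF F XY(1,2)] by blast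
  also have "\<dots> = {v}" unfolding X(3) Y(3) using XY(3-5) ne by auto
  finally show "sp_tree (Ser X Y)" using X Y XY by simp
  have "(tverts X \<union> tverts Y) \<inter> (V - {v}) = (tverts X \<inter> V \<union> tverts Y \<inter> V) - {v}" by blast
  also have "\<dots> = {tree_source X, tree_sink Y}" unfolding X(3) Y(3) using XY(3,4) ne by auto
  finally show "tverts (Ser X Y) \<inter> (V - {v}) = {tree_source (Ser X Y), tree_sink (Ser X Y)}" by simp
  show "clean (Ser X Y)" using X Y by simp
  show "tverts W \<inter> V \<subseteq> V - {v}" if "W \<in> P" "W \<noteq> X" "W \<noteq> Y" for W using only[OF that(1)] that by blast
qed auto

text \<open>The new node is not among the old ones: it shares arcs with \<open>X\<close> and would
  have to lie in the piece \<open>X\<close>, which is smaller. So the list of records stays free of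
  repetitions.\<close>

lemma nodes_merge:
  assumes F: "forest G V P" and XY: "X \<in> P" "Y \<in> P" and Z: "Z = Ser X Y \<or> Z = Par X Y"
  shows "Z \<notin> \<Union> (nodes ` P)" "\<Union> (nodes ` insert Z (P - {X, Y})) = insert Z (\<Union> (nodes ` P))"
proof -
  have nZ: "nodes Z = insert Z (nodes X \<union> nodes Y)" "tarcs X \<subseteq> tarcs Z" using Z by auto
  show "Z \<notin> \<Union> (nodes ` P)"
  proof
    assume "Z \<in> \<Union> (nodes ` P)"
    then obtain W where W: "W \<in> P" "Z \<in> nodes W" by blast
    have "tarcs X \<inter> tarcs W \<noteq> {}" using node_sub(1)[OF W(2)] nZ(2) tarcs_nonempty[of X] by blast
    then have "W = X" using forestD(5)[OF F XY(1) W(1)] by blast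
    then show False using size_node[OF W(2)] Z by auto
  qed
  show "\<Union> (nodes ` insert Z (P - {X, Y})) = insert Z (\<Union> (nodes ` P))" using nZ(1) XY by auto
qed

definition parallels :: "'a sptree set \<Rightarrow> 'a \<Rightarrow> 'a \<Rightarrow> 'a sptree set" where
  "parallels P x y = {X \<in> P. ends X = (x, y)}"

lemma parallels_merge:
  "ends Z = (x, y) \<Longrightarrow> parallels (insert Z (P - {X, Y})) x y = insert Z (parallels P x y - {X, Y})"
  "ends Z \<noteq> (x, y) \<Longrightarrow> parallels (insert Z (P - {X, Y})) x y = parallels P x y - {X, Y}"
  by (auto simp: parallels_def)

section \<open>Trees in memory\<close>

text \<open>The list \<open>ts\<close> contains the trees rooted at the allocated records.\<close>

definition store :: "('a \<times> 'a) list \<Rightarrow> memory \<Rightarrow> 'a sptree list \<Rightarrow> bool" where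
  "store es M ts \<longleftrightarrow> (\<forall>i<length ts. case ts ! i of
      Leaf e \<Rightarrow> M ''kind'' i = 0 \<and> M ''left'' i < length es \<and> es ! M ''left'' i = e
    | Ser l r \<Rightarrow> M ''kind'' i = 1 \<and> M ''left'' i < i \<and> M ''right'' i < i \<and>
        ts ! M ''left'' i = l \<and> ts ! M ''right'' i = r
    | Par l r \<Rightarrow> M ''kind'' i = 2 \<and> M ''left'' i < i \<and> M ''right'' i < i \<and>
        ts ! M ''left'' i = l \<and> ts ! M ''right'' i = r)"

lemma storeD:
  assumes "store es M ts" "i < length ts"
  shows "ts ! i = Leaf e \<Longrightarrow> M ''kind'' i = 0 \<and> M ''left'' i < length es \<and> es ! M ''left'' i = e"
    "ts ! i = Ser l r \<Longrightarrow> M ''kind'' i = 1 \<and> M ''left'' i < i \<and> M ''right'' i < i \<and>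
        ts ! M ''left'' i = l \<and> ts ! M ''right'' i = r"
    "ts ! i = Par l r \<Longrightarrow> M ''kind'' i = 2 \<and> M ''left'' i < i \<and> M ''right'' i < i \<and>
        ts ! M ''left'' i = l \<and> ts ! M ''right'' i = r"
  using assms(1)[unfolded store_def, rule_format, OF assms(2)] by simp_all

lemma store_cong:
  "store es M ts \<Longrightarrow> M' ''kind'' = M ''kind'' \<Longrightarrow> M' ''left'' = M ''left'' \<Longrightarrow> M' ''right'' = M ''right'' \<Longrightarrow>
    store es M' ts"
  by (simp add: store_def cong: sptree.case_cong)

lemma store_snoc:
  assumes S: "store es M ts" and lr: "l < length ts" "r < length ts"
    and Z: "d = 1 \<and> Z = Ser (ts ! l) (ts ! r) \<or> d = 2 \<and> Z = Par (ts ! l) (ts ! r)"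
    and M': "M' ''kind'' = (M ''kind'')(length ts := d)" "M' ''left'' = (M ''left'')(length ts := l)"
      "M' ''right'' = (M ''right'')(length ts := r)"
  shows "store es M' (ts @ [Z])"
  unfolding store_def
proof (intro allI impI)
  fix i assume i: "i < length (ts @ [Z])"
  show "case (ts @ [Z]) ! i of
      Leaf e \<Rightarrow> M' ''kind'' i = 0 \<and> M' ''left'' i < length es \<and> es ! M' ''left'' i = e
    | Ser l r \<Rightarrow> M' ''kind'' i = 1 \<and> M' ''left'' i < i \<and> M' ''right'' i < i \<and>
        (ts @ [Z]) ! M' ''left'' i = l \<and> (ts @ [Z]) ! M' ''right'' i = r
    | Par l r \<Rightarrow> M' ''kind'' i = 2 \<and> M' ''left'' i < i \<and> M' ''right'' i < i \<and>
        (ts @ [Z]) ! M' ''left'' i = l \<and> (ts @ [Z]) ! M' ''right'' i = r"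
  proof (cases "i < length ts")
    case True
    then show ?thesis using storeD[OF S True] M' by (cases "ts ! i") (auto simp: nth_append)
  next
    case False
    then have "i = length ts" using i by simp
    then show ?thesis using Z M' lr by (auto simp: nth_append)
  qed
qed

lemma store_holds_tree: "store es M ts \<Longrightarrow> i < length ts \<Longrightarrow> holds_tree es M (ts ! i) i"
proof (induction i rule: less_induct)
  case (less i)
  show ?case
  proof (cases "ts ! i")
    case (Leaf e)
    then show ?thesis using storeD(1)[OF less.prems Leaf] by simp
  next
    case (Ser l r)
    note D = storeD(2)[OF less.prems Ser]
    have "holds_tree es M (ts ! M ''left'' i) (M ''left'' i)" "holds_tree es M (ts ! M ''right'' i) (M ''right'' i)"
      using less.IH[OF _ less.prems(1)] D less.prems(2) by auto
    then show ?thesis using D Ser by simp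
  next
    case (Par l r)
    note D = storeD(3)[OF less.prems Par]
    have "holds_tree es M (ts ! M ''left'' i) (M ''left'' i)" "holds_tree es M (ts ! M ''right'' i) (M ''right'' i)"
      using less.IH[OF _ less.prems(1)] D less.prems(2) by auto
    then show ?thesis using D Par by simp
  qed
qed

lemma store_nodes: "store es M ts \<Longrightarrow> i < length ts \<Longrightarrow> nodes (ts ! i) \<subseteq> (!) ts ` {..i}"
proof (induction i rule: less_induct)
  case (less i)
  have sub: "nodes (ts ! j) \<subseteq> (!) ts ` {..i}" if "j < i" for j
  proof -
    have "nodes (ts ! j) \<subseteq> (!) ts ` {..j}" using less.IH[OF that less.prems(1)] less.prems(2) that by simp
    also have "\<dots> \<subseteq> (!) ts ` {..i}" using that by (intro image_mono) auto
    finally show ?thesis .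
  qed
  have self: "ts ! i \<in> (!) ts ` {..i}" by simp
  show ?case
  proof (cases "ts ! i")
    case (Leaf e)
    then show ?thesis using self by simp
  next
    case (Ser l r)
    note D = storeD(2)[OF less.prems Ser]
    then have "nodes l \<subseteq> (!) ts ` {..i}" "nodes r \<subseteq> (!) ts ` {..i}" using sub by metis+
    then show ?thesis using self Ser by simp
  next
    case (Par l r)
    note D = storeD(3)[OF less.prems Par]
    then have "nodes l \<subseteq> (!) ts ` {..i}" "nodes r \<subseteq> (!) ts ` {..i}" using sub by metis+
    then show ?thesis using self Par by simp
  qed
qed

text \<open>Records refer to smaller addresses only, so the order of allocation is bottom-up and the
  removal loop can simply run through the addresses.\<close>

lemma store_bottom_up:
  assumes "store es M ts" "distinct ts" "set ts = nodes T"
  shows "bottom_up T ts"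
proof -
  have "ts ! j \<notin> nodes (ts ! i)" if "i < j" "j < length ts" for i j
  proof
    assume "ts ! j \<in> nodes (ts ! i)"
    moreover have "nodes (ts ! i) \<subseteq> (!) ts ` {..i}" using store_nodes[OF assms(1)] that by simp
    ultimately have "ts ! j \<in> (!) ts ` {..i}" by (rule rev_subsetD)
    then obtain k where "k \<le> i" "ts ! j = ts ! k" by (elim imageE) simp
    then show False using nth_eq_iff_index_eq[OF assms(2)] that by simp
  qed
  then show ?thesis unfolding bottom_up_def sorted_wrt_iff_nth_less using assms(3) by blast
qed

section \<open>The program\<close>

abbreviation "rd x \<equiv> Read x (Const 0)"
abbreviation "put x a \<equiv> Write x (Const 0) a"
abbreviation "increment x i \<equiv> Write x i (Plus (Read x i) (Const 1))"
abbreviation "decrement x i \<equiv> Write x i (Minus (Read x i) (Const 1))"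
abbreviation "is_one a \<equiv> And (Less (Const 0) a) (Less a (Const 2))"

text \<open>The array \<open>ofs\<close> contains the multiples of the number of vertices; so \<open>ofs[x] + y\<close> indexes the
  entry \<open>(x, y)\<close> of a matrix.\<close>

abbreviation "cell x y \<equiv> Plus (Read ''ofs'' (rd x)) (rd y)"

definition make_node :: "nat \<Rightarrow> aexp \<Rightarrow> aexp \<Rightarrow> program" where
  "make_node d l r =
     Seq (Write ''kind'' (rd ''cnt'') (Const d))
     (Seq (Write ''left'' (rd ''cnt'') l)
     (Seq (Write ''right'' (rd ''cnt'') r)
     (increment ''cnt'' (Const 0))))"

text \<open>The matrix entries \<open>leaf[k]\<close> and \<open>comp[k]\<close> are the successors of the addresses of the single edge
  and of the composed piece between two vertices, or 0.\<close>

definition join :: program where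
  "join =
     Cond (Less (Const 0) (Read ''comp'' (rd ''k'')))
       (Cond (Less (Const 0) (Read ''leaf'' (rd ''k'')))
         (Seq (make_node 2 (Minus (Read ''comp'' (rd ''k'')) (Const 1)) (Minus (Read ''leaf'' (rd ''k'')) (Const 1)))
           (put ''r'' (Minus (rd ''cnt'') (Const 1))))
         (put ''r'' (Minus (Read ''comp'' (rd ''k'')) (Const 1))))
       (put ''r'' (Minus (Read ''leaf'' (rd ''k'')) (Const 1)))"

text \<open>The newest record has address \<open>cnt - 1\<close> and \<open>comp\<close> stores
  successors of addresses, so \<open>cnt\<close> is the correct entry whether or not a P-node has
  just been created.\<close>

definition absorb :: program where
  "absorb =
     Seq (Cond (Less (Const 0) (Read ''comp'' (rd ''k'')))
           (make_node 2 (Minus (Read ''comp'' (rd ''k'')) (Const 1)) (Minus (rd ''cnt'') (Const 1)))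
           Skip)
       (Write ''comp'' (rd ''k'') (rd ''cnt''))"

definition push :: "string \<Rightarrow> program" where
  "push z = Cond (And (is_one (Read ''ind'' (rd z))) (is_one (Read ''outd'' (rd z))))
     (Seq (Write ''stk'' (rd ''sp'') (rd z)) (increment ''sp'' (Const 0))) Skip"

text \<open>The unique neighbour of a vertex of degree one is read off the sum of its neighbours.\<close>

definition update_degrees :: program where
  "update_degrees =
     Seq (Write ''outsum'' (rd ''u'') (Minus (Read ''outsum'' (rd ''u'')) (rd ''v'')))
     (Seq (Write ''insum'' (rd ''w'') (Minus (Read ''insum'' (rd ''w'')) (rd ''v'')))
     (Cond (Less (Const 0) (Plus (Read ''leaf'' (rd ''k'')) (Read ''comp'' (rd ''k''))))
       (Seq (decrement ''outd'' (rd ''u''))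
       (Seq (decrement ''ind'' (rd ''w''))
       (Seq (push ''u'') (push ''w''))))
       (Seq (Write ''outsum'' (rd ''u'') (Plus (Read ''outsum'' (rd ''u'')) (rd ''w'')))
         (Write ''insum'' (rd ''w'') (Plus (Read ''insum'' (rd ''w'')) (rd ''u''))))))"

definition pop :: program where
  "pop =
     Seq (decrement ''sp'' (Const 0))
     (Seq (put ''v'' (Read ''stk'' (rd ''sp'')))
     (Seq (put ''u'' (Read ''insum'' (rd ''v'')))
     (Seq (put ''w'' (Read ''outsum'' (rd ''v'')))
     (put ''k'' (cell ''u'' ''v'')))))"

text \<open>\<open>join\<close> delivers its result in \<open>r\<close>; the first result is saved
  in \<open>a\<close> before \<open>join\<close> runs again.\<close>

definition second :: program where
  "second = Seq (put ''a'' (rd ''r'')) (put ''k'' (cell ''v'' ''w''))"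

definition serial :: program where
  "serial = Seq (make_node 1 (rd ''a'') (rd ''r'')) (put ''k'' (cell ''u'' ''w''))"

definition reduce :: program where
  "reduce = Seq pop (Seq join (Seq second (Seq join (Seq serial (Seq update_degrees absorb)))))"

section \<open>Assembling the tree\<close>

definition assembled ::
    "('a \<times> 'a) list \<Rightarrow> 'a pair_pre_digraph \<Rightarrow> memory \<Rightarrow> 'a sptree list \<Rightarrow> 'a sptree set \<Rightarrow> 'a set \<Rightarrow> bool" where
  "assembled es G M ts P V \<longleftrightarrow> store es M ts \<and> M ''cnt'' 0 = length ts \<and> distinct ts \<and>
     set ts = \<Union> (nodes ` P) \<and> forest G V P"

lemma assembled_cong:
  "assembled es G M ts P V \<Longrightarrow> M' ''kind'' = M ''kind'' \<Longrightarrow> M' ''left'' = M ''left'' \<Longrightarrow>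
    M' ''right'' = M ''right'' \<Longrightarrow> M' ''cnt'' 0 = M ''cnt'' 0 \<Longrightarrow> assembled es G M' ts P V"
  unfolding assembled_def using store_cong[of es M ts M'] by simp

lemma assembled_merge:
  assumes A: "assembled es G M ts P V" and lr: "l < length ts" "r < length ts" "ts ! l \<in> P" "ts ! r \<in> P"
    and Z: "d = 1 \<and> Z = Ser (ts ! l) (ts ! r) \<or> d = 2 \<and> Z = Par (ts ! l) (ts ! r)"
    and F: "forest G V' (insert Z (P - {ts ! l, ts ! r}))"
    and M': "M' ''kind'' = (M ''kind'')(length ts := d)" "M' ''left'' = (M ''left'')(length ts := l)"
      "M' ''right'' = (M ''right'')(length ts := r)" "M' ''cnt'' 0 = Suc (length ts)"
  shows "assembled es G M' (ts @ [Z]) (insert Z (P - {ts ! l, ts ! r})) V'"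
proof -
  have A': "store es M ts" "distinct ts" "set ts = \<Union> (nodes ` P)" "forest G V P"
    using A by (simp_all add: assembled_def)
  have S: "store es M' (ts @ [Z])" by (rule store_snoc[OF A'(1) lr(1,2) Z M'(1-3)])
  have ZZ: "Z = Ser (ts ! l) (ts ! r) \<or> Z = Par (ts ! l) (ts ! r)" using Z by blast
  note N = nodes_merge[OF A'(4) lr(3,4) ZZ]
  show ?thesis unfolding assembled_def using S A'(2,3) N F M'(4) by simp
qed

text \<open>The value 0, which all matrix cells have initially, stands for an absent piece.\<close>

definition slot :: "'a sptree list \<Rightarrow> nat \<Rightarrow> 'a sptree set" where
  "slot ts k = (if k = 0 then {} else {ts ! (k - 1)})"

definition entry :: "memory \<Rightarrow> 'a sptree list \<Rightarrow> 'a sptree set \<Rightarrow> 'a \<Rightarrow> 'a \<Rightarrow> nat \<Rightarrow> bool" where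
  "entry M ts P x y k \<longleftrightarrow> M ''leaf'' k \<le> length ts \<and> M ''comp'' k \<le> length ts \<and>
     parallels P x y = slot ts (M ''leaf'' k) \<union> slot ts (M ''comp'' k) \<and>
     (0 < M ''leaf'' k \<longrightarrow> ts ! (M ''leaf'' k - 1) = Leaf (x, y)) \<and>
     (0 < M ''comp'' k \<longrightarrow> no_leaf (ts ! (M ''comp'' k - 1)))"

lemma entry_cong:
  assumes "entry M ts P x y k" "parallels P' x y = parallels P x y"
    "M' ''leaf'' k = M ''leaf'' k" "M' ''comp'' k = M ''comp'' k"
  shows "entry M' (ts @ zs) P' x y k"
  using assms unfolding entry_def slot_def
  by (auto simp: nth_append)

lemma ends_image: "ends ` P = {(x, y). parallels P x y \<noteq> {}}"
  by (force simp: parallels_def)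

text \<open>The operands are evaluated after some of the writes; the assumption says that they do
  not depend on the arrays of the records.\<close>

lemma sem_make_node:
  assumes "\<And>M'. (\<And>x. x \<notin> {''kind'', ''left'', ''right''} \<Longrightarrow> M' x = M x) \<Longrightarrow> aval M' l = aval M l \<and> aval M' r = aval M r"
  shows "sem \<alpha> (make_node d l r) M = M(''kind'' := (M ''kind'')(M ''cnt'' 0 := d),
    ''left'' := (M ''left'')(M ''cnt'' 0 := aval M l), ''right'' := (M ''right'')(M ''cnt'' 0 := aval M r),
    ''cnt'' := (M ''cnt'')(0 := M ''cnt'' 0 + 1))"
proof -
  let ?M1 = "M(''kind'' := (M ''kind'')(M ''cnt'' 0 := d))"
  let ?M2 = "?M1(''left'' := (M ''left'')(M ''cnt'' 0 := aval M l))"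
  have l: "aval ?M1 l = aval M l" using assms[of ?M1] by simp
  have r: "aval ?M2 r = aval M r" using assms[of ?M2] by simp
  show ?thesis unfolding make_node_def sem.simps aval.simps l by (simp add: l r)
qed

text \<open>A node is created only if both an edge and a composed piece are present. The edge is
  then a child and the other child satisfies \<open>no_leaf\<close>, whence cleanness. The matrix
  entry becomes outdated, which is harmless as the pair disappears with the eliminated vertex or the
  program finishes.\<close>

lemma join_correct:
  assumes A: "assembled es G M ts P V" and E: "entry M ts P x y (M ''k'' 0)" and ne: "parallels P x y \<noteq> {}"
    and M'_def: "M' = sem \<alpha> join M"
  shows "\<exists>zs P' X. assembled es G M' (ts @ zs) P' V \<and> parallels P' x y = {X} \<and>
    (\<forall>x' y'. (x', y') \<noteq> (x, y) \<longrightarrow> parallels P' x' y' = parallels P x' y') \<and>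
    M' ''r'' 0 < length (ts @ zs) \<and> (ts @ zs) ! M' ''r'' 0 = X \<and>
    (\<forall>z. z \<notin> {''kind'', ''left'', ''right'', ''cnt'', ''r''} \<longrightarrow> M' z = M z)"
proof -
  let ?j = "M ''k'' 0"
  let ?l = "M ''comp'' ?j - 1" and ?r = "M ''leaf'' ?j - 1"
  have F: "forest G V P" and cnt: "M ''cnt'' 0 = length ts" using A by (simp_all add: assembled_def)
  consider "M ''comp'' ?j = 0" | "M ''comp'' ?j > 0" "M ''leaf'' ?j = 0" | "M ''comp'' ?j > 0" "M ''leaf'' ?j > 0"
    by auto
  then show ?thesis
  proof cases
    case 1
    then have lf: "M ''leaf'' ?j > 0" using ne E by (auto simp: entry_def slot_def)
    have M': "M' = M(''r'' := (M ''r'')(0 := ?r))" unfolding M'_def join_def using 1 by simp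
    have "assembled es G M' (ts @ []) P V" using assembled_cong[OF A, of M'] M' by simp
    moreover have "parallels P x y = {ts ! ?r}" "?r < length ts" using E 1 lf by (auto simp: entry_def slot_def)
    ultimately show ?thesis using M' by (intro exI[of _ "[]"] exI[of _ P] exI[of _ "ts ! ?r"]) simp
  next
    case 2
    have M': "M' = M(''r'' := (M ''r'')(0 := ?l))" unfolding M'_def join_def using 2 by simp
    have "assembled es G M' (ts @ []) P V" using assembled_cong[OF A, of M'] M' by simp
    moreover have "parallels P x y = {ts ! ?l}" "?l < length ts" using E 2 by (auto simp: entry_def slot_def)
    ultimately show ?thesis using M' by (intro exI[of _ "[]"] exI[of _ P] exI[of _ "ts ! ?l"]) simp
  next
    case 3
    have lr: "?l < length ts" "?r < length ts" "parallels P x y = {ts ! ?r, ts ! ?l}"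
      "ts ! ?r = Leaf (x, y)" "no_leaf (ts ! ?l)" using E 3 by (auto simp: entry_def slot_def)
    then have P: "ts ! ?l \<in> P" "ts ! ?r \<in> P" "ends (ts ! ?l) = (x, y)" "ends (ts ! ?r) = (x, y)"
      by (auto simp: parallels_def)
    have ne: "ts ! ?l \<noteq> ts ! ?r" using lr(4,5) by (auto simp: no_leaf_def)
    let ?Z = "Par (ts ! ?l) (ts ! ?r)"
    have "clean ?Z" using forestD(2)[OF F P(1)] lr(4,5) by (auto simp: no_leaf_def)
    then have F': "forest G V (insert ?Z (P - {ts ! ?l, ts ! ?r}))"
      using forest_par[OF F P(1,2) ne] P(3,4) by simp
    have M': "M' = M(''kind'' := (M ''kind'')(length ts := 2), ''left'' := (M ''left'')(length ts := ?l),
      ''right'' := (M ''right'')(length ts := ?r), ''cnt'' := (M ''cnt'')(0 := length ts + 1),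
      ''r'' := (M ''r'')(0 := length ts))"
      unfolding M'_def join_def using 3 by (simp add: sem_make_node cnt)
    have "assembled es G M' (ts @ [?Z]) (insert ?Z (P - {ts ! ?l, ts ! ?r})) V"
      by (rule assembled_merge[OF A lr(1,2) P(1,2) _ F', of 2]) (simp_all add: M')
    moreover have eZ: "ends ?Z = (x, y)" using P(3) by (simp add: ends_def)
    then have "parallels (insert ?Z (P - {ts ! ?l, ts ! ?r})) x y = {?Z}"
      using parallels_merge(1)[OF eZ, of P "ts ! ?l" "ts ! ?r"] lr(3) by auto
    moreover have "\<forall>x' y'. (x', y') \<noteq> (x, y) \<longrightarrow>
        parallels (insert ?Z (P - {ts ! ?l, ts ! ?r})) x' y' = parallels P x' y'"
      using eZ P(3,4) by (auto simp: parallels_def)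
    ultimately show ?thesis using M'
      by (intro exI[of _ "[?Z]"] exI[of _ "insert ?Z (P - {ts ! ?l, ts ! ?r})"] exI[of _ ?Z]) simp
  qed
qed

text \<open>The matrix does not yet know the S-node allocated last; hence the entry is assumed for
  \<open>butlast ts\<close> and \<open>P - {last ts}\<close>.\<close>

lemma absorb_correct:
  assumes A: "assembled es G M ts P V" and E: "entry M (butlast ts) (P - {last ts}) x y (M ''k'' 0)"
    and Z: "ts \<noteq> []" "last ts \<in> P" "ends (last ts) = (x, y)" "no_leaf (last ts)"
    and M'_def: "M' = sem \<alpha> absorb M"
  shows "\<exists>zs P'. assembled es G M' (ts @ zs) P' V \<and> entry M' (ts @ zs) P' x y (M ''k'' 0) \<and>
    parallels P' x y \<noteq> {} \<and>
    (\<forall>x' y'. (x', y') \<noteq> (x, y) \<longrightarrow> parallels P' x' y' = parallels P x' y') \<and>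
    (\<forall>z. z \<notin> {''kind'', ''left'', ''right'', ''cnt'', ''comp''} \<longrightarrow> M' z = M z) \<and>
    (\<forall>k. k \<noteq> M ''k'' 0 \<longrightarrow> M' ''comp'' k = M ''comp'' k)"
proof -
  let ?j = "M ''k'' 0" and ?S = "last ts" and ?len = "length ts"
  let ?l = "M ''comp'' ?j - 1" and ?r = "?len - 1"
  have F: "forest G V P" and cnt: "M ''cnt'' 0 = ?len" using A by (simp_all add: assembled_def)
  have pos: "?len > 0" using Z(1) by simp
  have S: "ts ! ?r = ?S" using Z(1) by (simp add: last_conv_nth)
  have bl: "butlast ts ! i = ts ! i" if "i < ?len - 1" for i using that by (simp add: nth_butlast)
  have pP: "parallels P x y = insert ?S (parallels (P - {?S}) x y)" using Z by (auto simp: parallels_def)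
  have leafE: "M ''leaf'' ?j \<le> ?len" "slot (butlast ts) (M ''leaf'' ?j) = slot ts (M ''leaf'' ?j)"
    "0 < M ''leaf'' ?j \<longrightarrow> ts ! (M ''leaf'' ?j - 1) = Leaf (x, y)"
    using E bl[of "M ''leaf'' ?j - 1"] by (auto simp: entry_def slot_def)
  show ?thesis
  proof (cases "M ''comp'' ?j = 0")
    case True
    have M': "M' = M(''comp'' := (M ''comp'')(?j := ?len))" unfolding M'_def absorb_def using True cnt by simp
    have A': "assembled es G M' (ts @ []) P V" using assembled_cong[OF A, of M'] M' by simp
    have "parallels (P - {?S}) x y = slot ts (M ''leaf'' ?j)" using E True leafE(2) by (simp add: entry_def slot_def)
    then have "entry M' (ts @ []) P x y ?j" unfolding entry_def M' pP using leafE pos Z(4) S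
      by (simp add: slot_def)
    then show ?thesis using A' M' pP by (intro exI[of _ "[]"] exI[of _ P]) simp
  next
    case False
    let ?C = "ts ! ?l"
    have l: "?l < ?len - 1" using E False by (simp add: entry_def) linarith
    have pE: "parallels (P - {?S}) x y = slot ts (M ''leaf'' ?j) \<union> {?C}"
      using E False leafE(2) bl[OF l] by (simp add: entry_def slot_def)
    then have C: "?C \<in> P" "?C \<noteq> ?S" "ends ?C = (x, y)" by (auto simp: parallels_def)
    have nC: "no_leaf ?C" using E False bl[OF l] by (simp add: entry_def)
    let ?Z = "Par ?C ?S"
    have nZ: "no_leaf ?Z" using nC Z(4) by (simp add: no_leaf_def)
    then have "clean ?Z" using forestD(2)[OF F C(1)] forestD(2)[OF F Z(2)] by (simp add: no_leaf_def)
    then have F': "forest G V (insert ?Z (P - {?C, ts ! ?r}))"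
      using forest_par[OF F C(1) Z(2) C(2)] C(3) Z(3) S by simp
    have M': "M' = M(''kind'' := (M ''kind'')(?len := 2), ''left'' := (M ''left'')(?len := ?l),
      ''right'' := (M ''right'')(?len := ?r), ''cnt'' := (M ''cnt'')(0 := ?len + 1),
      ''comp'' := (M ''comp'')(?j := ?len + 1))"
      unfolding M'_def absorb_def using False by (simp add: sem_make_node cnt)
    have A': "assembled es G M' (ts @ [?Z]) (insert ?Z (P - {?C, ts ! ?r})) V"
      by (rule assembled_merge[OF A _ _ C(1) _ _ F', of 2]) (use l pos S Z(2) in \<open>simp_all add: M'\<close>)
    let ?P' = "insert ?Z (P - {?C, ?S})"
    have eZ: "ends ?Z = (x, y)" using C(3) by (simp add: ends_def)
    \<comment> \<open>Neither operand is the single edge, which therefore remains a piece of its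
      own.\<close>
    have "?C \<notin> slot ts (M ''leaf'' ?j)" using leafE(3) nC by (auto simp: slot_def no_leaf_def)
    moreover have "?S \<notin> parallels (P - {?S}) x y" by (simp add: parallels_def)
    then have "?S \<notin> slot ts (M ''leaf'' ?j)" using pE by blast
    ultimately have pZ: "parallels ?P' x y = insert ?Z (slot ts (M ''leaf'' ?j))"
      using parallels_merge(1)[OF eZ, of P ?C ?S] pP pE by auto
    have "slot (ts @ [?Z]) (M ''leaf'' ?j) = slot ts (M ''leaf'' ?j)" using leafE(1)
      by (auto simp: slot_def nth_append)
    moreover have "0 < M ''leaf'' ?j \<longrightarrow> (ts @ [?Z]) ! (M ''leaf'' ?j - 1) = Leaf (x, y)"
      using leafE by (auto simp: nth_append)
    ultimately have "entry M' (ts @ [?Z]) ?P' x y ?j" unfolding entry_def M' pZ using leafE(1) nZ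
      by (simp add: slot_def[of _ "Suc _"])
    moreover have "\<forall>x' y'. (x', y') \<noteq> (x, y) \<longrightarrow> parallels ?P' x' y' = parallels P x' y'"
      using eZ C(3) Z(3) by (auto simp: parallels_def)
    ultimately show ?thesis using A' M' pZ S by (intro exI[of _ "[?Z]"] exI[of _ ?P']) simp
  qed
qed

section \<open>The reduction loop\<close>

lemma matrix_index_inj:
  fixes a b c d n :: nat
  assumes "a * n + b = c * n + d" "b < n" "d < n"
  shows "a = c" "b = d"
proof -
  have "(a * n + b) div n = a" "(c * n + d) div n = c" "(a * n + b) mod n = b" "(c * n + d) mod n = d"
    using assms(2,3) by auto
  then show "a = c" "b = d" using assms(1) by metis+
qed

definition deg11 :: "('a \<times> 'a) set \<Rightarrow> 'a set \<Rightarrow> 'a set" where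
  "deg11 A V = {x \<in> V. card (preds A x) = 1 \<and> card (succs A x) = 1}"

lemma contract_neighbours:
  assumes "inner A u v w" "u \<noteq> w" "u \<noteq> v" "v \<noteq> w"
  shows "x \<noteq> v \<Longrightarrow> x \<noteq> u \<Longrightarrow> succs (contract A u v w) x = succs A x"
    "succs (contract A u v w) u = insert w (succs A u - {v})"
    "x \<noteq> v \<Longrightarrow> x \<noteq> w \<Longrightarrow> preds (contract A u v w) x = preds A x"
    "preds (contract A u v w) w = insert u (preds A w - {v})"
  using assms(2-4) unfolding contract_def succs_def preds_def by blast+

locale encoded_graph =
  fixes G :: "'a pair_pre_digraph" and \<nu> :: "'a \<Rightarrow> nat" and es :: "('a \<times> 'a) list" and \<alpha> :: real
  assumes sp_graph: "directed_series_parallel G" and encoding: "graph_encoding G \<nu> es"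
begin

abbreviation "n \<equiv> card (pverts G)"
abbreviation "m \<equiv> length es"

lemma \<nu>_inj: "inj_on \<nu> (pverts G)" and \<nu>_image: "\<nu> ` pverts G = {..<n}"
  using encoding by (auto simp: graph_encoding_def bij_betw_def)

lemma \<nu>_eq_iff: "x \<in> pverts G \<Longrightarrow> y \<in> pverts G \<Longrightarrow> \<nu> x = \<nu> y \<longleftrightarrow> x = y"
  using \<nu>_inj by (auto simp: inj_on_def)

lemma \<nu>_less: "x \<in> pverts G \<Longrightarrow> \<nu> x < n"
  using \<nu>_image by blast

abbreviation "index x y \<equiv> \<nu> x * n + \<nu> y"

lemma index_eq_iff:
  assumes "x \<in> pverts G" "y \<in> pverts G" "x' \<in> pverts G" "y' \<in> pverts G"
  shows "index x y = index x' y' \<longleftrightarrow> x = x' \<and> y = y'"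
  using matrix_index_inj[of "\<nu> x" n "\<nu> y" "\<nu> x'" "\<nu> y'"] \<nu>_less assms \<nu>_eq_iff by blast

definition degrees :: "memory \<Rightarrow> ('a \<times> 'a) set \<Rightarrow> 'a set \<Rightarrow> bool" where
  "degrees M A V \<longleftrightarrow> (\<forall>x\<in>V. M ''ind'' (\<nu> x) = card (preds A x) \<and> M ''outd'' (\<nu> x) = card (succs A x) \<and>
     M ''insum'' (\<nu> x) = sum \<nu> (preds A x) \<and> M ''outsum'' (\<nu> x) = sum \<nu> (succs A x))"

text \<open>Equality is needed in both directions: an empty stack must mean that the graph is
  reduced, and a popped vertex must be eligible. Injectivity ensures that popping really removes the
  vertex.\<close>

definition stacked :: "memory \<Rightarrow> 'a set \<Rightarrow> bool" where
  "stacked M D \<longleftrightarrow> inj_on (M ''stk'') {..<M ''sp'' 0} \<and> M ''stk'' ` {..<M ''sp'' 0} = \<nu> ` D"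

lemma stacked_push:
  assumes "stacked M D" "insert x D \<subseteq> pverts G" "x \<notin> D"
    "M' ''stk'' = (M ''stk'')(M ''sp'' 0 := \<nu> x)" "M' ''sp'' 0 = Suc (M ''sp'' 0)"
  shows "stacked M' (insert x D)"
proof -
  have S: "inj_on (M ''stk'') {..<M ''sp'' 0}" "M ''stk'' ` {..<M ''sp'' 0} = \<nu> ` D"
    using assms(1) by (simp_all add: stacked_def)
  let ?g = "(M ''stk'')(M ''sp'' 0 := \<nu> x)"
  have g: "?g ` {..<M ''sp'' 0} = M ''stk'' ` {..<M ''sp'' 0}" "inj_on ?g {..<M ''sp'' 0}"
    using S(1) by (auto simp: inj_on_def)
  have "\<nu> x \<notin> \<nu> ` D"
  proof
    assume "\<nu> x \<in> \<nu> ` D"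
    then obtain y where "y \<in> D" "\<nu> x = \<nu> y" by blast
    then show False using \<nu>_eq_iff[of x y] assms(2,3) by auto
  qed
  then have "inj_on ?g (insert (M ''sp'' 0) {..<M ''sp'' 0})" using g S(2) by simp
  moreover have "?g ` insert (M ''sp'' 0) {..<M ''sp'' 0} = \<nu> ` insert x D"
    unfolding image_insert g(1) S(2) by simp
  ultimately show ?thesis unfolding stacked_def assms(4,5) lessThan_Suc by blast
qed

lemma push_correct:
  assumes S: "stacked M D" and x: "insert x D \<subseteq> pverts G" "x \<notin> D" "M z 0 = \<nu> x"
    and z: "z \<noteq> ''stk''" "z \<noteq> ''sp''"
  shows "stacked (sem \<alpha> (push z) M) (if M ''ind'' (\<nu> x) = 1 \<and> M ''outd'' (\<nu> x) = 1 then insert x D else D)"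
    "y \<noteq> ''stk'' \<Longrightarrow> y \<noteq> ''sp'' \<Longrightarrow> sem \<alpha> (push z) M y = M y"
proof -
  let ?c = "M ''ind'' (\<nu> x) = 1 \<and> M ''outd'' (\<nu> x) = 1"
  have c: "bval \<alpha> M (And (is_one (Read ''ind'' (rd z))) (is_one (Read ''outd'' (rd z)))) \<longleftrightarrow> ?c"
    using x(3) by auto
  have sem: "sem \<alpha> (push z) M = (if ?c then M(''stk'' := (M ''stk'')(M ''sp'' 0 := \<nu> x),
      ''sp'' := (M ''sp'')(0 := M ''sp'' 0 + 1)) else M)"
    unfolding push_def sem.simps(3) c using z x(3) by simp
  show "stacked (sem \<alpha> (push z) M) (if ?c then insert x D else D)"
  proof (cases ?c)
    case True
    show ?thesis unfolding sem if_P[OF True] by (rule stacked_push[OF S x(1,2)]) simp_all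
  next
    case False
    then show ?thesis unfolding sem using S by (simp only: if_not_P if_False)
  qed
  show "y \<noteq> ''stk'' \<Longrightarrow> y \<noteq> ''sp'' \<Longrightarrow> sem \<alpha> (push z) M y = M y" unfolding sem by simp
qed

text \<open>If \<open>(u, w)\<close> is present already, \<open>u\<close> loses a successor and
  \<open>w\<close> a predecessor, and both may become eligible. Otherwise \<open>w\<close> replaces
  \<open>v\<close> behind \<open>u\<close>, and \<open>u\<close> replaces it in front of
  \<open>w\<close>, so only the sums change.\<close>

lemma update_degrees_correct:
  assumes A: "A \<subseteq> V \<times> V" "V \<subseteq> pverts G" "finite V" and i: "inner A u v w"
    and ne: "u \<noteq> w" "u \<noteq> v" "v \<noteq> w"
    and D: "degrees M A V" and S: "stacked M (deg11 A V - {v})"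
    and uvw: "M ''u'' 0 = \<nu> u" "M ''v'' 0 = \<nu> v" "M ''w'' 0 = \<nu> w"
    and ex: "0 < M ''leaf'' (M ''k'' 0) + M ''comp'' (M ''k'' 0) \<longleftrightarrow> (u, w) \<in> A"
    and M'_def: "M' = sem \<alpha> update_degrees M"
  shows "degrees M' (contract A u v w) (V - {v}) \<and> stacked M' (deg11 (contract A u v w) (V - {v})) \<and>
    (\<forall>z. z \<notin> {''outsum'', ''insum'', ''outd'', ''ind'', ''stk'', ''sp''} \<longrightarrow> M' z = M z)"
proof -
  let ?A = "contract A u v w" and ?V = "V - {v}"
  note nb = contract_neighbours[OF i ne]
  have uvA: "(u, v) \<in> A" "(v, w) \<in> A" using inner_arcs[OF i] by blast+
  then have V: "u \<in> V" "v \<in> V" "w \<in> V" using A(1) by blast+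
  have fin: "finite (preds A x)" "finite (succs A x)" for x
    using A(1) by (auto simp: preds_def succs_def intro: finite_subset[OF _ A(3)])
  have inV: "preds A x \<subseteq> V" "succs A x \<subseteq> V" for x using A(1) by (auto simp: preds_def succs_def)
  have vs: "v \<in> succs A u" "v \<in> preds A w" using uvA by (simp_all add: succs_def preds_def)
  have \<nu>V: "\<nu> x = \<nu> y \<longleftrightarrow> x = y" if "x \<in> V" "y \<in> V" for x y using \<nu>_eq_iff that A(2) by blast
  have ws: "w \<in> succs A u \<longleftrightarrow> (u, w) \<in> A" "u \<in> preds A w \<longleftrightarrow> (u, w) \<in> A" by (simp_all add: succs_def preds_def)
  have Dx: "M ''ind'' (\<nu> x) = card (preds A x)" "M ''outd'' (\<nu> x) = card (succs A x)"
    "M ''insum'' (\<nu> x) = sum \<nu> (preds A x)" "M ''outsum'' (\<nu> x) = sum \<nu> (succs A x)" if "x \<in> V" for x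
    using D that by (simp_all add: degrees_def)
  let ?os = "(M ''outsum'')(\<nu> u := M ''outsum'' (\<nu> u) - \<nu> v)"
  let ?is = "(M ''insum'')(\<nu> w := M ''insum'' (\<nu> w) - \<nu> v)"
  \<comment> \<open>Truncated subtraction is exact here because \<open>v\<close> is one of the
    summands.\<close>
  have sums: "sum \<nu> (succs A u - {v}) = M ''outsum'' (\<nu> u) - \<nu> v" "sum \<nu> (preds A w - {v}) = M ''insum'' (\<nu> w) - \<nu> v"
    using Dx V vs by (simp_all add: sum_diff1_nat)
  show ?thesis
  proof (cases "(u, w) \<in> A")
    case True
    define M1 where "M1 = M(''outsum'' := ?os, ''insum'' := ?is,
      ''outd'' := (M ''outd'')(\<nu> u := M ''outd'' (\<nu> u) - 1), ''ind'' := (M ''ind'')(\<nu> w := M ''ind'' (\<nu> w) - 1))"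
    define M2 where "M2 = sem \<alpha> (push ''u'') M1"
    have M': "M' = sem \<alpha> (push ''w'') M2"
      unfolding M'_def update_degrees_def M2_def M1_def using ex True uvw by simp
    have su: "succs ?A u = succs A u - {v}" "preds ?A w = preds A w - {v}" using nb True ws ne by auto
    have cards: "card (succs A u - {v}) = card (succs A u) - 1" "card (preds A w - {v}) = card (preds A w) - 1"
      using vs fin by simp_all
    have D1: "degrees M1 ?A ?V" unfolding degrees_def
    proof
      fix x assume x: "x \<in> ?V"
      have "M1 ''outd'' (\<nu> x) = card (succs ?A x) \<and> M1 ''outsum'' (\<nu> x) = sum \<nu> (succs ?A x)"
        using x Dx[of x] \<nu>V[of x u] V nb(1)[of x] su(1) cards(1) sums(1)
        by (cases "x = u") (simp_all add: M1_def)
      moreover have "M1 ''ind'' (\<nu> x) = card (preds ?A x) \<and> M1 ''insum'' (\<nu> x) = sum \<nu> (preds ?A x)"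
        using x Dx[of x] \<nu>V[of x w] V nb(3)[of x] su(2) cards(2) sums(2)
        by (cases "x = w") (simp_all add: M1_def)
      ultimately show "M1 ''ind'' (\<nu> x) = card (preds ?A x) \<and> M1 ''outd'' (\<nu> x) = card (succs ?A x) \<and>
        M1 ''insum'' (\<nu> x) = sum \<nu> (preds ?A x) \<and> M1 ''outsum'' (\<nu> x) = sum \<nu> (succs ?A x)" by blast
    qed
    \<comment> \<open>Before the update \<open>u\<close> has two successors and \<open>w\<close> two
      predecessors, so neither is on the stack and pushing them creates no duplicates.\<close>
    have two: "card (succs A u) \<noteq> 1" "card (preds A w) \<noteq> 1"
    proof -
      have "{v, w} \<subseteq> succs A u" "{v, u} \<subseteq> preds A w" using vs ws True by auto
      then have "card {v, w} \<le> card (succs A u)" "card {v, u} \<le> card (preds A w)"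
        using card_mono fin by blast+
      then show "card (succs A u) \<noteq> 1" "card (preds A w) \<noteq> 1" using ne by auto
    qed
    let ?D = "deg11 A V - {v}"
    have uD: "u \<notin> ?D" "w \<notin> ?D" using two by (auto simp: deg11_def)
    have S1: "stacked M1 ?D" using S by (simp add: stacked_def M1_def)
    have DV: "?D \<subseteq> pverts G" using A(2) by (auto simp: deg11_def)
    have "M1 ''u'' 0 = \<nu> u" by (simp add: M1_def uvw)
    note P2 = push_correct[OF S1 _ uD(1) this, folded M2_def]
    define D2 where "D2 = (if M1 ''ind'' (\<nu> u) = 1 \<and> M1 ''outd'' (\<nu> u) = 1 then insert u ?D else ?D)"
    have S2: "stacked M2 D2" unfolding D2_def by (rule P2(1)) (use DV V A(2) in auto)
    have f2: "M2 y = M1 y" if "y \<noteq> ''stk''" "y \<noteq> ''sp''" for y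
      by (rule P2(2)) (use DV V A(2) that in auto)
    have D2: "D2 \<subseteq> pverts G" "w \<notin> D2" using DV V A(2) uD ne unfolding D2_def by auto
    have "M2 ''w'' 0 = \<nu> w" by (simp add: f2 M1_def uvw)
    note P3 = push_correct[OF S2 _ D2(2) this, folded M']
    define D3 where "D3 = (if M2 ''ind'' (\<nu> w) = 1 \<and> M2 ''outd'' (\<nu> w) = 1 then insert w D2 else D2)"
    have S3: "stacked M' D3" unfolding D3_def by (rule P3(1)) (use D2 V A(2) in auto)
    have f3: "M' y = M2 y" if "y \<noteq> ''stk''" "y \<noteq> ''sp''" for y
      by (rule P3(2)) (use D2 V A(2) that in auto)
    have D1x: "M1 ''ind'' (\<nu> x) = card (preds ?A x)" "M1 ''outd'' (\<nu> x) = card (succs ?A x)" if "x \<in> ?V" for x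
      using D1 that by (simp_all add: degrees_def)
    have "D3 = deg11 ?A ?V"
    proof (rule set_eqI)
      fix x
      have u: "u \<in> ?V" and w: "w \<in> ?V" using V ne by auto
      have xD: "x \<in> D3 \<longleftrightarrow> x \<in> ?D \<or> (x = u \<or> x = w) \<and> card (preds ?A x) = 1 \<and> card (succs ?A x) = 1"
        unfolding D3_def D2_def using D1x[OF u] D1x[OF w] by (auto simp: f2)
      show "x \<in> D3 \<longleftrightarrow> x \<in> deg11 ?A ?V"
      proof (cases "x = u \<or> x = w")
        case True
        then show ?thesis unfolding xD using uD u w by (auto simp: deg11_def)
      next
        case False
        then show ?thesis unfolding xD using nb(1)[of x] nb(3)[of x] by (auto simp: deg11_def)
      qed
    qed
    then have "stacked M' (deg11 ?A ?V)" using S3 by simp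
    moreover have "degrees M' ?A ?V" using D1 by (simp add: degrees_def f2 f3)
    moreover have "\<forall>z. z \<notin> {''outsum'', ''insum'', ''outd'', ''ind'', ''stk'', ''sp''} \<longrightarrow> M' z = M z"
      by (simp add: f2 f3 M1_def)
    ultimately show ?thesis by blast
  next
    case False
    have M': "M' = M(''outsum'' := ?os(\<nu> u := ?os (\<nu> u) + \<nu> w), ''insum'' := ?is(\<nu> w := ?is (\<nu> w) + \<nu> u))"
      unfolding M'_def update_degrees_def using ex False uvw by simp
    have new: "w \<notin> succs A u" "u \<notin> preds A w" using False by (simp_all add: ws)
    have cards: "card (succs ?A u) = card (succs A u)" "card (preds ?A w) = card (preds A w)"
    proof -
      have "card (succs ?A u) = Suc (card (succs A u - {v}))" "card (preds ?A w) = Suc (card (preds A w - {v}))"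
        unfolding nb(2,4) using new fin by simp_all
      then show "card (succs ?A u) = card (succs A u)" "card (preds ?A w) = card (preds A w)"
        using vs fin by (simp_all add: card_Suc_Diff1 del: card_Diff_insert)
    qed
    have sums': "sum \<nu> (succs ?A u) = M ''outsum'' (\<nu> u) - \<nu> v + \<nu> w"
      "sum \<nu> (preds ?A w) = M ''insum'' (\<nu> w) - \<nu> v + \<nu> u"
      unfolding nb(2,4) using new fin sums by simp_all
    have "degrees M' ?A ?V" unfolding degrees_def
    proof
      fix x assume x: "x \<in> ?V"
      have "M' ''outd'' (\<nu> x) = card (succs ?A x) \<and> M' ''outsum'' (\<nu> x) = sum \<nu> (succs ?A x)"
        using x Dx[of x] \<nu>V[of x u] V nb(1)[of x] cards(1) sums'(1)
        by (cases "x = u") (simp_all add: M')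
      moreover have "M' ''ind'' (\<nu> x) = card (preds ?A x) \<and> M' ''insum'' (\<nu> x) = sum \<nu> (preds ?A x)"
        using x Dx[of x] \<nu>V[of x w] V nb(3)[of x] cards(2) sums'(2)
        by (cases "x = w") (simp_all add: M')
      ultimately show "M' ''ind'' (\<nu> x) = card (preds ?A x) \<and> M' ''outd'' (\<nu> x) = card (succs ?A x) \<and>
        M' ''insum'' (\<nu> x) = sum \<nu> (preds ?A x) \<and> M' ''outsum'' (\<nu> x) = sum \<nu> (succs ?A x)" by blast
    qed
    moreover have "card (preds ?A x) = card (preds A x) \<and> card (succs ?A x) = card (succs A x)" if "x \<noteq> v" for x
      using nb(1,3)[OF that] cards by (cases "x = u"; cases "x = w") simp_all
    then have "deg11 ?A ?V = deg11 A V - {v}" unfolding deg11_def by auto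
    then have "stacked M' (deg11 ?A ?V)" using S by (simp add: stacked_def M')
    ultimately show ?thesis by (simp add: M')
  qed
qed

end

section \<open>One round of the reduction\<close>

context encoded_graph
begin

text \<open>By the last conjunct \<open>u\<close> and \<open>w\<close> hold the ends of some present
  piece; when a single pair is left, it is found there without a search.\<close>

definition reduction_inv :: "memory \<Rightarrow> 'a sptree list \<Rightarrow> 'a sptree set \<Rightarrow> 'a set \<Rightarrow> bool" where
  "reduction_inv M ts P V \<longleftrightarrow>
     assembled es G M ts P V \<and> V \<subseteq> pverts G \<and> (\<exists>s t. dsp s t \<lparr>pverts = V, parcs = ends ` P\<rparr>) \<and>
     (\<forall>x\<in>V. \<forall>y\<in>V. entry M ts P x y (index x y)) \<and>
     degrees M (ends ` P) V \<and> stacked M (deg11 (ends ` P) V) \<and>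
     (\<forall>i<n. M ''ofs'' i = i * n) \<and> (\<forall>j<m. M ''E'' j = 1) \<and>
     (\<exists>x y. (x, y) \<in> ends ` P \<and> M ''u'' 0 = \<nu> x \<and> M ''w'' 0 = \<nu> y)"

lemma finite_V: "V \<subseteq> pverts G \<Longrightarrow> finite V"
  using \<nu>_image \<nu>_inj finite_imageD[of \<nu> "pverts G"] finite_subset[of V "pverts G"] by simp

lemma reduce_step:
  assumes I: "reduction_inv M ts P V" and sp: "0 < M ''sp'' 0"
  shows "\<exists>ts' P' v. v \<in> V \<and> reduction_inv (sem \<alpha> reduce M) ts' P' (V - {v})"
proof -
  let ?A = "ends ` P"
  from I have A: "assembled es G M ts P V" and VG: "V \<subseteq> pverts G"
    and E: "\<And>x y. x \<in> V \<Longrightarrow> y \<in> V \<Longrightarrow> entry M ts P x y (index x y)"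
    and D: "degrees M ?A V" and S: "stacked M (deg11 ?A V)" and ofs: "\<And>i. i < n \<Longrightarrow> M ''ofs'' i = i * n"
    and ones: "\<And>j. j < m \<Longrightarrow> M ''E'' j = 1"
    by (simp_all add: reduction_inv_def)
  from I obtain s t where st: "dsp s t \<lparr>pverts = V, parcs = ?A\<rparr>" by (auto simp: reduction_inv_def)
  let ?top = "M ''sp'' 0 - 1"
  have "M ''stk'' ?top \<in> \<nu> ` deg11 ?A V" using S sp by (auto simp: stacked_def)
  then obtain v where v: "v \<in> deg11 ?A V" "M ''stk'' ?top = \<nu> v" by blast
  have vV: "v \<in> V" using v by (simp add: deg11_def)
  obtain u where u: "preds ?A v = {u}" using v(1) by (auto simp: deg11_def card_1_singleton_iff)
  obtain w where w: "succs ?A v = {w}" using v(1) by (auto simp: deg11_def card_1_singleton_iff)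
  have i: "inner ?A u v w" using u w by (simp add: inner_def)
  note uvw = inner_arcs[OF i]
  have AV: "?A \<subseteq> V \<times> V"
  proof
    fix e assume "e \<in> ?A"
    then show "e \<in> V \<times> V" using dsp_arcs_in_verts[OF st, of "fst e" "snd e"] by (cases e) simp
  qed
  have V: "u \<in> V" "w \<in> V" using AV uvw by blast+
  have loopfree: "(x, x) \<notin> ?A" for x using dsp_asym[OF st, of x x] by auto
  have ne: "u \<noteq> v" "v \<noteq> w" using uvw loopfree by blast+
  \<comment> \<open>There are no cycles of length two, so the new arc is not a loop.\<close>
  have ne': "u \<noteq> w" using dsp_asym[OF st, of u v] uvw by auto
  have lt: "\<nu> u < n" "\<nu> v < n" using \<nu>_less VG V vV by blast+

  define M1 where "M1 = sem \<alpha> pop M"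
  have M1: "M1 = M(''sp'' := (M ''sp'')(0 := ?top), ''v'' := (M ''v'')(0 := \<nu> v), ''u'' := (M ''u'')(0 := \<nu> u),
    ''w'' := (M ''w'')(0 := \<nu> w), ''k'' := (M ''k'')(0 := index u v))"
    using D vV u w v(2) ofs[OF lt(1)] by (simp add: M1_def pop_def degrees_def)
  have A1: "assembled es G M1 ts P V" using assembled_cong[OF A, of M1] by (simp add: M1)
  have E1: "entry M1 ts P u v (M1 ''k'' 0)"
    using entry_cong[OF E[OF V(1) vV] HOL.refl, of M1 "[]"] by (simp add: M1)
  have puv: "parallels P u v \<noteq> {}" "parallels P v w \<noteq> {}" using uvw by (auto simp: ends_image)

  define M2 where "M2 = sem \<alpha> join M1"
  obtain zs1 P2 X where A2: "assembled es G M2 (ts @ zs1) P2 V" and X: "parallels P2 u v = {X}"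
    and p2_all: "\<forall>x y. (x, y) \<noteq> (u, v) \<longrightarrow> parallels P2 x y = parallels P x y"
    and r2: "M2 ''r'' 0 < length (ts @ zs1)" "(ts @ zs1) ! M2 ''r'' 0 = X"
    and f2_all: "\<forall>z. z \<notin> {''kind'', ''left'', ''right'', ''cnt'', ''r''} \<longrightarrow> M2 z = M1 z"
    using join_correct[OF A1 E1 puv(1) M2_def] by (elim exE conjE) (rule that)
  note p2 = p2_all[rule_format] and f2 = f2_all[rule_format]

  define M3 where "M3 = sem \<alpha> second M2"
  have M3: "M3 = M2(''a'' := (M2 ''a'')(0 := M2 ''r'' 0), ''k'' := (M2 ''k'')(0 := index v w))"
    using ofs[OF lt(2)] by (simp add: M3_def second_def f2 M1)
  have A3: "assembled es G M3 (ts @ zs1) P2 V" using assembled_cong[OF A2, of M3] by (simp add: M3)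
  have p2vw: "parallels P2 v w = parallels P v w" using p2[of v w] ne by simp
  then have pvw2: "parallels P2 v w \<noteq> {}" using puv(2) by simp
  have E3: "entry M3 (ts @ zs1) P2 v w (M3 ''k'' 0)"
    using entry_cong[OF E[OF vV V(2)] p2vw, of M3 zs1] by (simp add: M3 f2 M1)

  define M4 where "M4 = sem \<alpha> join M3"
  obtain zs2 P4 Y where A4: "assembled es G M4 ((ts @ zs1) @ zs2) P4 V" and Y: "parallels P4 v w = {Y}"
    and p4_all: "\<forall>x y. (x, y) \<noteq> (v, w) \<longrightarrow> parallels P4 x y = parallels P2 x y"
    and r4: "M4 ''r'' 0 < length ((ts @ zs1) @ zs2)" "((ts @ zs1) @ zs2) ! M4 ''r'' 0 = Y"
    and f4_all: "\<forall>z. z \<notin> {''kind'', ''left'', ''right'', ''cnt'', ''r''} \<longrightarrow> M4 z = M3 z"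
    using join_correct[OF A3 E3 pvw2 M4_def] by (elim exE conjE) (rule that)
  note p4 = p4_all[rule_format] and f4 = f4_all[rule_format]
  let ?ts4 = "(ts @ zs1) @ zs2"
  have X4: "parallels P4 u v = {X}" using p4[of u v] X ne by blast
  have p4': "parallels P4 x y = parallels P x y" if "(x, y) \<noteq> (u, v)" "(x, y) \<noteq> (v, w)" for x y
    using p4[OF that(2)] p2[OF that(1)] by simp
  have XY: "X \<in> P4" "Y \<in> P4" "ends X = (u, v)" "ends Y = (v, w)" using X4 Y by (auto simp: parallels_def)
  have a42: "M4 ''a'' 0 = M2 ''r'' 0" by (simp add: f4 M3)
  have "?ts4 ! M2 ''r'' 0 = (ts @ zs1) ! M2 ''r'' 0"
    unfolding nth_append[of "ts @ zs1" zs2] using r2(1) by (simp only: if_True)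
  then have a4: "M4 ''a'' 0 < length ?ts4" "?ts4 ! M4 ''a'' 0 = X"
    unfolding a42 using r2 by simp_all
  have cnt4: "M4 ''cnt'' 0 = length ?ts4" and F4: "forest G V P4" using A4 by (simp_all add: assembled_def)
  \<comment> \<open>Joining replaces parallel pieces by one with the same ends, so the reduced graph
    has not changed yet.\<close>
  have ends4: "ends ` P4 = ?A"
  proof -
    have "parallels P4 x y \<noteq> {} \<longleftrightarrow> parallels P x y \<noteq> {}" for x y
      using X4 Y p4'[of x y] puv by (cases "(x, y) = (u, v)"; cases "(x, y) = (v, w)") auto
    then show ?thesis unfolding ends_image by simp
  qed

  let ?Z = "Ser X Y" and ?V = "V - {v}"
  define P5 where "P5 = insert ?Z (P4 - {X, Y})"
  have F5: "forest G ?V P5" unfolding P5_def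
  proof (rule forest_ser[OF F4 XY(1,2)])
    show "tree_sink X = v" "tree_source Y = v" "tree_source X \<noteq> tree_sink Y"
      using XY(3,4) ne' by (simp_all add: ends_def)
    \<comment> \<open>A piece at \<open>v\<close> runs along the only incoming or the only outgoing
      arc of \<open>v\<close>, and the joins have left exactly one piece on each of them.\<close>
    fix W assume W: "W \<in> P4" "v \<in> tverts W \<inter> V"
    have "ends W \<in> ?A" unfolding ends4[symmetric] using W(1) by (rule imageI)
    then have "tree_source W \<in> preds ?A (tree_sink W)" "tree_sink W \<in> succs ?A (tree_source W)"
      by (simp_all add: ends_def[of W] preds_def succs_def)
    moreover have "v = tree_source W \<or> v = tree_sink W" using W(2) forestD(3)[OF F4 W(1)] by blast
    ultimately have "ends W = (u, v) \<or> ends W = (v, w)" using u w by (elim disjE) (simp_all add: ends_def[of W])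
    then have "W \<in> parallels P4 u v \<or> W \<in> parallels P4 v w" using W(1) by (auto simp: parallels_def)
    then show "W = X \<or> W = Y" using X4 Y by blast
  qed
  have reg4: "M4 ''u'' 0 = \<nu> u" "M4 ''v'' 0 = \<nu> v" "M4 ''w'' 0 = \<nu> w" "M4 ''ofs'' (\<nu> u) = \<nu> u * n"
    using ofs[OF lt(1)] by (simp_all add: f4 M3 f2 M1)
  have old4: "M4 ''ofs'' = M ''ofs''" "M4 ''E'' = M ''E''" "M4 ''leaf'' = M ''leaf''" "M4 ''comp'' = M ''comp''"
    "M4 ''ind'' = M ''ind''" "M4 ''outd'' = M ''outd''" "M4 ''insum'' = M ''insum''" "M4 ''outsum'' = M ''outsum''"
    "M4 ''stk'' = M ''stk''" "M4 ''sp'' 0 = ?top"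
    by (simp_all add: f4 M3 f2 M1)
  define M5 where "M5 = sem \<alpha> serial M4"
  have M5: "M5 = M4(''kind'' := (M4 ''kind'')(length ?ts4 := 1), ''left'' := (M4 ''left'')(length ?ts4 := M4 ''a'' 0),
    ''right'' := (M4 ''right'')(length ?ts4 := M4 ''r'' 0), ''cnt'' := (M4 ''cnt'')(0 := length ?ts4 + 1),
    ''k'' := (M4 ''k'')(0 := index u w))"
    unfolding M5_def serial_def by (simp add: sem_make_node cnt4 reg4)
  have A5: "assembled es G M5 (?ts4 @ [?Z]) P5 ?V"
    using assembled_merge[OF A4 a4(1) r4(1), of 1 ?Z ?V M5, unfolded a4(2) r4(2)] XY(1,2) F5
    by (simp add: M5 P5_def)
  have eZ: "ends ?Z = (u, w)" using XY(3,4) by (simp add: ends_def)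
  have p5: "parallels P5 x y = (if (x, y) = (u, v) \<or> (x, y) = (v, w) then {} else parallels P x y)"
    if "(x, y) \<noteq> (u, w)" for x y
  proof -
    have eq: "parallels P5 x y = parallels P4 x y - {X, Y}"
      unfolding P5_def by (rule parallels_merge(2)) (use eZ that in auto)
    have nX: "X \<notin> parallels P4 x y" if "(x, y) \<noteq> (u, v)" using that XY(3) by (auto simp: parallels_def)
    have nY: "Y \<notin> parallels P4 x y" if "(x, y) \<noteq> (v, w)" using that XY(4) by (auto simp: parallels_def)
    consider "(x, y) = (u, v)" | "(x, y) = (v, w)" | "(x, y) \<noteq> (u, v)" "(x, y) \<noteq> (v, w)" by blast
    then show ?thesis
    proof cases
      case 1
      then show ?thesis unfolding eq using X4 by simp
    next
      case 2
      then show ?thesis unfolding eq using Y by simp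
    next
      case 3
      then have "parallels P4 x y - {X, Y} = parallels P x y" using nX nY p4'[OF 3] by (simp add: Diff_insert0)
      then show ?thesis unfolding eq using 3 by (simp only: if_False simp_thms)
    qed
  qed
  have Z4: "?Z \<notin> P4"
  proof
    assume "?Z \<in> P4"
    then have "?Z \<in> \<Union> (nodes ` P4)" using node_refl[of ?Z] by (rule UN_I)
    moreover have "?Z \<notin> \<Union> (nodes ` P4)" by (rule nodes_merge(1)[OF F4 XY(1,2)]) simp
    ultimately show False by (rule notE[rotated])
  qed
  \<comment> \<open>Apart from the new S-node the pieces between \<open>u\<close> and
    \<open>w\<close> are those from the beginning of the round, which the matrix entry
    describes.\<close>
  have p5uw: "parallels (P5 - {?Z}) u w = parallels P u w"
  proof -
    have eq: "P5 - {?Z} = P4 - {X, Y}" unfolding P5_def using Z4 by (simp add: insert_Diff_if Diff_insert0)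
    have "parallels (P4 - {X, Y}) u w = parallels P4 u w"
      unfolding parallels_def using XY(3,4) ne by (intro Collect_cong) auto
    then show ?thesis unfolding eq using p4'[of u w] ne by simp
  qed

  define M6 where "M6 = sem \<alpha> update_degrees M5"
  have DD: "degrees M5 ?A V" using D by (simp add: degrees_def M5 old4 reg4)
  \<comment> \<open>The entries of the stack are distinct and \<nu> is injective, so dropping the
    top removes exactly \<open>v\<close> from the represented set.\<close>
  have SS: "stacked M5 (deg11 ?A V - {v})"
  proof -
    have b: "{..<M ''sp'' 0} = insert ?top {..<?top}" using sp by auto
    have inj: "inj_on (M ''stk'') (insert ?top {..<?top})" and
      im: "M ''stk'' ` insert ?top {..<?top} = \<nu> ` deg11 ?A V"
      using S unfolding stacked_def b by simp_all
    have "M ''stk'' ` {..<?top} = M ''stk'' ` insert ?top {..<?top} - {M ''stk'' ?top}"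
      using inj by (auto simp: inj_on_def)
    also have "\<dots> = \<nu> ` (deg11 ?A V - {v})"
    proof -
      have "deg11 ?A V \<subseteq> pverts G" using VG by (auto simp: deg11_def)
      then have "inj_on \<nu> (deg11 ?A V)" using \<nu>_inj inj_on_subset by blast
      then show ?thesis unfolding im v(2) using v(1) by (auto simp: inj_on_def)
    qed
    finally have "M ''stk'' ` {..<?top} = \<nu> ` (deg11 ?A V - {v})" .
    then show ?thesis using inj by (simp add: stacked_def M5 old4 reg4)
  qed
  have Euw: "entry M ts P u w (index u w)" using E V by blast
  \<comment> \<open>The degrees are updated before \<open>absorb\<close>, so the matrix still tells
    whether the arc \<open>(u, w)\<close> existed before the elimination.\<close>
  have ex: "0 < M5 ''leaf'' (M5 ''k'' 0) + M5 ''comp'' (M5 ''k'' 0) \<longleftrightarrow> (u, w) \<in> ?A"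
  proof -
    have "(u, w) \<in> ?A \<longleftrightarrow> parallels P u w \<noteq> {}" by (simp add: ends_image)
    also have "\<dots> \<longleftrightarrow> 0 < M ''leaf'' (index u w) + M ''comp'' (index u w)"
      using Euw by (auto simp: entry_def slot_def split: if_splits)
    finally show ?thesis by (simp add: M5 old4 reg4)
  qed
  have reg5: "M5 ''u'' 0 = \<nu> u" "M5 ''v'' 0 = \<nu> v" "M5 ''w'' 0 = \<nu> w" by (simp_all add: M5 old4 reg4)
  note U = update_degrees_correct[OF AV VG finite_V[OF VG] i ne' ne DD SS reg5 ex M6_def]
  note D6 = U[THEN conjunct1] and S6 = U[THEN conjunct2, THEN conjunct1]
    and f6 = U[THEN conjunct2, THEN conjunct2, rule_format]
  have A6: "assembled es G M6 (?ts4 @ [?Z]) P5 ?V" using assembled_cong[OF A5, of M6] by (simp add: f6)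
  have k6: "M6 ''k'' 0 = index u w" by (simp add: f6 M5)
  have E6: "entry M6 (butlast (?ts4 @ [?Z])) (P5 - {last (?ts4 @ [?Z])}) u w (M6 ''k'' 0)"
    unfolding butlast_snoc last_snoc k6 unfolding append_assoc
    by (rule entry_cong[OF Euw p5uw]) (simp_all add: f6 M5 old4 reg4)

  have snoc_neq_Nil: "?ts4 @ [?Z] \<noteq> []" by simp
  define M7 where "M7 = sem \<alpha> absorb M6"
  have Z6: "last (?ts4 @ [?Z]) \<in> P5" "ends (last (?ts4 @ [?Z])) = (u, w)" "no_leaf (last (?ts4 @ [?Z]))"
    using eZ by (simp_all add: P5_def no_leaf_def)
  obtain zs3 P7 where A7: "assembled es G M7 ((?ts4 @ [?Z]) @ zs3) P7 ?V"
    and E7: "entry M7 ((?ts4 @ [?Z]) @ zs3) P7 u w (M6 ''k'' 0)" and ne7: "parallels P7 u w \<noteq> {}"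
    and p7_all: "\<forall>x y. (x, y) \<noteq> (u, w) \<longrightarrow> parallels P7 x y = parallels P5 x y"
    and f7_all: "\<forall>z. z \<notin> {''kind'', ''left'', ''right'', ''cnt'', ''comp''} \<longrightarrow> M7 z = M6 z"
    and c7_all: "\<forall>k. k \<noteq> M6 ''k'' 0 \<longrightarrow> M7 ''comp'' k = M6 ''comp'' k"
    using absorb_correct[OF A6 E6 _ Z6 M7_def, OF snoc_neq_Nil] by (elim exE conjE) (rule that)
  note p7 = p7_all[rule_format] and f7 = f7_all[rule_format] and c7 = c7_all[rule_format]
  have ends7: "ends ` P7 = contract ?A u v w"
  proof -
    have "parallels P7 x y \<noteq> {} \<longleftrightarrow> (x, y) \<in> contract ?A u v w" for x y
      using ne7 p7[of x y] p5[of x y] ne by (cases "(x, y) = (u, w)") (auto simp: contract_def ends_image)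
    then show ?thesis unfolding ends_image[of P7] by auto
  qed
  have entries: "entry M7 ((?ts4 @ [?Z]) @ zs3) P7 x y (index x y)" if xy: "x \<in> ?V" "y \<in> ?V" for x y
  proof (cases "(x, y) = (u, w)")
    case True
    then show ?thesis using E7 k6 by simp
  next
    case False
    have p: "parallels P7 x y = parallels P x y" using p7[OF False] p5[OF False] xy by auto
    have "index x y \<noteq> index u w" using index_eq_iff[of x y u w] False xy V VG by blast
    then have c: "M7 ''comp'' (index x y) = M ''comp'' (index x y)"
      using c7[of "index x y"] k6 by (simp add: f6 M5 old4 reg4)
    have l: "M7 ''leaf'' (index x y) = M ''leaf'' (index x y)" by (simp add: f7 f6 M5 old4 reg4)
    have "entry M ts P x y (index x y)" using E xy by blast
    then have "entry M7 (ts @ (zs1 @ zs2 @ [?Z] @ zs3)) P7 x y (index x y)"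
      by (rule entry_cong) (fact p l c)+
    then show ?thesis by simp
  qed
  have "dsp s t \<lparr>pverts = ?V, parcs = contract ?A u v w\<rparr>" using dsp_contract[OF st] i by simp
  moreover have "degrees M7 (contract ?A u v w) ?V" using D6 by (simp add: degrees_def f7)
  moreover have "stacked M7 (deg11 (contract ?A u v w) ?V)" using S6 by (simp add: stacked_def f7)
  moreover have "\<forall>i<n. M7 ''ofs'' i = i * n" using ofs by (simp add: f7 f6 M5 old4 reg4)
  moreover have "\<forall>j<m. M7 ''E'' j = 1" using ones by (simp add: f7 f6 M5 old4 reg4)
  moreover have "(u, w) \<in> contract ?A u v w" by (simp add: contract_def)
  moreover have "M7 ''u'' 0 = \<nu> u" "M7 ''w'' 0 = \<nu> w" by (simp_all add: f7 f6 M5 old4 reg4)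
  ultimately have "reduction_inv M7 ((?ts4 @ [?Z]) @ zs3) P7 ?V"
    unfolding reduction_inv_def ends7 using A7 VG entries by blast
  moreover have "sem \<alpha> reduce M = M7"
    by (simp add: reduce_def M1_def M2_def M3_def M4_def M5_def M6_def M7_def)
  ultimately show ?thesis using vV by metis
qed

end

section \<open>Setting up and running the reduction\<close>

text \<open>The machine cannot multiply; the multiples of \<open>n\<close> are accumulated by
  additions in linear time.\<close>

definition offsets_step :: program where
  "offsets_step = Seq (Write ''ofs'' (Plus (rd ''i'') (Const 1)) (Plus (Read ''ofs'' (rd ''i'')) (rd ''n'')))
     (increment ''i'' (Const 0))"

text \<open>Edge \<open>i\<close> becomes the leaf record with address \<open>i\<close>; its kind 0
  is what the cell contains anyway. The matrix stores the successor \<open>i + 1\<close> of the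
  address.\<close>

definition load_step :: program where
  "load_step =
     Seq (Write ''left'' (rd ''i'') (rd ''i''))
     (Seq (Write ''E'' (rd ''i'') (Const 1))
     (Seq (Write ''leaf'' (Plus (Read ''ofs'' (Read ''tail'' (rd ''i''))) (Read ''head'' (rd ''i''))) (Plus (rd ''i'') (Const 1)))
     (Seq (increment ''outd'' (Read ''tail'' (rd ''i'')))
     (Seq (increment ''ind'' (Read ''head'' (rd ''i'')))
     (Seq (Write ''outsum'' (Read ''tail'' (rd ''i''))
        (Plus (Read ''outsum'' (Read ''tail'' (rd ''i''))) (Read ''head'' (rd ''i''))))
     (Seq (Write ''insum'' (Read ''head'' (rd ''i''))
        (Plus (Read ''insum'' (Read ''head'' (rd ''i''))) (Read ''tail'' (rd ''i''))))
     (increment ''i'' (Const 0))))))))"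

text \<open>The \<open>m\<close> leaf records count as allocated. The ends of the first edge are the
  pair that the reduction invariant requires in \<open>u\<close> and \<open>w\<close>.\<close>

definition start_stack :: program where
  "start_stack =
     Seq (put ''cnt'' (rd ''m''))
     (Seq (put ''u'' (Read ''tail'' (Const 0)))
     (Seq (put ''w'' (Read ''head'' (Const 0)))
     (put ''i'' (Const 0))))"

definition stack_step :: program where
  "stack_step = Seq (push ''i'') (increment ''i'' (Const 0))"

definition finish :: program where
  "finish = Seq (put ''k'' (cell ''u'' ''w'')) (Seq join (Seq (put ''root'' (rd ''r'')) (put ''i'' (Const 0))))"

definition build :: program where
  "build =
     Seq (While (Less (rd ''i'') (rd ''n'')) offsets_step)
     (Seq (put ''i'' (Const 0))
     (Seq (While (Less (rd ''i'') (rd ''m'')) load_step)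
     (Seq start_stack
     (Seq (While (Less (rd ''i'') (rd ''n'')) stack_step)
     (Seq (While (Less (Const 0) (rd ''sp'')) reduce)
     finish)))))"

section \<open>Correctness and running time of the set-up\<close>

context encoded_graph
begin

lemma es: "distinct es" "set es = parcs G"
  using encoding by (simp_all add: graph_encoding_def)

abbreviation "inp \<equiv> input G \<nu> es"

lemma input_simps:
  "inp ''n'' 0 = n" "inp ''m'' 0 = m"
  "i < m \<Longrightarrow> inp ''tail'' i = \<nu> (fst (es ! i))" "i < m \<Longrightarrow> inp ''head'' i = \<nu> (snd (es ! i))"
  "z \<notin> {''n'', ''m'', ''tail'', ''head''} \<Longrightarrow> inp z i = 0"
  by (simp_all add: input_def)

lemma dspG: obtains s t where "dsp s t G"
  using sp_graph by (auto simp: directed_series_parallel_def)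

lemma arc_in_verts: "i < m \<Longrightarrow> fst (es ! i) \<in> pverts G \<and> snd (es ! i) \<in> pverts G \<and> fst (es ! i) \<noteq> snd (es ! i)"
proof -
  assume "i < m"
  then have "(fst (es ! i), snd (es ! i)) \<in> parcs G" using es(2) nth_mem[of i es] by simp
  then show ?thesis using dspG dsp_arcs_in_verts dsp_asym by metis
qed

definition offsets_inv :: "nat \<Rightarrow> memory \<Rightarrow> bool" where
  "offsets_inv k M \<longleftrightarrow> (\<exists>i\<le>n. k = n - i \<and> M ''i'' 0 = i \<and> (\<forall>j\<le>i. M ''ofs'' j = j * n) \<and>
     (\<forall>z. z \<notin> {''ofs'', ''i''} \<longrightarrow> M z = inp z))"

lemma offsets_triple:
  "triple \<alpha> (\<lambda>M. M = inp) (While (Less (rd ''i'') (rd ''n'')) offsets_step) ((cost offsets_step + 2) * n + 1)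
    (\<lambda>M. (\<forall>j\<le>n. M ''ofs'' j = j * n) \<and> (\<forall>z. z \<notin> {''ofs'', ''i''} \<longrightarrow> M z = inp z))"
proof (rule triple_conseq[OF triple_While[where I = offsets_inv]])
  show "loopfree_prog offsets_step" by (simp add: offsets_step_def)
  show "offsets_inv n M" if "M = inp" for M
    unfolding offsets_inv_def that by (intro exI[of _ 0]) (simp add: input_simps)
next
  fix k M assume I: "offsets_inv k M" and b: "bval \<alpha> M (Less (rd ''i'') (rd ''n''))"
  from I obtain i where i: "i \<le> n" "k = n - i" "M ''i'' 0 = i" "\<forall>j\<le>i. M ''ofs'' j = j * n"
    "\<forall>z. z \<notin> {''ofs'', ''i''} \<longrightarrow> M z = inp z" unfolding offsets_inv_def by (elim exE conjE) (rule that)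
  have nn: "M ''n'' 0 = n" using i(5) by (simp add: input_simps)
  then have "i < n" using b i(3) by simp
  let ?M = "sem \<alpha> offsets_step M"
  have M: "?M = M(''ofs'' := (M ''ofs'')(i + 1 := i * n + n), ''i'' := (M ''i'')(0 := i + 1))"
    using i(3,4) nn by (simp add: offsets_step_def)
  have "offsets_inv (n - (i + 1)) ?M" unfolding offsets_inv_def
  proof (intro exI[of _ "i + 1"] conjI allI impI)
    fix j assume "j \<le> i + 1"
    then show "?M ''ofs'' j = j * n" using i(4) by (cases "j = i + 1") (simp_all add: M)
  qed (use \<open>i < n\<close> i(5) in \<open>simp_all add: M\<close>)
  then show "\<exists>k'<k. offsets_inv k' ?M" using \<open>i < n\<close> i(2) by (intro exI[of _ "n - (i + 1)"]) simp
next
  fix M assume M: "\<not> bval \<alpha> M (Less (rd ''i'') (rd ''n'')) \<and> (\<exists>k. offsets_inv k M)"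
  then obtain k where "offsets_inv k M" by blast
  then obtain i where i: "i \<le> n" "M ''i'' 0 = i" "\<forall>j\<le>i. M ''ofs'' j = j * n"
    "\<forall>z. z \<notin> {''ofs'', ''i''} \<longrightarrow> M z = inp z" unfolding offsets_inv_def by (elim exE conjE) (rule that)
  moreover have "M ''n'' 0 = n" using i(4) by (simp add: input_simps)
  ultimately have "i = n" using M by simp
  then show "(\<forall>j\<le>n. M ''ofs'' j = j * n) \<and> (\<forall>z. z \<notin> {''ofs'', ''i''} \<longrightarrow> M z = inp z)" using i by simp
qed simp

definition loaded :: "nat \<Rightarrow> memory \<Rightarrow> bool" where
  "loaded i M \<longleftrightarrow> (\<forall>j\<le>n. M ''ofs'' j = j * n) \<and>
     (\<forall>j<i. M ''left'' j = j \<and> M ''E'' j = 1 \<and> M ''leaf'' (index (fst (es ! j)) (snd (es ! j))) = j + 1) \<and>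
     (\<forall>x\<in>pverts G. \<forall>y\<in>pverts G. (x, y) \<notin> set (take i es) \<longrightarrow> M ''leaf'' (index x y) = 0) \<and>
     degrees M (set (take i es)) (pverts G) \<and>
     (\<forall>z\<in>{''n'', ''m'', ''tail'', ''head'', ''kind'', ''comp''}. M z = inp z)"

lemma loaded_step:
  assumes L: "loaded i M" and i: "i < m" "M ''i'' 0 = i"
  shows "loaded (i + 1) (sem \<alpha> load_step M) \<and> sem \<alpha> load_step M ''i'' 0 = i + 1 \<and>
    sem \<alpha> load_step M ''sp'' = M ''sp''"
proof -
  obtain x y where e: "es ! i = (x, y)" by (cases "es ! i")
  have xy: "x \<in> pverts G" "y \<in> pverts G" using arc_in_verts[OF i(1)] e by simp_all
  let ?A = "set (take i es)" and ?A' = "set (take (Suc i) es)"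
  have A': "?A' = insert (x, y) ?A" using e i(1) by (simp add: take_Suc_conv_app_nth)
  \<comment> \<open>As the list has no repetitions, each increment accounts for a new
    neighbour.\<close>
  have new: "(x, y) \<notin> ?A"
  proof
    assume "(x, y) \<in> ?A"
    then obtain j where "j < i" "es ! j = (x, y)" using i(1) by (auto simp: in_set_conv_nth)
    then show False using nth_eq_iff_index_eq[OF es(1), of j i] e i(1) by simp
  qed
  have L': "M ''ofs'' (\<nu> x) = \<nu> x * n" "M ''tail'' i = \<nu> x" "M ''head'' i = \<nu> y"
    using L \<nu>_less[OF xy(1)] i(1) e by (simp_all add: loaded_def input_simps)
  let ?M = "sem \<alpha> load_step M"
  have M: "?M = M(''left'' := (M ''left'')(i := i), ''E'' := (M ''E'')(i := 1),
    ''leaf'' := (M ''leaf'')(index x y := i + 1), ''outd'' := (M ''outd'')(\<nu> x := M ''outd'' (\<nu> x) + 1),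
    ''ind'' := (M ''ind'')(\<nu> y := M ''ind'' (\<nu> y) + 1),
    ''outsum'' := (M ''outsum'')(\<nu> x := M ''outsum'' (\<nu> x) + \<nu> y),
    ''insum'' := (M ''insum'')(\<nu> y := M ''insum'' (\<nu> y) + \<nu> x), ''i'' := (M ''i'')(0 := i + 1))"
    using L' i(2) by (simp add: load_step_def)
  have fin: "finite (preds ?A z)" "finite (succs ?A z)" for z
  proof -
    have "preds ?A z \<subseteq> fst ` ?A" "succs ?A z \<subseteq> snd ` ?A" by (force simp: preds_def succs_def)+
    then show "finite (preds ?A z)" "finite (succs ?A z)" by (simp_all add: finite_subset)
  qed
  have nb: "succs ?A' z = (if z = x then insert y (succs ?A x) else succs ?A z)"
    "preds ?A' z = (if z = y then insert x (preds ?A y) else preds ?A z)" for z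
    unfolding A' by (auto simp: succs_def preds_def)
  have nw: "y \<notin> succs ?A x" "x \<notin> preds ?A y" using new by (simp_all add: succs_def preds_def)
  have D: "degrees ?M ?A' (pverts G)" unfolding degrees_def
  proof
    fix z assume z: "z \<in> pverts G"
    have Dz: "M ''ind'' (\<nu> z) = card (preds ?A z)" "M ''outd'' (\<nu> z) = card (succs ?A z)"
      "M ''insum'' (\<nu> z) = sum \<nu> (preds ?A z)" "M ''outsum'' (\<nu> z) = sum \<nu> (succs ?A z)"
      using L z by (simp_all add: loaded_def degrees_def)
    have "?M ''outd'' (\<nu> z) = card (succs ?A' z) \<and> ?M ''outsum'' (\<nu> z) = sum \<nu> (succs ?A' z)"
      using Dz nw(1) fin(2)[of x] \<nu>_eq_iff[OF z xy(1)] by (cases "z = x") (simp_all add: M nb)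
    moreover have "?M ''ind'' (\<nu> z) = card (preds ?A' z) \<and> ?M ''insum'' (\<nu> z) = sum \<nu> (preds ?A' z)"
      using Dz nw(2) fin(1)[of y] \<nu>_eq_iff[OF z xy(2)] by (cases "z = y") (simp_all add: M nb)
    ultimately show "?M ''ind'' (\<nu> z) = card (preds ?A' z) \<and> ?M ''outd'' (\<nu> z) = card (succs ?A' z) \<and>
      ?M ''insum'' (\<nu> z) = sum \<nu> (preds ?A' z) \<and> ?M ''outsum'' (\<nu> z) = sum \<nu> (succs ?A' z)" by blast
  qed
  have old: "?M ''left'' j = j \<and> ?M ''E'' j = 1 \<and> ?M ''leaf'' (index (fst (es ! j)) (snd (es ! j))) = j + 1"
    if j: "j < Suc i" for j
  proof (cases "j = i")
    case True
    then show ?thesis by (simp add: M e)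
  next
    case False
    then have ji: "j < i" "j < m" using j i(1) by simp_all
    have "es ! j \<noteq> es ! i" using nth_eq_iff_index_eq[OF es(1), of j i] ji i(1) by simp
    then have "index (fst (es ! j)) (snd (es ! j)) \<noteq> index x y"
      using index_eq_iff[of "fst (es ! j)" "snd (es ! j)" x y] arc_in_verts[OF ji(2)] xy e by (cases "es ! j") simp
    then show ?thesis using L ji(1) False by (simp add: M loaded_def)
  qed
  have zero: "?M ''leaf'' (index a b) = 0" if ab: "a \<in> pverts G" "b \<in> pverts G" "(a, b) \<notin> ?A'" for a b
  proof -
    have "(a, b) \<noteq> (x, y)" "(a, b) \<notin> ?A" using ab(3) unfolding A' by blast+
    then have "index a b \<noteq> index x y" using index_eq_iff[OF ab(1,2) xy] by simp
    then show ?thesis using L ab(1,2) \<open>(a, b) \<notin> ?A\<close> by (simp add: M loaded_def)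
  qed
  have "loaded (Suc i) ?M"
    unfolding loaded_def
  proof (intro conjI)
    show "\<forall>j<Suc i. ?M ''left'' j = j \<and> ?M ''E'' j = 1 \<and> ?M ''leaf'' (index (fst (es ! j)) (snd (es ! j))) = j + 1"
      using old by simp
    show "\<forall>x\<in>pverts G. \<forall>y\<in>pverts G. (x, y) \<notin> ?A' \<longrightarrow> ?M ''leaf'' (index x y) = 0" using zero by simp
    show "degrees ?M ?A' (pverts G)" by (rule D)
    show "\<forall>j\<le>n. ?M ''ofs'' j = j * n" using L by (simp add: M loaded_def)
    show "\<forall>z\<in>{''n'', ''m'', ''tail'', ''head'', ''kind'', ''comp''}. ?M z = inp z"
      using L by (simp add: M loaded_def)
  qed
  then show ?thesis by (simp add: M)
qed

lemma load_triple:
  "triple \<alpha> (\<lambda>M. loaded 0 M \<and> M ''i'' 0 = 0 \<and> M ''sp'' 0 = 0) (While (Less (rd ''i'') (rd ''m'')) load_step)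
    ((cost load_step + 2) * m + 1) (\<lambda>M. loaded m M \<and> M ''sp'' 0 = 0)"
proof (rule triple_conseq[OF triple_While[where
      I = "\<lambda>k M. \<exists>i\<le>m. k = m - i \<and> loaded i M \<and> M ''i'' 0 = i \<and> M ''sp'' 0 = 0"]])
  show "loopfree_prog load_step" by (simp add: load_step_def)
  show "\<exists>i\<le>m. m = m - i \<and> loaded i M \<and> M ''i'' 0 = i \<and> M ''sp'' 0 = 0"
    if "loaded 0 M \<and> M ''i'' 0 = 0 \<and> M ''sp'' 0 = 0" for M
    using that by (intro exI[of _ 0]) simp
next
  fix k M assume "\<exists>i\<le>m. k = m - i \<and> loaded i M \<and> M ''i'' 0 = i \<and> M ''sp'' 0 = 0"
    and b: "bval \<alpha> M (Less (rd ''i'') (rd ''m''))"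
  then obtain i where i: "i \<le> m" "k = m - i" "loaded i M" "M ''i'' 0 = i" "M ''sp'' 0 = 0" by blast
  have "M ''m'' 0 = m" using i(3) by (simp add: loaded_def input_simps)
  then have "i < m" using b i(4) by simp
  then show "\<exists>k'<k. \<exists>i\<le>m. k' = m - i \<and> loaded i (sem \<alpha> load_step M) \<and> sem \<alpha> load_step M ''i'' 0 = i \<and>
      sem \<alpha> load_step M ''sp'' 0 = 0"
    using loaded_step[OF i(3) _ i(4)] i(2,5) by (intro exI[of _ "m - (i + 1)"] conjI exI[of _ "i + 1"]) simp_all
next
  fix M assume a: "\<not> bval \<alpha> M (Less (rd ''i'') (rd ''m'')) \<and>
    (\<exists>k. \<exists>i\<le>m. k = m - i \<and> loaded i M \<and> M ''i'' 0 = i \<and> M ''sp'' 0 = 0)"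
  then obtain i where i: "i \<le> m" "loaded i M" "M ''i'' 0 = i" "M ''sp'' 0 = 0" by blast
  have "M ''m'' 0 = m" using i(2) by (simp add: loaded_def input_simps)
  then have "i = m" using a i(1,3) by simp
  then show "loaded m M \<and> M ''sp'' 0 = 0" using i by simp
qed simp

definition started :: "memory \<Rightarrow> bool" where
  "started M \<longleftrightarrow> loaded m M \<and> M ''cnt'' 0 = m \<and> M ''u'' 0 = \<nu> (fst (es ! 0)) \<and> M ''w'' 0 = \<nu> (snd (es ! 0))"

lemma m_pos: "0 < m"
proof -
  obtain s t where st: "dsp s t G" using dspG .
  obtain u where "(u, t) \<in> parcs G" using dsp_sink_in[OF st] by (elim exE) (rule that)
  then have "set es \<noteq> {}" using es(2) by auto
  then show ?thesis by simp
qed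

lemma start_stack_triple:
  "triple \<alpha> (\<lambda>M. loaded m M \<and> M ''sp'' 0 = 0) start_stack (cost start_stack)
     (\<lambda>M. started M \<and> M ''i'' 0 = 0 \<and> M ''sp'' 0 = 0)"
proof (rule triple_loopfree)
  show "loopfree_prog start_stack" by (simp add: start_stack_def)
  fix M assume M: "loaded m M \<and> M ''sp'' 0 = 0"
  then show "started (sem \<alpha> start_stack M) \<and> sem \<alpha> start_stack M ''i'' 0 = 0 \<and> sem \<alpha> start_stack M ''sp'' 0 = 0"
    using m_pos by (simp add: start_stack_def started_def loaded_def degrees_def input_simps)
qed

definition stack_inv :: "nat \<Rightarrow> memory \<Rightarrow> bool" where
  "stack_inv i M \<longleftrightarrow> started M \<and> M ''i'' 0 = i \<and> stacked M {x \<in> deg11 (parcs G) (pverts G). \<nu> x < i}"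

lemma stack_inv_step:
  assumes I: "stack_inv i M" and i: "i < n"
  shows "stack_inv (i + 1) (sem \<alpha> stack_step M)"
proof -
  let ?D = "{x \<in> deg11 (parcs G) (pverts G). \<nu> x < i}"
  have "i \<in> \<nu> ` pverts G" using i \<nu>_image by simp
  then obtain x where x: "x \<in> pverts G" "\<nu> x = i" by (elim imageE) simp
  have I': "started M" "M ''i'' 0 = \<nu> x" "stacked M ?D" using I x by (simp_all add: stack_inv_def)
  have DG: "insert x ?D \<subseteq> pverts G" "x \<notin> ?D" using x by (auto simp: deg11_def)
  define M1 where "M1 = sem \<alpha> (push ''i'') M"
  have P: "stacked M1 (if M ''ind'' (\<nu> x) = 1 \<and> M ''outd'' (\<nu> x) = 1 then insert x ?D else ?D)"
    unfolding M1_def by (rule push_correct(1)[OF I'(3) DG I'(2)]) simp_all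
  have f: "M1 z = M z" if "z \<noteq> ''stk''" "z \<noteq> ''sp''" for z
    unfolding M1_def by (rule push_correct(2)[OF I'(3) DG I'(2) _ _ that]) simp_all
  have d: "M ''ind'' (\<nu> x) = card (preds (parcs G) x)" "M ''outd'' (\<nu> x) = card (succs (parcs G) x)"
    using I'(1) x(1) es(2) by (simp_all add: started_def loaded_def degrees_def)
  have D': "{y \<in> deg11 (parcs G) (pverts G). \<nu> y < i + 1} =
    (if card (preds (parcs G) x) = 1 \<and> card (succs (parcs G) x) = 1 then insert x ?D else ?D)"
  proof -
    have lt: "\<nu> y < i + 1 \<longleftrightarrow> \<nu> y < i" if "y \<in> pverts G" "y \<noteq> x" for y
      using \<nu>_eq_iff[OF that(1) x(1)] x(2) that(2) by auto
    show ?thesis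
    proof (rule set_eqI)
      fix y
      show "y \<in> {y \<in> deg11 (parcs G) (pverts G). \<nu> y < i + 1} \<longleftrightarrow>
        y \<in> (if card (preds (parcs G) x) = 1 \<and> card (succs (parcs G) x) = 1 then insert x ?D else ?D)"
      proof (cases "y = x")
        case True
        then show ?thesis using x by (simp add: deg11_def)
      next
        case False
        then show ?thesis using lt[of y] by (cases "y \<in> pverts G") (simp_all add: deg11_def)
      qed
    qed
  qed
  have S: "stacked M1 {y \<in> deg11 (parcs G) (pverts G). \<nu> y < i + 1}"
    using P unfolding D' d .
  have M2: "sem \<alpha> stack_step M = M1(''i'' := (M1 ''i'')(0 := i + 1))"
    using I'(2) x(2) by (simp add: stack_step_def M1_def[symmetric] f)
  have "started (sem \<alpha> stack_step M)" unfolding M2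
    using I'(1) by (simp add: started_def loaded_def degrees_def f)
  moreover have "stacked (sem \<alpha> stack_step M) {y \<in> deg11 (parcs G) (pverts G). \<nu> y < i + 1}"
    using S by (simp add: M2 stacked_def)
  moreover have "sem \<alpha> stack_step M ''i'' 0 = i + 1" unfolding M2 by simp
  ultimately show ?thesis unfolding stack_inv_def by (intro conjI)
qed

lemma stack_triple:
  "triple \<alpha> (\<lambda>M. started M \<and> M ''i'' 0 = 0 \<and> M ''sp'' 0 = 0) (While (Less (rd ''i'') (rd ''n'')) stack_step)
    ((cost stack_step + 2) * n + 1) (stack_inv n)"
proof (rule triple_conseq[OF triple_While[where I = "\<lambda>k M. \<exists>i\<le>n. k = n - i \<and> stack_inv i M"]])
  show "loopfree_prog stack_step" by (simp add: stack_step_def push_def)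
  show "\<exists>i\<le>n. n = n - i \<and> stack_inv i M" if "started M \<and> M ''i'' 0 = 0 \<and> M ''sp'' 0 = 0" for M
    using that by (intro exI[of _ 0]) (simp add: stack_inv_def stacked_def)
next
  fix k M assume "\<exists>i\<le>n. k = n - i \<and> stack_inv i M" and b: "bval \<alpha> M (Less (rd ''i'') (rd ''n''))"
  then obtain i where i: "i \<le> n" "k = n - i" "stack_inv i M" by blast
  then have "M ''n'' 0 = n" "M ''i'' 0 = i" by (simp_all add: stack_inv_def started_def loaded_def input_simps)
  then have "i < n" using b by simp
  then show "\<exists>k'<k. \<exists>i\<le>n. k' = n - i \<and> stack_inv i (sem \<alpha> stack_step M)"
    using stack_inv_step[OF i(3)] i(2) by (intro exI[of _ "n - (i + 1)"] conjI exI[of _ "i + 1"]) simp_all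
next
  fix M assume a: "\<not> bval \<alpha> M (Less (rd ''i'') (rd ''n'')) \<and> (\<exists>k. \<exists>i\<le>n. k = n - i \<and> stack_inv i M)"
  then obtain i where i: "i \<le> n" "stack_inv i M" by blast
  then have "M ''n'' 0 = n" "M ''i'' 0 = i" by (simp_all add: stack_inv_def started_def loaded_def input_simps)
  then have "i = n" using a i(1) by simp
  then show "stack_inv n M" using i by simp
qed simp

text \<open>Initially no vertex is eliminated and every edge is a piece. The edges cover all
  vertices because a series-parallel graph has no isolated ones.\<close>

lemma forest_of_arcs: "forest G (pverts G) (Leaf ` parcs G)"
proof -
  obtain s t where st: "dsp s t G" using dspG .
  have e: "fst e \<in> pverts G \<and> snd e \<in> pverts G \<and> fst e \<noteq> snd e" if "e \<in> parcs G" for e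
  proof -
    obtain a b where ab: "e = (a, b)" by (cases e)
    have a: "(a, b) \<in> parcs G" using that ab by simp
    then show ?thesis using dsp_arcs_in_verts[OF st a] dsp_asym[OF st a] by (auto simp: ab)
  qed
  have "\<Union> (tverts ` Leaf ` parcs G) = pverts G" unfolding dsp_verts[OF st] by auto
  moreover have "\<Union> (tarcs ` Leaf ` parcs G) = parcs G" by auto
  moreover have "\<forall>X\<in>Leaf ` parcs G. sp_tree X \<and> clean X \<and> tverts X \<inter> pverts G = {tree_source X, tree_sink X}"
  proof
    fix X assume "X \<in> Leaf ` parcs G"
    then obtain e where "X = Leaf e" "e \<in> parcs G" by blast
    then show "sp_tree X \<and> clean X \<and> tverts X \<inter> pverts G = {tree_source X, tree_sink X}"
      using e[of e] by auto
  qed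
  moreover have "\<forall>X\<in>Leaf ` parcs G. \<forall>Y\<in>Leaf ` parcs G. X \<noteq> Y \<longrightarrow> tverts X \<inter> tverts Y \<subseteq> pverts G \<and> tarcs X \<inter> tarcs Y = {}"
  proof (intro ballI impI)
    fix X Y assume "X \<in> Leaf ` parcs G" "Y \<in> Leaf ` parcs G" "X \<noteq> Y"
    then obtain e f where "X = Leaf e" "Y = Leaf f" "e \<in> parcs G" "e \<noteq> f" by blast
    then show "tverts X \<inter> tverts Y \<subseteq> pverts G \<and> tarcs X \<inter> tarcs Y = {}" using e[of e] by auto
  qed
  ultimately show ?thesis unfolding forest_def by (intro conjI) assumption+
qed

lemma initial_reduction_inv:
  assumes I: "stack_inv n M"
  shows "reduction_inv M (map Leaf es) (Leaf ` parcs G) (pverts G)"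
proof -
  let ?P = "Leaf ` parcs G" and ?ts = "map Leaf es"
  obtain s t where st: "dsp s t G" using dspG .
  have I': "loaded m M" "M ''cnt'' 0 = m" "M ''u'' 0 = \<nu> (fst (es ! 0))" "M ''w'' 0 = \<nu> (snd (es ! 0))"
    "stacked M {x \<in> deg11 (parcs G) (pverts G). \<nu> x < n}" using I by (simp_all add: stack_inv_def started_def)
  have ends: "ends ` ?P = parcs G" by (force simp: ends_def)
  have "store es M ?ts" using I'(1) by (simp add: store_def loaded_def input_simps)
  moreover have "distinct ?ts" using es(1) by (simp add: distinct_map inj_on_def)
  moreover have "set ?ts = \<Union> (nodes ` ?P)" using es(2) by auto
  ultimately have "assembled es G M ?ts ?P (pverts G)"
    using I'(2) forest_of_arcs by (simp add: assembled_def)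
  moreover have "entry M ?ts ?P x y (index x y)" if xy: "x \<in> pverts G" "y \<in> pverts G" for x y
  proof -
    have comp: "M ''comp'' (index x y) = 0" using I'(1) by (simp add: loaded_def input_simps)
    have par: "parallels ?P x y = (if (x, y) \<in> parcs G then {Leaf (x, y)} else {})"
      by (auto simp: parallels_def ends_def)
    show ?thesis
    proof (cases "(x, y) \<in> parcs G")
      case True
      then have "(x, y) \<in> set es" using es(2) by simp
      then obtain j where j: "j < m" "es ! j = (x, y)" by (metis in_set_conv_nth)
      have "M ''leaf'' (index (fst (es ! j)) (snd (es ! j))) = j + 1" using I'(1) j(1) by (simp add: loaded_def)
      then have "M ''leaf'' (index x y) = j + 1" unfolding j(2) by simp
      then show ?thesis using comp par j True by (simp add: entry_def slot_def)
    next
      case False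
      then have "M ''leaf'' (index x y) = 0" using I'(1) xy es(2) by (simp add: loaded_def)
      then show ?thesis using comp par False by (simp add: entry_def slot_def)
    qed
  qed
  moreover have "{x \<in> deg11 (parcs G) (pverts G). \<nu> x < n} = deg11 (parcs G) (pverts G)"
    using \<nu>_less by (auto simp: deg11_def)
  moreover have "(fst (es ! 0), snd (es ! 0)) \<in> parcs G" using m_pos es(2) nth_mem[of 0 es] by simp
  moreover have "dsp s t \<lparr>pverts = pverts G, parcs = parcs G\<rparr>" by (rule dsp_cong[OF st]) simp_all
  moreover have "degrees M (parcs G) (pverts G)" using I'(1) es(2) by (simp add: loaded_def)
  moreover have "\<forall>i<n. M ''ofs'' i = i * n" "\<forall>j<m. M ''E'' j = 1" using I'(1) by (simp_all add: loaded_def)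
  ultimately show ?thesis unfolding reduction_inv_def ends using I'(3-5)
    by (intro conjI ballI exI[of _ s] exI[of _ t] exI[of _ "fst (es ! 0)"] exI[of _ "snd (es ! 0)"]) simp_all
qed

section \<open>The reduction loop and the finished tree\<close>

definition reduced :: "memory \<Rightarrow> bool" where
  "reduced M \<longleftrightarrow> \<not> 0 < M ''sp'' 0 \<and> (\<exists>ts P V. reduction_inv M ts P V)"

text \<open>The number of remaining vertices is the variant, hence at most \<open>n\<close>
  rounds.\<close>

lemma reduce_triple:
  "triple \<alpha> (stack_inv n) (While (Less (Const 0) (rd ''sp'')) reduce) ((cost reduce + 2) * n + 1) reduced"
proof (rule triple_conseq[OF triple_While[where
      I = "\<lambda>k M. \<exists>ts P V. k = card V \<and> reduction_inv M ts P V"]])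
  show "loopfree_prog reduce"
    by (simp add: reduce_def pop_def join_def second_def serial_def make_node_def update_degrees_def push_def absorb_def)
  show "\<exists>ts P V. n = card V \<and> reduction_inv M ts P V" if "stack_inv n M" for M
    using initial_reduction_inv[OF that] by blast
next
  fix k M assume "\<exists>ts P V. k = card V \<and> reduction_inv M ts P V" and b: "bval \<alpha> M (Less (Const 0) (rd ''sp''))"
  then obtain ts P V where I: "k = card V" "reduction_inv M ts P V" by blast
  have "0 < M ''sp'' 0" using b by simp
  from reduce_step[OF I(2) this] obtain ts' P' v
    where v: "v \<in> V" "reduction_inv (sem \<alpha> reduce M) ts' P' (V - {v})" by blast
  have "finite V" using I(2) finite_V by (simp add: reduction_inv_def)
  then have "card (V - {v}) < k" unfolding I(1) using v(1) by (rule card_Diff1_less)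
  then show "\<exists>k'<k. \<exists>ts P V. k' = card V \<and> reduction_inv (sem \<alpha> reduce M) ts P V" using v(2) by blast
next
  fix M assume "\<not> bval \<alpha> M (Less (Const 0) (rd ''sp'')) \<and> (\<exists>k ts P V. k = card V \<and> reduction_inv M ts P V)"
  then show "reduced M" by (auto simp: reduced_def)
qed simp

definition tree_built :: "memory \<Rightarrow> 'a sptree \<Rightarrow> 'a sptree list \<Rightarrow> bool" where
  "tree_built M T ts \<longleftrightarrow> clean_decomposition_tree G T \<and> store es M ts \<and> distinct ts \<and> set ts = nodes T \<and>
     M ''cnt'' 0 = length ts \<and> M ''root'' 0 < length ts \<and> ts ! M ''root'' 0 = T"

lemma finish_triple:
  "triple \<alpha> reduced finish (cost finish)
     (\<lambda>M. (\<exists>T ts. tree_built M T ts) \<and> (\<forall>j<m. M ''E'' j = 1) \<and> M ''i'' 0 = 0)"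
proof (rule triple_loopfree)
  show "loopfree_prog finish" by (simp add: finish_def join_def make_node_def)
  fix M assume "reduced M"
  then obtain ts P V where I: "reduction_inv M ts P V" and sp: "M ''sp'' 0 = 0" by (auto simp: reduced_def)
  let ?A = "ends ` P"
  from I have A: "assembled es G M ts P V" and VG: "V \<subseteq> pverts G"
    and E: "\<And>x y. x \<in> V \<Longrightarrow> y \<in> V \<Longrightarrow> entry M ts P x y (index x y)"
    and S: "stacked M (deg11 ?A V)" and ofs: "\<And>i. i < n \<Longrightarrow> M ''ofs'' i = i * n"
    and ones: "\<And>j. j < m \<Longrightarrow> M ''E'' j = 1"
    by (simp_all add: reduction_inv_def)
  from I obtain s t where st: "dsp s t \<lparr>pverts = V, parcs = ?A\<rparr>" by (auto simp: reduction_inv_def)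
  from I obtain x y where xy: "(x, y) \<in> ?A" "M ''u'' 0 = \<nu> x" "M ''w'' 0 = \<nu> y"
    unfolding reduction_inv_def by (elim conjE exE) (rule that)
  have "deg11 ?A V = {}" using S sp by (simp add: stacked_def)
  \<comment> \<open>With an empty stack no inner vertex is left, so the reduced graph is a single
    arc.\<close>
  have "?A = {(s, t)}"
  proof (rule ccontr)
    assume "?A \<noteq> {(s, t)}"
    then obtain u v w where i: "inner ?A u v w" using dsp_has_inner[OF st] by auto
    then have "v \<in> V" using inner_arcs[OF i] dsp_arcs_in_verts[OF st, of u v] by simp
    then have "v \<in> deg11 ?A V" using i by (simp add: deg11_def inner_def)
    then show False using \<open>deg11 ?A V = {}\<close> by simp
  qed
  then have A1: "?A = {(x, y)}" using xy(1) by simp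
  have V: "x \<in> V" "y \<in> V" using dsp_arcs_in_verts[OF st, of x y] xy(1) by simp_all
  have lt: "\<nu> x < n" using \<nu>_less V VG by blast
  define M1 where "M1 = sem \<alpha> (put ''k'' (cell ''u'' ''w'')) M"
  have M1: "M1 = M(''k'' := (M ''k'')(0 := index x y))" using xy ofs[OF lt] by (simp add: M1_def)
  have A1': "assembled es G M1 ts P V" using assembled_cong[OF A, of M1] by (simp add: M1)
  have E1: "entry M1 ts P x y (M1 ''k'' 0)" using E[OF V] by (simp add: M1 entry_def)
  have ne: "parallels P x y \<noteq> {}" using xy(1) by (auto simp: ends_image)
  define M2 where "M2 = sem \<alpha> join M1"
  obtain zs P2 X where A2: "assembled es G M2 (ts @ zs) P2 V" and X: "parallels P2 x y = {X}"
    and p2: "\<forall>x' y'. (x', y') \<noteq> (x, y) \<longrightarrow> parallels P2 x' y' = parallels P x' y'"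
    and r2: "M2 ''r'' 0 < length (ts @ zs)" "(ts @ zs) ! M2 ''r'' 0 = X"
    and f2_all: "\<forall>z. z \<notin> {''kind'', ''left'', ''right'', ''cnt'', ''r''} \<longrightarrow> M2 z = M1 z"
    using join_correct[OF A1' E1 ne M2_def] by (elim exE conjE) (rule that)
  note f2 = f2_all[rule_format]
  \<comment> \<open>All pieces run between the same two vertices, and \<open>join\<close> has left
    only one of them.\<close>
  have P2: "P2 = {X}"
  proof -
    have "ends Z = (x, y)" if "Z \<in> P2" for Z
    proof (rule ccontr)
      assume ne: "ends Z \<noteq> (x, y)"
      obtain a b where ab: "ends Z = (a, b)" by (cases "ends Z")
      then have "Z \<in> parallels P2 a b" using that by (simp add: parallels_def)
      then have "Z \<in> parallels P a b" using p2 ne ab by simp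
      then have "(a, b) \<in> ?A" unfolding ends_image by blast
      then show False using A1 ne ab by simp
    qed
    then have "P2 = parallels P2 x y" by (auto simp: parallels_def)
    then show ?thesis using X by simp
  qed
  define M3 where "M3 = sem \<alpha> finish M"
  have M3: "M3 = M2(''root'' := (M2 ''root'')(0 := M2 ''r'' 0), ''i'' := (M2 ''i'')(0 := 0))"
    unfolding M3_def finish_def sem.simps(2) M1_def[symmetric] M2_def[symmetric] by simp
  have a2: "store es M2 (ts @ zs)" "M2 ''cnt'' 0 = length (ts @ zs)" "distinct (ts @ zs)"
    "set (ts @ zs) = nodes X" "forest G V {X}" using A2 P2 by (simp_all add: assembled_def)
  have "clean_decomposition_tree G X"
    unfolding clean_decomposition_tree_def
    using forestD(1,2,6,7)[OF a2(5), simplified] pair_pre_digraph_eqI[of "tree_graph X" G] by simp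
  moreover have "store es M3 (ts @ zs)" by (rule store_cong[OF a2(1)]) (simp_all add: M3)
  moreover have "M3 ''cnt'' 0 = length (ts @ zs)" using a2(2) by (simp add: M3)
  moreover have "M3 ''root'' 0 = M2 ''r'' 0" "M3 ''i'' 0 = 0" by (simp_all add: M3)
  moreover have "\<forall>j<m. M3 ''E'' j = 1" using ones by (simp add: M3 f2 M1)
  ultimately have "tree_built M3 X (ts @ zs)" "\<forall>j<m. M3 ''E'' j = 1" "M3 ''i'' 0 = 0"
    using a2(3,4) r2 by (simp_all only: tree_built_def simp_thms)
  then show "(\<exists>T ts. tree_built (sem \<alpha> finish M) T ts) \<and> (\<forall>j<m. sem \<alpha> finish M ''E'' j = 1) \<and> sem \<alpha> finish M ''i'' 0 = 0"
    unfolding M3_def by blast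
qed

text \<open>The bounds of the phases, nested in the way in which \<open>triple_Seq\<close> combines
  them.\<close>

definition build_cost :: nat where
  "build_cost = ((cost offsets_step + 2) * n + 1) + 1 + (cost (put ''i'' (Const 0)) + 1 +
     (((cost load_step + 2) * m + 1) + 1 + (cost start_stack + 1 + (((cost stack_step + 2) * n + 1) + 1 +
     (((cost reduce + 2) * n + 1) + 1 + cost finish)))))"

lemma build_triple:
  "triple \<alpha> (\<lambda>M. M = inp) build build_cost
     (\<lambda>M. (\<exists>T ts. tree_built M T ts) \<and> (\<forall>j<m. M ''E'' j = 1) \<and> M ''i'' 0 = 0)"
  unfolding build_def build_cost_def
proof (rule triple_Seq[OF offsets_triple triple_Seq[OF _ triple_Seq[OF load_triple triple_Seq[OF start_stack_triple
      triple_Seq[OF stack_triple triple_Seq[OF reduce_triple finish_triple]]]]]], rule triple_loopfree)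
  show "loopfree_prog (put ''i'' (Const 0))" by simp
  fix M assume M: "(\<forall>j\<le>n. M ''ofs'' j = j * n) \<and> (\<forall>z. z \<notin> {''ofs'', ''i''} \<longrightarrow> M z = inp z)"
  then show "loaded 0 (sem \<alpha> (put ''i'' (Const 0)) M) \<and> sem \<alpha> (put ''i'' (Const 0)) M ''i'' 0 = 0 \<and>
      sem \<alpha> (put ''i'' (Const 0)) M ''sp'' 0 = 0"
    by (simp add: loaded_def degrees_def preds_def succs_def input_simps)
qed

end

section \<open>The removal loop\<close>

text \<open>\<open>lam\<close> and \<open>ret\<close> hold for every record the flow between its
  terminals inside the node, in the input graph and in the retained edges. At an S-node both are
  minima.\<close>

definition evaluate_series :: program where
  "evaluate_series =
     Seq (Cond (Less (Read ''lam'' (rd ''a'')) (Read ''lam'' (rd ''b'')))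
       (Write ''lam'' (rd ''i'') (Read ''lam'' (rd ''a''))) (Write ''lam'' (rd ''i'') (Read ''lam'' (rd ''b''))))
     (Cond (Less (Read ''ret'' (rd ''a'')) (Read ''ret'' (rd ''b'')))
       (Write ''ret'' (rd ''i'') (Read ''ret'' (rd ''a''))) (Write ''ret'' (rd ''i'') (Read ''ret'' (rd ''b''))))"

text \<open>Children are swapped if necessary so that a leaf becomes the second one.\<close>

definition evaluate_parallel :: program where
  "evaluate_parallel =
     Seq (Cond (Less (Read ''kind'' (rd ''a'')) (Const 1))
       (Seq (put ''a'' (rd ''b'')) (put ''b'' (Read ''left'' (rd ''i'')))) Skip)
     (Seq (Write ''lam'' (rd ''i'') (Plus (Read ''lam'' (rd ''a'')) (Read ''lam'' (rd ''b''))))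
     (Cond (And (Less (Read ''kind'' (rd ''b'')) (Const 1))
           (AtLeastAlpha (Read ''ret'' (rd ''a'')) (Read ''lam'' (rd ''i''))))
       (Seq (Write ''E'' (Read ''left'' (rd ''b'')) (Const 0)) (Write ''ret'' (rd ''i'') (Read ''ret'' (rd ''a''))))
       (Write ''ret'' (rd ''i'') (Plus (Read ''ret'' (rd ''a'')) (Read ''ret'' (rd ''b''))))))"

definition remove_step :: program where
  "remove_step =
     Seq (put ''a'' (Read ''left'' (rd ''i'')))
     (Seq (put ''b'' (Read ''right'' (rd ''i'')))
     (Seq (Cond (Less (Read ''kind'' (rd ''i'')) (Const 1))
         (Seq (Write ''lam'' (rd ''i'') (Const 1)) (Write ''ret'' (rd ''i'') (Const 1)))
         (Cond (Less (Read ''kind'' (rd ''i'')) (Const 2)) evaluate_series evaluate_parallel))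
     (increment ''i'' (Const 0))))"

definition algorithm :: program where
  "algorithm = Seq build (While (Less (rd ''i'') (rd ''cnt'')) remove_step)"

lemma holds_edges_remove:
  assumes "holds_edges es M F" "distinct es" "j < length es"
    "M' ''E'' = (M ''E'')(j := 0)"
  shows "holds_edges es M' (F - {es ! j})"
  using assms nth_eq_iff_index_eq[OF assms(2)] unfolding holds_edges_def by auto

locale removal = encoded_graph G \<nu> es \<alpha> + clean_tree T \<alpha>
  for G :: "'a pair_pre_digraph" and \<nu> es \<alpha> and T :: "'a sptree" +
  fixes ts :: "'a sptree list"
  assumes tree: "tree_graph T = G" and ts: "distinct ts" "set ts = nodes T"
begin

text \<open>The value \<open>ret\<close> of a leaf is 1 even after its edge has been removed. It is
  read only when the parent is processed, and until then the edge is present.\<close>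

definition removal_inv :: "nat \<Rightarrow> memory \<Rightarrow> bool" where
  "removal_inv k M \<longleftrightarrow> store es M ts \<and> M ''cnt'' 0 = length ts \<and> M ''i'' 0 = k \<and>
     M ''root'' 0 < length ts \<and> ts ! M ''root'' 0 = T \<and>
     holds_edges es M (retained (take k ts)) \<and>
     (\<forall>j<k. M ''lam'' j = tflow (tarcs T) (ts ! j)) \<and>
     (\<forall>j<k. M ''ret'' j = (if \<exists>e. ts ! j = Leaf e then 1 else tflow (retained (take k ts)) (ts ! j)))"

context
  fixes M :: memory and k :: nat
  assumes I: "removal_inv k M" and k: "k < length ts"
begin

lemma store_M: "store es M ts"
  using I by (simp add: removal_inv_def)

lemma ts_bottom_up: "bottom_up T ts"
  using store_bottom_up[OF store_M ts] .

lemma prefix: "bottom_up_prefix (take j ts)"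
  unfolding bottom_up_prefix_def
proof
  show "set (take j ts) \<subseteq> nodes T" using ts(2) set_take_subset[of j ts] by simp
  have "sorted_wrt (\<lambda>\<sigma> \<tau>. \<tau> \<notin> nodes \<sigma>) ts" using ts_bottom_up by (simp add: bottom_up_def)
  then show "sorted_wrt (\<lambda>\<sigma> \<tau>. \<tau> \<notin> nodes \<sigma>) (take j ts)" by (rule sorted_wrt_take)
qed

lemma take_Suc: "take (Suc k) ts = take k ts @ [ts ! k]"
  using take_Suc_conv_app_nth[OF k] .

lemma node_k: "ts ! k \<in> nodes T" "ts ! k \<notin> set (take k ts)"
proof -
  show "ts ! k \<in> nodes T" using nth_mem[OF k] ts(2) by simp
  have "distinct (take k ts @ [ts ! k])" using distinct_take[OF ts(1), of "Suc k"] unfolding take_Suc .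
  then show "ts ! k \<notin> set (take k ts)" by simp
qed

lemma retained_Suc:
  "retained (take (Suc k) ts) = retained (take k ts) - {e. removable (retained (take k ts)) (ts ! k) e}"
  unfolding take_Suc by (rule retained_snoc[OF node_k(1) retained_subset[OF prefix]])

text \<open>Stored flows of inner nodes stay valid, since processing a node removes nothing from the
  inner nodes before it.\<close>

lemma retained_older:
  assumes "j < k" "\<And>e. ts ! j \<noteq> Leaf e"
  shows "tflow (retained (take (Suc k) ts)) (ts ! j) = tflow (retained (take k ts)) (ts ! j)"
proof -
  have "ts ! j \<in> set (take k ts)" using assms(1) k by (auto simp: in_set_conv_nth)
  from retained_stable[OF _ this assms(2)] show ?thesis
    using prefix[of "Suc k"] unfolding take_Suc by simp
qed

lemma leaf_child_retained: "leaf_parent e (ts ! k) \<Longrightarrow> e \<in> retained (take k ts)"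
  using leaf_retained[OF prefix node_k(1)] node_k(2) by blast

lemma child_value:
  assumes "j < k" "\<And>e. ts ! j = Leaf e \<Longrightarrow> leaf_parent e (ts ! k)" "sp_tree (ts ! j)"
  shows "M ''ret'' j = tflow (retained (take k ts)) (ts ! j)"
proof (cases "\<exists>e. ts ! j = Leaf e")
  case True
  then obtain e where e: "ts ! j = Leaf e" by blast
  have "M ''ret'' j = 1" using I assms(1) True by (simp add: removal_inv_def)
  moreover have "e \<in> retained (take k ts)" using leaf_child_retained assms(2)[OF e] .
  moreover have "sp_tree (Leaf e)" using assms(3) e by simp
  ultimately show ?thesis unfolding e using tflow_Leaf[of e "retained (take k ts)"] by (simp only: if_True)
next
  case False
  then show ?thesis using I assms(1) by (simp add: removal_inv_def)
qed

lemma child_lam: "j < k \<Longrightarrow> M ''lam'' j = tflow (tarcs T) (ts ! j)"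
  using I by (simp add: removal_inv_def)

lemma removal_inv_SucI:
  assumes M': "M' ''kind'' = M ''kind''" "M' ''left'' = M ''left''" "M' ''right'' = M ''right''" "M' ''cnt'' = M ''cnt''"
      "M' ''root'' = M ''root''" "M' ''i'' 0 = Suc k"
    and lam: "M' ''lam'' = (M ''lam'')(k := tflow (tarcs T) (ts ! k))"
    and ret: "M' ''ret'' = (M ''ret'')(k := r)"
    and r: "if \<exists>e. ts ! k = Leaf e then r = 1 else r = tflow (retained (take (Suc k) ts)) (ts ! k)"
    and E: "holds_edges es M' (retained (take (Suc k) ts))"
  shows "removal_inv (Suc k) M'"
  unfolding removal_inv_def
proof (intro conjI allI impI)
  show "store es M' ts" by (rule store_cong[OF store_M M'(1-3)])
  show "M' ''cnt'' 0 = length ts" "M' ''root'' 0 < length ts" "ts ! M' ''root'' 0 = T"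
    using I M'(4,5) by (simp_all add: removal_inv_def)
  show "M' ''lam'' j = tflow (tarcs T) (ts ! j)" if "j < Suc k" for j
    using child_lam[of j] that lam by (cases "j = k") simp_all
  show "M' ''ret'' j = (if \<exists>e. ts ! j = Leaf e then 1 else tflow (retained (take (Suc k) ts)) (ts ! j))"
    if j: "j < Suc k" for j
  proof (cases "j = k")
    case True
    then show ?thesis using r ret by (simp split: if_splits)
  next
    case False
    then have "j < k" using j by simp
    then have "M' ''ret'' j = (if \<exists>e. ts ! j = Leaf e then 1 else tflow (retained (take k ts)) (ts ! j))"
      using I ret by (simp add: removal_inv_def)
    then show ?thesis using retained_older[OF \<open>j < k\<close>] by (cases "\<exists>e. ts ! j = Leaf e") auto
  qed
qed (fact M'(6) E)+

lemma holds_edges_cong: "holds_edges es M F \<Longrightarrow> M' ''E'' = M ''E'' \<Longrightarrow> holds_edges es M' F"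
  by (simp add: holds_edges_def)

lemma edges_k: "holds_edges es M (retained (take k ts))"
  using I by (simp add: removal_inv_def)

lemma i_k: "M ''i'' 0 = k"
  using I by (simp add: removal_inv_def)

lemma unchanged: "(\<And>e. \<not> candidate (ts ! k) e) \<Longrightarrow> retained (take (Suc k) ts) = retained (take k ts)"
  using retained_Suc by (simp add: removable_def)

lemma remove_step_leaf:
  assumes n: "ts ! k = Leaf e"
  shows "removal_inv (Suc k) (sem \<alpha> remove_step M)"
proof -
  have kind: "M ''kind'' k = 0" using storeD(1)[OF store_M k n] by simp
  have sp: "sp_tree (Leaf e)" using sp_node[OF node_k(1)] n by simp
  have eT: "e \<in> tarcs T" using node_sub(1)[OF node_k(1)] n by simp
  have un: "retained (take (Suc k) ts) = retained (take k ts)" by (rule unchanged) (simp add: candidate_def n)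
  have M': "sem \<alpha> remove_step M = M(''a'' := (M ''a'')(0 := M ''left'' k), ''b'' := (M ''b'')(0 := M ''right'' k),
    ''lam'' := (M ''lam'')(k := 1), ''ret'' := (M ''ret'')(k := 1), ''i'' := (M ''i'')(0 := Suc k))"
    using kind i_k by (simp add: remove_step_def)
  have one: "tflow (tarcs T) (ts ! k) = 1" unfolding n using tflow_Leaf[OF sp, of "tarcs T"] eT by simp
  show ?thesis
  proof (rule removal_inv_SucI[where r = 1])
    show "holds_edges es (sem \<alpha> remove_step M) (retained (take (Suc k) ts))"
      unfolding un by (rule holds_edges_cong[OF edges_k]) (simp add: M')
    show "sem \<alpha> remove_step M ''lam'' = (M ''lam'')(k := tflow (tarcs T) (ts ! k))" unfolding one by (simp add: M')
  qed (simp_all add: M' n)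
qed

lemma remove_step_series:
  assumes n: "ts ! k = Ser l r"
  shows "removal_inv (Suc k) (sem \<alpha> remove_step M)"
proof -
  let ?a = "M ''left'' k" and ?b = "M ''right'' k"
  have D: "M ''kind'' k = 1" "?a < k" "?b < k" "ts ! ?a = l" "ts ! ?b = r"
    using storeD(2)[OF store_M k n] by simp_all
  have sps: "sp_tree (Ser l r)" using sp_node[OF node_k(1)] n by simp
  then have spl: "sp_tree l" "sp_tree r" by simp_all
  have un: "retained (take (Suc k) ts) = retained (take k ts)" by (rule unchanged) (simp add: candidate_def n)
  have ret: "M ''ret'' ?a = tflow (retained (take k ts)) l" "M ''ret'' ?b = tflow (retained (take k ts)) r"
    using child_value[OF D(2)] child_value[OF D(3)] spl n D(4,5) by simp_all
  have lam: "M ''lam'' ?a = tflow (tarcs T) l" "M ''lam'' ?b = tflow (tarcs T) r"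
    using child_lam[OF D(2)] child_lam[OF D(3)] D(4,5) by simp_all
  have M': "sem \<alpha> remove_step M = M(''a'' := (M ''a'')(0 := ?a), ''b'' := (M ''b'')(0 := ?b),
    ''lam'' := (M ''lam'')(k := min (M ''lam'' ?a) (M ''lam'' ?b)),
    ''ret'' := (M ''ret'')(k := min (M ''ret'' ?a) (M ''ret'' ?b)), ''i'' := (M ''i'')(0 := Suc k))"
    using D(1) i_k by (simp add: remove_step_def evaluate_series_def min_def)
  show ?thesis
  proof (rule removal_inv_SucI)
    show "holds_edges es (sem \<alpha> remove_step M) (retained (take (Suc k) ts))"
      unfolding un by (rule holds_edges_cong[OF edges_k]) (simp add: M')
    show "sem \<alpha> remove_step M ''lam'' = (M ''lam'')(k := tflow (tarcs T) (ts ! k))"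
      unfolding n tflow_Ser[OF sps] lam[symmetric] by (simp add: M')
    show "sem \<alpha> remove_step M ''ret'' = (M ''ret'')(k := min (M ''ret'' ?a) (M ''ret'' ?b))" by (simp add: M')
    show "if \<exists>e. ts ! k = Leaf e then min (M ''ret'' ?a) (M ''ret'' ?b) = 1
      else min (M ''ret'' ?a) (M ''ret'' ?b) = tflow (retained (take (Suc k) ts)) (ts ! k)"
      unfolding n un tflow_Ser[OF sps] ret by simp
  qed (simp_all add: M')
qed

lemma remove_step_parallel:
  assumes n: "ts ! k = Par l r"
  shows "removal_inv (Suc k) (sem \<alpha> remove_step M)"
proof -
  let ?E = "retained (take k ts)"
  have D: "M ''kind'' k = 2" "M ''left'' k < k" "M ''right'' k < k" "ts ! M ''left'' k = l" "ts ! M ''right'' k = r"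
    using storeD(3)[OF store_M k n] by simp_all
  have node: "Par l r \<in> nodes T" using node_k(1) n by simp
  have sps: "sp_tree (Par l r)" "clean (Par l r)" using sp_node[OF node] clean_node[OF node] by blast+
  then have spl: "sp_tree l" "sp_tree r" by simp_all
  have kind0: "M ''kind'' j = 0 \<longleftrightarrow> (\<exists>e. ts ! j = Leaf e)" if "j < k" for j
    using storeD[OF store_M, of j] that k by (cases "ts ! j") auto
  \<comment> \<open>Two leaves with common terminals would be the same edge twice.\<close>
  have not_both: "\<not> (\<exists>e f. l = Leaf e \<and> r = Leaf f)"
  proof (intro notI, elim exE conjE)
    fix e f assume "l = Leaf e" "r = Leaf f"
    then show False using sps(1) by (cases e; cases f) auto
  qed
  \<comment> \<open>The addresses of the children after the possible swap; \<open>a\<close> never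
    refers to a leaf.\<close>
  define a where "a = (if M ''kind'' (M ''left'' k) = 0 then M ''right'' k else M ''left'' k)"
  define b where "b = (if M ''kind'' (M ''left'' k) = 0 then M ''left'' k else M ''right'' k)"
  have ab: "a < k" "b < k" using D by (simp_all add: a_def b_def)
  have abn: "ts ! a = l \<and> ts ! b = r \<or> ts ! a = r \<and> ts ! b = l" using D by (simp add: a_def b_def)
  have a_inner: "ts ! a \<noteq> Leaf e" for e
  proof (cases "M ''kind'' (M ''left'' k) = 0")
    case True
    then obtain f where "l = Leaf f" using kind0[OF D(2)] D(4) by metis
    then have "r \<noteq> Leaf e" using not_both by metis
    then show ?thesis using True D(5) by (simp add: a_def)
  next
    case False
    then have "\<not> (\<exists>e. ts ! M ''left'' k = Leaf e)" unfolding kind0[OF D(2)] .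
    then show ?thesis unfolding a_def if_not_P[OF False] by metis
  qed
  have b_inner: "l \<noteq> Leaf e \<and> r \<noteq> Leaf e" if "\<not> (\<exists>e. ts ! b = Leaf e)" for e
    using that abn a_inner by metis
  have spab: "sp_tree (ts ! a)" "sp_tree (ts ! b)" using abn spl by auto
  have par: "leaf_parent e (ts ! k)" if "ts ! a = Leaf e \<or> ts ! b = Leaf e" for e
    using that abn unfolding n by auto
  have ret: "M ''ret'' a = tflow ?E (ts ! a)" "M ''ret'' b = tflow ?E (ts ! b)"
    using child_value[OF ab(1) _ spab(1)] child_value[OF ab(2) _ spab(2)] par by blast+
  have sum: "tflow F (Par l r) = tflow F (ts ! a) + tflow F (ts ! b)" for F
    unfolding tflow_Par[OF sps(1)] using abn by auto
  have lam: "M ''lam'' a + M ''lam'' b = tflow (tarcs T) (Par l r)"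
    unfolding sum child_lam[OF ab(1)] child_lam[OF ab(2)] ..
  \<comment> \<open>The condition evaluated by the program: the sum is the flow of the graph at this
    node, and \<open>ret\<close> of the child \<open>a\<close> is what is left without a leaf as the
    other child.\<close>
  let ?c = "M ''kind'' b = 0 \<and> \<alpha> * real (M ''lam'' a + M ''lam'' b) \<le> real (M ''ret'' a)"
  let ?r = "if ?c then M ''ret'' a else M ''ret'' a + M ''ret'' b"
  let ?M1 = "M(''a'' := (M ''a'')(0 := a), ''b'' := (M ''b'')(0 := b),
    ''lam'' := (M ''lam'')(k := M ''lam'' a + M ''lam'' b))"
  have M': "sem \<alpha> remove_step M = (if ?c
      then ?M1(''E'' := (M ''E'')(M ''left'' b := 0), ''ret'' := (M ''ret'')(k := ?r), ''i'' := (M ''i'')(0 := Suc k))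
      else ?M1(''ret'' := (M ''ret'')(k := ?r), ''i'' := (M ''i'')(0 := Suc k)))"
    using D(1) i_k ab by (simp add: remove_step_def evaluate_parallel_def a_def b_def)
  have new: "retained (take (Suc k) ts) = ?E - {e. removable ?E (Par l r) e}" using retained_Suc n by simp
  have main: "?r = tflow (retained (take (Suc k) ts)) (Par l r) \<and>
    holds_edges es (sem \<alpha> remove_step M) (retained (take (Suc k) ts))"
  proof (cases "M ''kind'' b = 0")
    case False
    then have "\<not> (\<exists>e. ts ! b = Leaf e)" using kind0[OF ab(2)] by simp
    then have "\<not> leaf_parent e (Par l r)" for e using b_inner by simp
    then have "\<not> candidate (Par l r) e" for e using candidate_iff[OF sps] by blast
    then have un: "retained (take (Suc k) ts) = ?E" using new by (simp add: removable_def)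
    have "holds_edges es (sem \<alpha> remove_step M) ?E"
      by (rule holds_edges_cong[OF edges_k]) (use False in \<open>simp add: M'\<close>)
    then show ?thesis unfolding un sum using False ret by simp
  next
    case True
    then obtain e where e: "ts ! b = Leaf e" using kind0[OF ab(2)] by blast
    have c: "l = Leaf e \<and> ts ! a = r \<or> r = Leaf e \<and> ts ! a = l" using abn e by auto
    note R = removable_par_iff(1,2)[OF HOL.refl node c] and R3 = removable_par_iff(3)[OF HOL.refl node c]
    have eE: "e \<in> ?E" using leaf_child_retained par e by blast
    have le: "M ''left'' b < m" "es ! M ''left'' b = e"
      using storeD(1)[OF store_M _ e] ab(2) k by simp_all
    have test: "?c \<longleftrightarrow> \<alpha> * real (tflow (tarcs T) (ts ! a) + 1) \<le> tflow ?E (ts ! a)"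
      using True lam R3 ret(1) by simp
    show ?thesis
    proof (cases ?c)
      case True
      then have un: "retained (take (Suc k) ts) = ?E - {e}" using new R(1)[of ?E] test by simp
      have "tflow (?E - {e}) (ts ! a) = tflow ?E (ts ! a)"
        using retained_older[OF ab(1) a_inner] unfolding un .
      then have "?r = tflow (?E - {e}) (Par l r)" using R(2)[of "?E - {e}"] True ret(1) by simp
      moreover have "holds_edges es (sem \<alpha> remove_step M) (?E - {es ! M ''left'' b})"
        by (rule holds_edges_remove[OF edges_k es(1) le(1)]) (use True in \<open>simp add: M'\<close>)
      ultimately show ?thesis unfolding un le(2) by blast
    next
      case False
      then have "\<not> removable ?E (Par l r) f" for f unfolding test using R(1)[of ?E] by metis
      then have un: "retained (take (Suc k) ts) = ?E" unfolding new by blast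
      have "holds_edges es (sem \<alpha> remove_step M) ?E"
        by (rule holds_edges_cong[OF edges_k]) (simp only: M' if_not_P[OF False], simp)
      then show ?thesis unfolding un sum if_not_P[OF False] using ret by simp
    qed
  qed
  show ?thesis
  proof (rule removal_inv_SucI)
    show "holds_edges es (sem \<alpha> remove_step M) (retained (take (Suc k) ts))" using main by blast
    show "sem \<alpha> remove_step M ''lam'' = (M ''lam'')(k := tflow (tarcs T) (ts ! k))"
      unfolding n lam[symmetric] by (simp add: M')
    show "sem \<alpha> remove_step M ''ret'' = (M ''ret'')(k := ?r)" by (simp add: M')
    show "if \<exists>e. ts ! k = Leaf e then ?r = 1 else ?r = tflow (retained (take (Suc k) ts)) (ts ! k)"
      unfolding n using main by simp
  qed (simp_all add: M')
qed

lemma remove_step_correct: "removal_inv (Suc k) (sem \<alpha> remove_step M)"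
  using remove_step_leaf remove_step_series remove_step_parallel by (cases "ts ! k") blast+

end

lemma removal_loop:
  assumes I0: "removal_inv 0 M"
  shows "\<exists>\<theta>. (\<forall>k<length ts. \<theta> k < \<theta> (Suc k)) \<and>
    \<theta> (length ts) \<le> (cost remove_step + 2) * length ts + 1 \<and>
    (\<forall>k\<le>length ts. \<exists>c M'. reaches \<alpha> (\<theta> k) (While (Less (rd ''i'') (rd ''cnt'')) remove_step, M) (c, M') \<and>
      removal_inv k M' \<and> (k = length ts \<longrightarrow> c = Skip))"
proof -
  let ?N = "length ts" and ?p = "Less (rd ''i'') (rd ''cnt'')"
  define mem where "mem k = (sem \<alpha> remove_step ^^ k) M" for k
  have inv: "k \<le> ?N \<Longrightarrow> removal_inv k (mem k)" for k
  proof (induction k)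
    case 0
    show ?case using I0 by (simp add: mem_def)
  next
    case (Suc k)
    then have "removal_inv k (mem k)" "k < ?N" by simp_all
    then show ?case using remove_step_correct by (simp add: mem_def)
  qed
  have guard: "bval \<alpha> (mem k) ?p \<longleftrightarrow> k < ?N" if "k \<le> ?N" for k
    using inv[OF that] by (simp add: removal_inv_def)
  have "loopfree_prog remove_step" by (simp add: remove_step_def evaluate_series_def evaluate_parallel_def)
  from while_trace[OF this, of ?N \<alpha> mem ?p] guard obtain \<theta> where
    \<theta>: "\<forall>k<?N. \<theta> k < \<theta> (Suc k) \<and> reaches \<alpha> (\<theta> k) (While ?p remove_step, mem 0) (While ?p remove_step, mem k)"
    "\<theta> ?N \<le> (cost remove_step + 2) * ?N + 1"
    "reaches \<alpha> (\<theta> ?N) (While ?p remove_step, mem 0) (Skip, mem ?N)"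
    by (auto simp: mem_def)
  have "\<exists>c M'. reaches \<alpha> (\<theta> k) (While ?p remove_step, M) (c, M') \<and> removal_inv k M' \<and> (k = ?N \<longrightarrow> c = Skip)"
    if k: "k \<le> ?N" for k
  proof (cases "k = ?N")
    case True
    then show ?thesis using \<theta>(3) inv[OF k] by (intro exI[of _ Skip] exI[of _ "mem k"]) (simp add: mem_def)
  next
    case False
    then show ?thesis using \<theta>(1) inv[OF k] k
      by (intro exI[of _ "While ?p remove_step"] exI[of _ "mem k"]) (simp add: mem_def)
  qed
  then show ?thesis using \<theta>(1,2) by blast
qed

end

section \<open>The linear time bound and the theorem\<close>

lemma linear_bound:
  fixes n :: nat
  assumes "m \<le> 2 * n" "N \<le> 4 * n" "1 \<le> n"
  shows "a * n + b * m + c * n + d * n + e * N + k \<le> (a + 2 * b + c + d + 4 * e + k) * n"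
proof -
  have "b * m \<le> b * (2 * n)" "e * N \<le> e * (4 * n)" "k * 1 \<le> k * n"
    by (rule mult_le_mono2[OF assms(1)], rule mult_le_mono2[OF assms(2)], rule mult_le_mono2[OF assms(3)])
  moreover have "(a + 2 * b + c + d + 4 * e + k) * n = a * n + b * (2 * n) + c * n + d * n + e * (4 * n) + k * n"
    by (simp add: algebra_simps)
  ultimately show ?thesis by linarith
qed

text \<open>The factors 2 and 4 stem from the bounds \<open>2n\<close> on the edges and
  \<open>4n\<close> on the tree nodes. The summand 20 generously covers the exits of the loops and
  the transitions between the phases.\<close>

definition time_factor :: nat where
  "time_factor = (cost offsets_step + 2) + 2 * (cost load_step + 2) + (cost stack_step + 2) + (cost reduce + 2) +
     4 * (cost remove_step + 2) + (cost start_stack + cost finish + 20)"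

lemma algorithm_runs:
  assumes dsp: "directed_series_parallel G" and \<alpha>: "0 < \<alpha>" "\<alpha> < 1" and enc: "graph_encoding G \<nu> es"
  shows "executes_algorithm_within \<alpha> G \<nu> es algorithm (time_factor * card (pverts G))"
proof -
  interpret encoded_graph G \<nu> es \<alpha> using dsp enc by unfold_locales
  let ?W = "While (Less (rd ''i'') (rd ''cnt'')) remove_step"
  obtain M0 k0 T ts where k0: "k0 \<le> build_cost" "exec \<alpha> build inp k0 M0" and B: "tree_built M0 T ts"
    and E: "\<forall>j<m. M0 ''E'' j = 1" and i: "M0 ''i'' 0 = 0"
    using build_triple unfolding triple_def by blast
  have T: "clean_decomposition_tree G T" "store es M0 ts" "distinct ts" "set ts = nodes T"
    "M0 ''cnt'' 0 = length ts" "M0 ''root'' 0 < length ts" "ts ! M0 ''root'' 0 = T"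
    using B by (simp_all add: tree_built_def)
  then have T': "sp_tree T" "clean T" "tree_graph T = G" by (simp_all add: clean_decomposition_tree_def)
  interpret removal G \<nu> es \<alpha> T ts
    by unfold_locales (use T' T(3,4) \<alpha> in simp_all)
  have bu: "bottom_up T ts" using store_bottom_up[OF T(2,3,4)] .
  have "removal_inv 0 M0"
  proof -
    have "holds_edges es M0 (tarcs T)" using E es(2) T'(3) by (auto simp: holds_edges_def)
    then show ?thesis using T(2,5-7) i by (simp add: removal_inv_def retained_Nil)
  qed
  from removal_loop[OF this] obtain \<theta> where
    \<theta>: "\<forall>k<length ts. \<theta> k < \<theta> (Suc k)" "\<theta> (length ts) \<le> (cost remove_step + 2) * length ts + 1"
    and loop: "\<forall>k\<le>length ts. \<exists>c M'. reaches \<alpha> (\<theta> k) (?W, M0) (c, M') \<and> removal_inv k M' \<and>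
      (k = length ts \<longrightarrow> c = Skip)" by (elim exE conjE) (rule that)
  \<comment> \<open>One step beyond the \<open>k0\<close> steps of \<open>build\<close> passes
    control to the removal loop.\<close>
  define \<theta>' where "\<theta>' k = Suc k0 + \<theta> k" for k
  have state: "\<exists>c M'. run \<alpha> algorithm inp (\<theta>' k) = (c, M') \<and> removal_inv k M' \<and> (k = length ts \<longrightarrow> c = Skip)"
    if k: "k \<le> length ts" for k
  proof -
    obtain c M' where c: "reaches \<alpha> (\<theta> k) (?W, M0) (c, M')" "removal_inv k M'" "k = length ts \<longrightarrow> c = Skip"
      using loop k by blast
    have "reaches \<alpha> (\<theta>' k) (algorithm, inp) (c, M')"
      unfolding \<theta>'_def algorithm_def by (rule reaches_trans[OF reaches_continuation[OF k0(2)] c(1)])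
    then have "run \<alpha> algorithm inp (\<theta>' k) = (c, M')" unfolding run_def by (rule reaches_funpow)
    then show ?thesis using c(2,3) by blast
  qed
  have "\<theta>' (length ts) \<le> time_factor * n"
  proof -
    obtain s t where st: "dsp s t G" using dspG .
    have "m = card (parcs G)" using es distinct_card by metis
    then have mn: "m \<le> 2 * n" using dsp_few_arcs[OF st] by simp
    have "length ts = card (nodes T)" using T(3,4) distinct_card by metis
    then have "length ts \<le> 2 * card (tarcs T)" using card_nodes[OF T'(1)] by simp
    then have Nn: "length ts \<le> 4 * n" using mn \<open>m = card (parcs G)\<close> T'(3) by simp
    have "n \<noteq> 0" using dsp_basic(1,4)[OF st] by auto
    then have "1 \<le> n" by simp
    note bound = linear_bound[OF mn Nn this, of "cost offsets_step + 2" "cost load_step + 2" "cost stack_step + 2"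
        "cost reduce + 2" "cost remove_step + 2" "cost start_stack + cost finish + 20"]
    have "\<theta>' (length ts) \<le> Suc build_cost + ((cost remove_step + 2) * length ts + 1)"
      unfolding \<theta>'_def using k0(1) \<theta>(2) by (intro add_mono) simp_all
    also have "\<dots> \<le> (cost offsets_step + 2) * n + (cost load_step + 2) * m + (cost stack_step + 2) * n +
      (cost reduce + 2) * n + (cost remove_step + 2) * length ts + (cost start_stack + cost finish + 20)"
      unfolding build_cost_def by simp
    also have "\<dots> \<le> time_factor * n" using bound unfolding time_factor_def .
    finally show ?thesis .
  qed
  moreover have "let M = snd (run \<alpha> algorithm inp (\<theta>' k)) in
      holds_tree es M T (M ''root'' 0) \<and> holds_edges es M (retained_edges \<alpha> G (take k ts))"
    if k: "k \<le> length ts" for k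
  proof -
    obtain c M' where c: "run \<alpha> algorithm inp (\<theta>' k) = (c, M')" "removal_inv k M'" using state[OF k] by blast
    have S: "store es M' ts" "M' ''root'' 0 < length ts" "ts ! M' ''root'' 0 = T"
      "holds_edges es M' (retained (take k ts))" using c(2) by (simp_all add: removal_inv_def)
    have "holds_tree es M' T (M' ''root'' 0)" using store_holds_tree[OF S(1,2)] S(3) by simp
    then show ?thesis using c(1) S(4) T'(3) by simp
  qed
  moreover have "fst (run \<alpha> algorithm inp (\<theta>' (length ts))) = Skip" using state[OF order_refl] by auto
  moreover have "\<forall>k<length ts. \<theta>' k < \<theta>' (Suc k)" using \<theta>(1) by (simp add: \<theta>'_def)
  ultimately show ?thesis
    unfolding executes_algorithm_within_def using T(1) bu
    by (intro exI[of _ T] exI[of _ ts] exI[of _ \<theta>'] conjI allI impI) simp_all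
qed

theorem theorem7:
  shows "(\<forall>(G :: 'a pair_pre_digraph) (\<alpha> :: real).
            directed_series_parallel G \<and> 0 < \<alpha> \<and> \<alpha> < 1 \<longrightarrow>
              (\<exists>E'. algorithm_returns \<alpha> G E') \<and>
              (\<forall>E'. algorithm_returns \<alpha> G E' \<longrightarrow> mcps_optimal \<alpha> G E')) \<and>
         (\<exists>(c :: program) (C :: nat). \<forall>(G :: 'a pair_pre_digraph) (\<alpha> :: real) \<nu> es.
            directed_series_parallel G \<and> 0 < \<alpha> \<and> \<alpha> < 1 \<and> graph_encoding G \<nu> es \<longrightarrow>
              executes_algorithm_within \<alpha> G \<nu> es c (C * card (pverts G)))"
proof (intro conjI allI impI)
  fix G :: "'a pair_pre_digraph" and \<alpha> :: real
  assume a: "directed_series_parallel G \<and> 0 < \<alpha> \<and> \<alpha> < 1"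
  obtain s t where st: "dsp s t G" using a by (auto simp: directed_series_parallel_def)
  \<comment> \<open>That a result exists is read off a run of the program: any numbering and any
    edge list will do, and the run supplies a clean tree with a bottom-up order.\<close>
  obtain \<nu> where "bij_betw \<nu> (pverts G) {0..<card (pverts G)}"
    using ex_bij_betw_finite_nat[OF dsp_basic(4)[OF st]] by blast
  moreover obtain es where "set es = parcs G" "distinct es"
    using finite_distinct_list[OF dsp_basic(5)[OF st]] by blast
  ultimately have "graph_encoding G \<nu> es" by (simp add: graph_encoding_def atLeast0LessThan)
  then have "executes_algorithm_within \<alpha> G \<nu> es algorithm (time_factor * card (pverts G))"
    using algorithm_runs a by blast
  then show "\<exists>E'. algorithm_returns \<alpha> G E'"
    unfolding executes_algorithm_within_def algorithm_returns_def by blast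
next
  fix G :: "'a pair_pre_digraph" and \<alpha> :: real and E'
  assume a: "directed_series_parallel G \<and> 0 < \<alpha> \<and> \<alpha> < 1" and "algorithm_returns \<alpha> G E'"
  then obtain T \<sigma>s where T: "clean_decomposition_tree G T" "bottom_up T \<sigma>s" "E' = retained_edges \<alpha> G \<sigma>s"
    by (auto simp: algorithm_returns_def)
  interpret clean_tree T \<alpha>
    by unfold_locales (use T(1) a in \<open>simp_all add: clean_decomposition_tree_def\<close>)
  show "mcps_optimal \<alpha> G E'"
    using retained_optimal[OF T(2)] T(1,3) by (simp add: clean_decomposition_tree_def)
next
  show "\<exists>(c :: program) (C :: nat). \<forall>(G :: 'a pair_pre_digraph) (\<alpha> :: real) \<nu> es.
      directed_series_parallel G \<and> 0 < \<alpha> \<and> \<alpha> < 1 \<and> graph_encoding G \<nu> es \<longrightarrow>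
        executes_algorithm_within \<alpha> G \<nu> es c (C * card (pverts G))"
    using algorithm_runs by blast
qed

end
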